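(* The actions of $GL(2,\mathbb{R})$ on $\mathcal{M}$ and on $\mathcal{E}$ are continuous; that is, the action maps $GL(2,\mathbb{R})\times\mathcal{M}\to\mathcal{M}$ and $GL(2,\mathbb{R})\times\mathcal{E}\to\mathcal{E}$ are continuous with respect to the immersive topologies on $\mathcal{M}$ and $\mathcal{E}$.
   Context: Surfaces and translation structures. A surface is a connected oriented 2-manifold without boundary (possibly non-compact). A translation atlas on a surface $X$ is a collection of pairs $(U_j,\phi_j)$ with the $U_j$ open and covering $X$, and $\phi_j:U_j\to\mathbb{R}^2$ orientation preserving local homeomorphisms, such that on overlaps $U_i\cap U_j$ the transition functions $\phi_i\circ\phi_j^{-1}$ are locally restrictions of translations (i.e. $\phi_i-\phi_j$ is locally constant on $U_i\cap U_j$). A translation structure is a pair $(X,\mathcal{A})$ with $\mathcal{A}$ a maximal translation atlas on $X$. A pointed translation structure is $(X,x_0,\mathcal{A})$ with basepoint $x_0\in X$. An isomorphism $(X,x_0,\mathcal{A})\to(Y,y_0,\mathcal{B})$ is a homeomorphism $h:X\to Y$ with $h(x_0)=y_0$ and $\mathcal{B}=\{(h(U),\phi\circ h^{-1}):(U,\phi)\in\mathcal{A}\}$. The spaces. $\mathcal{M}$ is the set of all isomorphism classes $[X,x_0,\mathcal{A}]$. $\mathcal{E}$ is the set of isomorphism classes $[X,x_0,\mathcal{A};x]$ of pointed translation structures with an additional point $x\in X$ (isomorphisms must also carry the additional point to the additional point). The projection $\pi:\mathcal{E}\to\mathcal{M}$ forgets $x$. The fiber of $\pi$ over $[X,x_0,\mathcal{A}]$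 is in canonical bijection with $X$ via $x\mapsto[X,x_0,\mathcal{A};x]$ and thus is itself a translation surface $S$ isomorphic to $(X,x_0,\mathcal{A})$, with basepoint denoted $o_S$. One identifies a point of $\mathcal{M}$ with the translation surface $S$ above it, and writes points of $\mathcal{E}$ as pairs $(S,s)$ with $S\in\mathcal{M}$, $s\in S$. The actions. For $A\in GL(2,\mathbb{R})$ and a translation atlas $\mathcal{A}=\{(U_j,\phi_j)\}$ on $X$, set $A(\mathcal{A})=\{(U_j,A\circ\phi_j)\}$ (if $\det A<0$, the orientation of $X$ is reversed so that these charts are orientation preserving). The actions are $A:[X,x_0,\mathcal{A}]\mapsto[X,x_0,A(\mathcal{A})]$ on $\mathcal{M}$ and $A:[X,x_0,\mathcal{A};x]\mapsto[X,x_0,A(\mathcal{A});x]$ on $\mathcal{E}$. Immersions. $PC(S)$ is the collection of path-connected subsets of $S$ containing $o_S$. For $A\in PC(S)$ and $B\subset T$ (with $S,T$ translation surfaces), an immersion of $A$ into $B$ is a continuous map $\iota:A\to B$ with $\iota(o_S)=o_T$ such that each $s\in A$ has a chart $(U,\phi)$ of $S$ with $s\in U$, a chart $(V,\psi)$ of $T$, and a vector $v\in\mathbb{R}^2$ with $\iota(U\cap A)\subset V$ and $\psi\circ\iota(s')=v+\phi(s')$ for all $s'\in U\cap A$ (charts from the maximal atlases). Immersions are unique when they exist. Write $A\rightsquigarrow B$ if an immersion exists and $A\not\rightsquigarrow B$ otherwise. Disks. An open disk is a path-connected subset of a translation surface, containing the basepoint, homeomorphic to an open disk. A closed disk is a subset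 of a translation surface homeomorphic to a closed disk and containing the basepoint in its interior; $D^\circ$ denotes the interior of $D$. Immersive topology on $\mathcal{M}$: the coarsest topology in which all the following sets are open: $\{S: D\rightsquigarrow S\}$ for $D$ a closed disk; $\{S: U\not\rightsquigarrow S\}$ for $U$ an open disk; $\mathcal{M}_+(D,U)=\{S:\exists\,\iota:D\rightsquigarrow S\text{ and }o_S\in\iota(U)\}$ for $D$ a closed disk and $U\subset D^\circ$ open; $\mathcal{M}_-(D,K)=\{S:\exists\,\iota:D\rightsquigarrow S\text{ and }o_S\notin\iota(K)\}$ for $D$ a closed disk and $K\subset D$ closed. Immersive topology on $\mathcal{E}$: the coarsest topology such that $\pi:\mathcal{E}\to\mathcal{M}$ is continuous and $\mathcal{E}_+(D,U)=\{(S,s):\exists\,\iota:D\rightsquigarrow S\text{ and }s\in\iota(U)\}$ is open for every closed disk $D$ and open $U\subset D^\circ$. *)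

theory Defs
  imports "HOL-Analysis.Analysis"
begin

section \<open>Translation structures\<close>

text \<open>
  Spaces are HOL-Analysis topologies, so that a surface is a subset of the type \<open>'a\<close> (its
  \<^const>\<open>topspace\<close>) with a topology. A surface has the cardinality of the continuum; hence as
  soon as \<open>'a\<close> is at least that large (for instance \<open>'a = real\<close>), every pointed translation
  structure is isomorphic to one carried by a subset of \<open>'a\<close>, and the sets of isomorphism
  classes below do not depend on \<open>'a\<close>.

  No orientation is recorded. If charts are to preserve orientation, the orientation of the
  surface has to be the one pulled back from \<open>\<real>\<^sup>2\<close> by the charts, and this pullback is always
  consistent because translations preserve orientation. So an oriented surface with a
  translation atlas is the same thing as a surface with a translation atlas, every isomorphism
  of atlases preserves orientation, and post-composing all charts with a matrix of negative
  determinant reverses the orientation.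
\<close>

definition surface :: "'a topology \<Rightarrow> bool" where
  "surface X \<longleftrightarrow>
     connected_space X \<and> Hausdorff_space X \<and> second_countable X \<and>
     (\<forall>x\<in>topspace X. \<exists>U V. openin X U \<and> x \<in> U \<and> open (V :: (real^2) set) \<and>
        subtopology X U homeomorphic_space top_of_set V)"

definition local_homeo_on :: "'a topology \<Rightarrow> 'a set \<Rightarrow> ('a \<Rightarrow> real^2) \<Rightarrow> bool" where
  "local_homeo_on X U \<phi> \<longleftrightarrow>
     (\<forall>x\<in>U. \<exists>W. openin X W \<and> x \<in> W \<and> W \<subseteq> U \<and> open (\<phi> ` W) \<and>
        homeomorphic_map (subtopology X W) (top_of_set (\<phi> ` W)) \<phi>)"

text \<open>
  The second component of a chart is a partial function, normalised by extensionality so that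
  equality of charts, and hence of atlases, is the intended one.
\<close>

type_synonym 'a chart = "'a set \<times> ('a \<Rightarrow> real^2)"

definition translation_atlas :: "'a topology \<Rightarrow> 'a chart set \<Rightarrow> bool" where
  "translation_atlas X \<A> \<longleftrightarrow>
     (\<forall>(U, \<phi>)\<in>\<A>. openin X U \<and> \<phi> \<in> extensional U \<and> local_homeo_on X U \<phi>) \<and>
     (\<Union>(U, \<phi>)\<in>\<A>. U) = topspace X \<and>
     (\<forall>(U, \<phi>)\<in>\<A>. \<forall>(V, \<psi>)\<in>\<A>. \<forall>x\<in>U \<inter> V.
        \<exists>W v. openin X W \<and> x \<in> W \<and> W \<subseteq> U \<inter> V \<and> (\<forall>y\<in>W. \<phi> y - \<psi> y = v))"

definition maximal_translation_atlas :: "'a topology \<Rightarrow> 'a chart set \<Rightarrow> bool" where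
  "maximal_translation_atlas X \<A> \<longleftrightarrow>
     translation_atlas X \<A> \<and> (\<forall>\<B>. translation_atlas X \<B> \<and> \<A> \<subseteq> \<B> \<longrightarrow> \<B> = \<A>)"

record 'a pointed_structure =
  surf :: "'a topology"
  bpt :: 'a
  charts :: "'a chart set"

definition structures :: "'a pointed_structure set" where
  "structures =
     {P. surface (surf P) \<and> bpt P \<in> topspace (surf P) \<and>
         maximal_translation_atlas (surf P) (charts P)}"

text \<open>The chart \<open>(h(U), \<phi> \<circ> h\<^sup>-\<^sup>1)\<close>, where \<open>h\<close> is a bijection defined on \<open>S\<close>.\<close>

definition push_chart :: "'a set \<Rightarrow> ('a \<Rightarrow> 'b) \<Rightarrow> 'a chart \<Rightarrow> 'b chart" where
  "push_chart S h = (\<lambda>(U, \<phi>). (h ` U, restrict (\<phi> \<circ> inv_into S h) (h ` U)))"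

definition is_iso :: "('a \<Rightarrow> 'b) \<Rightarrow> 'a pointed_structure \<Rightarrow> 'b pointed_structure \<Rightarrow> bool" where
  "is_iso h P Q \<longleftrightarrow>
     homeomorphic_map (surf P) (surf Q) h \<and> h (bpt P) = bpt Q \<and>
     charts Q = push_chart (topspace (surf P)) h ` charts P"


section \<open>The sets of isomorphism classes and the projection\<close>

definition iso_rel :: "('a pointed_structure \<times> 'a pointed_structure) set" where
  "iso_rel = {(P, Q). P \<in> structures \<and> Q \<in> structures \<and> (\<exists>h. is_iso h P Q)}"

definition structures_pt :: "('a pointed_structure \<times> 'a) set" where
  "structures_pt = {(P, x). P \<in> structures \<and> x \<in> topspace (surf P)}"

definition iso_rel_pt ::
    "(('a pointed_structure \<times> 'a) \<times> ('a pointed_structure \<times> 'a)) set" where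
  "iso_rel_pt = {((P, x), (Q, y)). (P, x) \<in> structures_pt \<and> (Q, y) \<in> structures_pt \<and>
                   (\<exists>h. is_iso h P Q \<and> h x = y)}"

definition \<M> :: "'a pointed_structure set set" where
  "\<M> = structures // iso_rel"

definition \<E> :: "('a pointed_structure \<times> 'a) set set" where
  "\<E> = structures_pt // iso_rel_pt"

definition proj_\<E> :: "('a pointed_structure \<times> 'a) set \<Rightarrow> 'a pointed_structure set" where
  "proj_\<E> e = (\<Union>(P, x)\<in>e. iso_rel `` {P})"


section \<open>The actions of \<open>GL(2,\<real>)\<close>\<close>

definition GL2 :: "(real^2^2) topology" where
  "GL2 = top_of_set {A. invertible A}"

definition matrix_chart :: "real^2^2 \<Rightarrow> 'a chart \<Rightarrow> 'a chart" where
  "matrix_chart A = (\<lambda>(U, \<phi>). (U, restrict (\<lambda>x. A *v \<phi> x) U))"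

definition act :: "real^2^2 \<Rightarrow> 'a pointed_structure \<Rightarrow> 'a pointed_structure" where
  "act A P = P\<lparr>charts := matrix_chart A ` charts P\<rparr>"

definition act_\<M> :: "real^2^2 \<Rightarrow> 'a pointed_structure set \<Rightarrow> 'a pointed_structure set" where
  "act_\<M> A c = (\<Union>P\<in>c. iso_rel `` {act A P})"

definition act_\<E> ::
    "real^2^2 \<Rightarrow> ('a pointed_structure \<times> 'a) set \<Rightarrow> ('a pointed_structure \<times> 'a) set" where
  "act_\<E> A e = (\<Union>(P, x)\<in>e. iso_rel_pt `` {(act A P, x)})"


section \<open>Immersions and disks\<close>

definition PC :: "'a pointed_structure \<Rightarrow> 'a set set" where
  "PC P = {A. path_connectedin (surf P) A \<and> bpt P \<in> A}"

definition is_immersion ::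
    "'a pointed_structure \<Rightarrow> 'a set \<Rightarrow> 'b pointed_structure \<Rightarrow> 'b set \<Rightarrow> ('a \<Rightarrow> 'b) \<Rightarrow> bool" where
  "is_immersion P A Q B \<iota> \<longleftrightarrow>
     A \<in> PC P \<and> B \<subseteq> topspace (surf Q) \<and>
     continuous_map (subtopology (surf P) A) (subtopology (surf Q) B) \<iota> \<and>
     \<iota> (bpt P) = bpt Q \<and>
     (\<forall>s\<in>A. \<exists>U \<phi> V \<psi> v. (U, \<phi>) \<in> charts P \<and> s \<in> U \<and> (V, \<psi>) \<in> charts Q \<and>
        \<iota> ` (U \<inter> A) \<subseteq> V \<and> (\<forall>s'\<in>U \<inter> A. \<psi> (\<iota> s') = v + \<phi> s'))"

definition open_disk :: "'a pointed_structure \<Rightarrow> 'a set \<Rightarrow> bool" where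
  "open_disk P U \<longleftrightarrow>
     U \<in> PC P \<and> subtopology (surf P) U homeomorphic_space top_of_set (ball (0::real^2) 1)"

definition closed_disk :: "'a pointed_structure \<Rightarrow> 'a set \<Rightarrow> bool" where
  "closed_disk P D \<longleftrightarrow>
     D \<subseteq> topspace (surf P) \<and> bpt P \<in> surf P interior_of D \<and>
     subtopology (surf P) D homeomorphic_space top_of_set (cball (0::real^2) 1)"


section \<open>The immersive topologies\<close>

text \<open>
  A point of \<open>\<M>\<close> is identified with the translation surface above it, which is isomorphic to each
  representative of the class. The conditions below are invariant under isomorphism, so they may
  be tested on some (equivalently, on every) representative. The structure \<open>R\<close> is the translation
  surface in which the disk lies.
\<close>

definition immerses ::
    "'a pointed_structure \<Rightarrow> 'a set \<Rightarrow> 'a pointed_structure set \<Rightarrow> bool" where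
  "immerses R A c \<longleftrightarrow> (\<exists>P\<in>c. \<exists>\<iota>. is_immersion R A P (topspace (surf P)) \<iota>)"

definition \<M>_plus :: "'a pointed_structure \<Rightarrow> 'a set \<Rightarrow> 'a set \<Rightarrow> 'a pointed_structure set set" where
  "\<M>_plus R D U =
     {c \<in> \<M>. \<exists>P\<in>c. \<exists>\<iota>. is_immersion R D P (topspace (surf P)) \<iota> \<and> bpt P \<in> \<iota> ` U}"

definition \<M>_minus :: "'a pointed_structure \<Rightarrow> 'a set \<Rightarrow> 'a set \<Rightarrow> 'a pointed_structure set set" where
  "\<M>_minus R D K =
     {c \<in> \<M>. \<exists>P\<in>c. \<exists>\<iota>. is_immersion R D P (topspace (surf P)) \<iota> \<and> bpt P \<notin> \<iota> ` K}"

definition \<E>_plus ::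
    "'a pointed_structure \<Rightarrow> 'a set \<Rightarrow> 'a set \<Rightarrow> ('a pointed_structure \<times> 'a) set set" where
  "\<E>_plus R D U =
     {e \<in> \<E>. \<exists>(P, x)\<in>e. \<exists>\<iota>. is_immersion R D P (topspace (surf P)) \<iota> \<and> x \<in> \<iota> ` U}"

text \<open>Inserting \<open>\<M>\<close> into the subbasis makes \<open>\<M>\<close> the underlying set by construction.\<close>

definition immersive_topology_\<M> :: "'a pointed_structure set topology" where
  "immersive_topology_\<M> = topology_generated_by
     (insert \<M>
       ({{c \<in> \<M>. immerses R D c} | R D. R \<in> structures \<and> closed_disk R D} \<union>
        {{c \<in> \<M>. \<not> immerses R U c} | R U. R \<in> structures \<and> open_disk R U} \<union>
        {\<M>_plus R D U | R D U. R \<in> structures \<and> closed_disk R D \<and>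
           openin (surf R) U \<and> U \<subseteq> surf R interior_of D} \<union>
        {\<M>_minus R D K | R D K. R \<in> structures \<and> closed_disk R D \<and>
           closedin (surf R) K \<and> K \<subseteq> D}))"

definition immersive_topology_\<E> :: "('a pointed_structure \<times> 'a) set topology" where
  "immersive_topology_\<E> = topology_generated_by
     ({{e \<in> \<E>. proj_\<E> e \<in> W} | W. openin immersive_topology_\<M> W} \<union>
      {\<E>_plus R D U | R D U. R \<in> structures \<and> closed_disk R D \<and>
         openin (surf R) U \<and> U \<subseteq> surf R interior_of D})"


section \<open>The quotient constructions are well defined\<close>

lemma charts_structures:
  assumes "P \<in> structures" "(U, \<phi>) \<in> charts P"
  shows "U \<subseteq> topspace (surf P)" "\<phi> \<in> extensional U"
  using assms openin_subset
  by (force simp: structures_def maximal_translation_atlas_def translation_atlas_def)+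

lemma push_chart_cong:
  assumes "U \<subseteq> S" "\<And>x. x \<in> S \<Longrightarrow> k x = h x"
  shows "push_chart S k (U, \<phi>) = push_chart S h (U, \<phi>)"
proof -
  have "k ` U = h ` U" using assms by (intro image_cong) auto
  moreover have "inv_into S k = inv_into S h"
    unfolding inv_into_def using assms by (intro ext arg_cong[where f = Eps]) auto
  ultimately show ?thesis by (simp add: push_chart_def)
qed

lemma push_chart_id:
  assumes U: "U \<subseteq> S" and \<phi>: "\<phi> \<in> extensional U"
  shows "push_chart S id (U, \<phi>) = (U, \<phi>)"
proof -
  have "restrict (\<phi> \<circ> inv_into S id) U = \<phi>"
  proof (rule extensionalityI[OF _ \<phi>])
    fix x assume x: "x \<in> U"
    then have "inv_into S id (id x) = x"
      using U by (intro inv_into_f_f) auto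
    then show "restrict (\<phi> \<circ> inv_into S id) U x = \<phi> x"
      using x by simp
  qed simp
  then show ?thesis by (simp add: push_chart_def)
qed

lemma push_chart_compose:
  assumes U: "U \<subseteq> S" and h: "inj_on h S" "h ` S = T" and k: "inj_on k T"
  shows "push_chart T k (push_chart S h (U, \<phi>)) = push_chart S (k \<circ> h) (U, \<phi>)"
proof -
  have "restrict (restrict (\<phi> \<circ> inv_into S h) (h ` U) \<circ> inv_into T k) (k ` h ` U)
      = restrict (\<phi> \<circ> inv_into S (k \<circ> h)) (k ` h ` U)"
  proof (rule restrict_ext)
    fix y assume "y \<in> k ` h ` U"
    then obtain u where u: "u \<in> U" "y = k (h u)" by auto
    have uS: "u \<in> S" using u U by auto
    have "inj_on (k \<circ> h) S" using h k by (simp add: comp_inj_on)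
    then have "inv_into S (k \<circ> h) y = u" using u uS by (simp add: inv_into_f_eq)
    moreover have "inv_into T k y = h u" using u uS h k by (auto intro!: inv_into_f_eq)
    moreover have "inv_into S h (h u) = u" using uS h by simp
    ultimately show "(restrict (\<phi> \<circ> inv_into S h) (h ` U) \<circ> inv_into T k) y
        = (\<phi> \<circ> inv_into S (k \<circ> h)) y"
      using u by simp
  qed
  then show ?thesis by (simp add: push_chart_def image_comp)
qed

lemma is_iso_id:
  assumes "P \<in> structures"
  shows "is_iso id P P"
proof -
  have "push_chart (topspace (surf P)) id c = c" if "c \<in> charts P" for c
    using that charts_structures[OF assms] by (cases c) (auto intro!: push_chart_id)
  then show ?thesis by (simp add: is_iso_def)
qed

lemma is_iso_compose:
  assumes P: "P \<in> structures" and h: "is_iso h P Q" and k: "is_iso k Q R"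
  shows "is_iso (k \<circ> h) P R"
proof -
  have hm: "homeomorphic_map (surf P) (surf Q) h" and km: "homeomorphic_map (surf Q) (surf R) k"
    using h k by (auto simp: is_iso_def)
  have "push_chart (topspace (surf Q)) k (push_chart (topspace (surf P)) h c)
      = push_chart (topspace (surf P)) (k \<circ> h) c" if "c \<in> charts P" for c
    using that hm km charts_structures(1)[OF P]
    by (cases c) (auto simp: homeomorphic_eq_everything_map intro!: push_chart_compose)
  then show ?thesis
    using h k homeomorphic_map_compose[OF hm km] by (auto simp: is_iso_def image_image)
qed

lemma is_iso_inverse:
  assumes P: "P \<in> structures" and h: "is_iso h P Q"
  shows "is_iso (inv_into (topspace (surf P)) h) Q P"
proof -
  let ?S = "topspace (surf P)" and ?T = "topspace (surf Q)"
  let ?g = "inv_into ?S h"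
  have hm: "homeomorphic_map (surf P) (surf Q) h" using h by (simp add: is_iso_def)
  then have inj: "inj_on h ?S" and im: "h ` ?S = ?T"
    by (auto simp: homeomorphic_eq_everything_map)
  obtain g where g: "homeomorphic_maps (surf P) (surf Q) h g"
    using hm by (auto simp: homeomorphic_map_maps)
  have gh: "g y = ?g y" if y: "y \<in> ?T" for y
  proof -
    obtain x where x: "x \<in> ?S" "y = h x" using y im by blast
    then have "g y = x" using g by (simp add: homeomorphic_maps_map)
    then show ?thesis using x inj by simp
  qed
  have gm: "homeomorphic_map (surf Q) (surf P) ?g"
    by (rule homeomorphic_map_eq[of _ _ g]) (use g gh in \<open>auto simp: homeomorphic_maps_map\<close>)
  have injg: "inj_on ?g ?T" using gm by (auto simp: homeomorphic_eq_everything_map)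
  have "push_chart ?T ?g (push_chart ?S h c) = c" if "c \<in> charts P" for c
  proof -
    obtain U \<phi> where c: "c = (U, \<phi>)" by (cases c)
    then have U: "U \<subseteq> ?S" and \<phi>: "\<phi> \<in> extensional U"
      using charts_structures[OF P] that by auto
    have "push_chart ?T ?g (push_chart ?S h (U, \<phi>)) = push_chart ?S (?g \<circ> h) (U, \<phi>)"
      by (rule push_chart_compose[OF U inj im injg])
    also have "\<dots> = push_chart ?S id (U, \<phi>)"
      by (rule push_chart_cong[OF U]) (simp add: inj)
    also have "\<dots> = (U, \<phi>)" by (rule push_chart_id[OF U \<phi>])
    finally show ?thesis by (simp add: c)
  qed
  then have "charts P = push_chart ?T ?g ` charts Q"
    using h by (simp add: is_iso_def image_image)
  moreover have "?g (bpt Q) = bpt P"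
  proof -
    have "bpt Q = h (bpt P)" "bpt P \<in> ?S" using h P by (auto simp: is_iso_def structures_def)
    then show ?thesis using inj by simp
  qed
  ultimately show ?thesis using gm by (simp add: is_iso_def)
qed

lemma equiv_iso_rel_pt: "equiv (structures_pt :: ('a pointed_structure \<times> 'a) set) iso_rel_pt"
proof -
  let ?r = "iso_rel_pt :: (('a pointed_structure \<times> 'a) \<times> ('a pointed_structure \<times> 'a)) set"
  have "?r \<subseteq> structures_pt \<times> structures_pt" by (auto simp: iso_rel_pt_def)
  moreover have "refl_on structures_pt ?r"
    by (force simp: refl_on_def iso_rel_pt_def structures_pt_def dest: is_iso_id)
  moreover have "sym ?r"
  proof -
    have "((Q, y), (P, x)) \<in> iso_rel_pt" if r: "((P, x), (Q, y)) \<in> iso_rel_pt"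
      for P Q :: "'a pointed_structure" and x y
    proof -
      obtain h where h: "is_iso h P Q" "h x = y" and P: "P \<in> structures" "x \<in> topspace (surf P)"
        using r by (auto simp: iso_rel_pt_def structures_pt_def)
      then have "inv_into (topspace (surf P)) h y = x"
        by (auto simp: is_iso_def homeomorphic_eq_everything_map)
      then show ?thesis
        using r is_iso_inverse[OF P(1) h(1)] by (auto simp: iso_rel_pt_def)
    qed
    then show ?thesis unfolding sym_def by fast
  qed
  moreover have "trans ?r"
  proof -
    have "((P, x), (R, z)) \<in> iso_rel_pt"
      if r: "((P, x), (Q, y)) \<in> iso_rel_pt" "((Q, y), (R, z)) \<in> iso_rel_pt"
      for P Q R :: "'a pointed_structure" and x y z
    proof -
      obtain h k where "is_iso h P Q" "h x = y" "is_iso k Q R" "k y = z" "P \<in> structures"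
        using r by (auto simp: iso_rel_pt_def structures_pt_def)
      then have "is_iso (k \<circ> h) P R" "(k \<circ> h) x = z"
        using is_iso_compose[of P h Q k R] by auto
      then show ?thesis using r by (auto simp: iso_rel_pt_def)
    qed
    then show ?thesis unfolding trans_def by fast
  qed
  ultimately show ?thesis by (rule equivI)
qed

lemma equiv_iso_rel: "equiv structures iso_rel"
proof (rule equivI)
  show "iso_rel \<subseteq> structures \<times> structures" by (auto simp: iso_rel_def)
  show "refl_on structures iso_rel"
    by (auto simp: refl_on_def iso_rel_def dest: is_iso_id)
  show "sym iso_rel"
    by (auto simp: sym_def iso_rel_def dest: is_iso_inverse)
  show "trans iso_rel"
    by (auto simp: trans_def iso_rel_def dest: is_iso_compose)
qed

lemma topspace_immersive_topology_\<M> [simp]: "topspace immersive_topology_\<M> = \<M>"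
  by (auto simp: immersive_topology_\<M>_def \<M>_plus_def \<M>_minus_def)

lemma iso_rel_pt_imp_iso_rel: "((P, x), (Q, y)) \<in> iso_rel_pt \<Longrightarrow> (P, Q) \<in> iso_rel"
  by (auto simp: iso_rel_pt_def iso_rel_def structures_pt_def)

lemma iso_class_congruent:
  assumes "equiv A r" "equiv B s" "a \<in> A" "\<And>x y. (x, y) \<in> r \<Longrightarrow> (f x, f y) \<in> s"
  shows "(\<Union>x\<in>r `` {a}. s `` {f x}) = s `` {f a}"
  using assms by (intro UN_equiv_class[of A r "\<lambda>x. s `` {f x}"])
    (auto intro!: congruentI equiv_class_eq[OF assms(2)])

lemma proj_\<E>_class:
  assumes "(P, x) \<in> structures_pt"
  shows "proj_\<E> (iso_rel_pt `` {(P, x)}) = iso_rel `` {P}"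
proof -
  have "(\<Union>e\<in>iso_rel_pt `` {(P, x)}. iso_rel `` {fst e}) = iso_rel `` {fst (P, x)}"
    by (rule iso_class_congruent[OF equiv_iso_rel_pt equiv_iso_rel assms])
       (auto dest: iso_rel_pt_imp_iso_rel)
  then show ?thesis by (simp add: proj_\<E>_def case_prod_unfold)
qed

lemma proj_\<E>_in_\<M>: "e \<in> \<E> \<Longrightarrow> proj_\<E> e \<in> \<M>"
  by (auto simp: \<E>_def \<M>_def quotient_def proj_\<E>_class structures_pt_def)

lemma topspace_immersive_topology_\<E> [simp]: "topspace immersive_topology_\<E> = \<E>"
proof
  show "topspace immersive_topology_\<E> \<subseteq> \<E>"
    unfolding immersive_topology_\<E>_def topology_generated_by_topspace
    by (auto simp: \<E>_plus_def)
  have "{e \<in> \<E>. proj_\<E> e \<in> \<M>} \<subseteq> topspace immersive_topology_\<E>"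
    unfolding immersive_topology_\<E>_def topology_generated_by_topspace
    by (intro Union_upper UnI1 CollectI exI[of _ \<M>] conjI refl)
       (use openin_topspace[of immersive_topology_\<M>] in simp)
  then show "\<E> \<subseteq> topspace immersive_topology_\<E>" using proj_\<E>_in_\<M> by blast
qed

lemma local_homeo_on_matrix:
  assumes A: "invertible A" and \<phi>: "local_homeo_on X U \<phi>"
  shows "local_homeo_on X U (restrict (\<lambda>x. A *v \<phi> x) U)"
  unfolding local_homeo_on_def
proof
  fix x assume "x \<in> U"
  then obtain W where W: "openin X W" "x \<in> W" "W \<subseteq> U" "open (\<phi> ` W)"
    "homeomorphic_map (subtopology X W) (top_of_set (\<phi> ` W)) \<phi>"
    using \<phi> unfolding local_homeo_on_def by blast
  obtain B where B: "A ** B = mat 1" "B ** A = mat 1"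
    using A by (auto simp: invertible_def)
  have BA: "B *v (A *v v) = v" "A *v (B *v v) = v" for v
    using B by (simp_all add: matrix_vector_mul_assoc)
  let ?\<psi> = "restrict (\<lambda>x. A *v \<phi> x) U"
  have im: "?\<psi> ` W = (*v) A ` \<phi> ` W" using W(3) by (auto simp: image_image intro!: image_cong)
  have "surj ((*v) A)" by (metis BA(2) surjI)
  then have op: "open (?\<psi> ` W)"
    unfolding im using W(4) by (intro open_surjective_linear_image) auto
  have "homeomorphic_maps (top_of_set (\<phi> ` W)) (top_of_set (?\<psi> ` W)) ((*v) A) ((*v) B)"
    unfolding im homeomorphic_maps_def
    by (auto simp: BA intro!: linear_continuous_on bounded_linear_intros)
  then have "homeomorphic_map (top_of_set (\<phi> ` W)) (top_of_set (?\<psi> ` W)) ((*v) A)"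
    by (auto simp: homeomorphic_map_maps)
  then have "homeomorphic_map (subtopology X W) (top_of_set (?\<psi> ` W)) ((*v) A \<circ> \<phi>)"
    by (rule homeomorphic_map_compose[OF W(5)])
  then have "homeomorphic_map (subtopology X W) (top_of_set (?\<psi> ` W)) ?\<psi>"
    by (rule homeomorphic_map_eq) (use W(3) in auto)
  then show "\<exists>W. openin X W \<and> x \<in> W \<and> W \<subseteq> U \<and> open (?\<psi> ` W) \<and>
      homeomorphic_map (subtopology X W) (top_of_set (?\<psi> ` W)) ?\<psi>"
    using W op by blast
qed

lemma translation_atlas_matrix:
  assumes A: "invertible A" and T: "translation_atlas X \<A>"
  shows "translation_atlas X (matrix_chart A ` \<A>)"
  unfolding translation_atlas_def
proof (intro conjI)
  show "\<forall>(U, \<phi>)\<in>matrix_chart A ` \<A>. openin X U \<and> \<phi> \<in> extensional U \<and> local_homeo_on X U \<phi>"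
    using T A by (auto simp: translation_atlas_def matrix_chart_def intro!: local_homeo_on_matrix)
  show "(\<Union>(U, \<phi>)\<in>matrix_chart A ` \<A>. U) = topspace X"
    using T by (simp add: translation_atlas_def matrix_chart_def case_prod_unfold)
  have trans: "\<forall>(U, \<phi>)\<in>\<A>. \<forall>(V, \<psi>)\<in>\<A>. \<forall>x\<in>U \<inter> V.
      \<exists>W v. openin X W \<and> x \<in> W \<and> W \<subseteq> U \<inter> V \<and> (\<forall>y\<in>W. \<phi> y - \<psi> y = v)"
    using T unfolding translation_atlas_def by (elim conjE)
  have "\<exists>W w. openin X W \<and> x \<in> W \<and> W \<subseteq> U \<inter> V \<and>
      (\<forall>y\<in>W. restrict (\<lambda>x. A *v \<phi> x) U y - restrict (\<lambda>x. A *v \<psi> x) V y = w)"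
    if UV: "(U, \<phi>) \<in> \<A>" "(V, \<psi>) \<in> \<A>" "x \<in> U \<inter> V" for U \<phi> V \<psi> x
  proof -
    obtain W v where W: "openin X W" "x \<in> W" "W \<subseteq> U \<inter> V" "\<forall>y\<in>W. \<phi> y - \<psi> y = v"
      using bspec[OF bspec[OF bspec[OF trans UV(1), unfolded split_conv] UV(2), unfolded split_conv] UV(3)]
      by (elim exE conjE)
    have "restrict (\<lambda>x. A *v \<phi> x) U y - restrict (\<lambda>x. A *v \<psi> x) V y = A *v v" if "y \<in> W" for y
    proof -
      have "y \<in> U" "y \<in> V" using W(3) that by auto
      then show ?thesis using W(4) that by (simp flip: matrix_vector_mult_diff_distrib)
    qed
    then show ?thesis using W by blast
  qed
  then show "\<forall>(U, \<phi>)\<in>matrix_chart A ` \<A>. \<forall>(V, \<psi>)\<in>matrix_chart A ` \<A>. \<forall>x\<in>U \<inter> V.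
      \<exists>W v. openin X W \<and> x \<in> W \<and> W \<subseteq> U \<inter> V \<and> (\<forall>y\<in>W. \<phi> y - \<psi> y = v)"
    unfolding matrix_chart_def ball_simps split_def fst_conv snd_conv
    by (intro ballI) simp
qed

lemma matrix_chart_inverse:
  assumes "B ** A = mat 1" "\<phi> \<in> extensional U"
  shows "matrix_chart B (matrix_chart A (U, \<phi>)) = (U, \<phi>)"
  using assms
  by (auto simp: matrix_chart_def matrix_vector_mul_assoc extensional_def restrict_def)

lemma matrix_chart_image_inverse:
  assumes "B ** A = mat 1" "translation_atlas X \<A>"
  shows "matrix_chart B ` matrix_chart A ` \<A> = \<A>"
proof -
  have "matrix_chart B (matrix_chart A c) = c" if "c \<in> \<A>" for c
    using that assms matrix_chart_inverse[OF assms(1)]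
    by (cases c) (force simp: translation_atlas_def)
  then show ?thesis by (simp add: image_image)
qed

lemma act_structures:
  assumes A: "invertible A" and P: "P \<in> structures"
  shows "act A P \<in> structures"
proof -
  obtain B where B: "A ** B = mat 1" "B ** A = mat 1"
    using A by (auto simp: invertible_def)
  then have iB: "invertible B" by (auto simp: invertible_def)
  have P': "translation_atlas (surf P) (charts P)"
    "\<And>\<B>. translation_atlas (surf P) \<B> \<Longrightarrow> charts P \<subseteq> \<B> \<Longrightarrow> \<B> = charts P"
    using P by (auto simp: structures_def maximal_translation_atlas_def)
  have "\<B> = matrix_chart A ` charts P"
    if \<B>: "translation_atlas (surf P) \<B>" "matrix_chart A ` charts P \<subseteq> \<B>" for \<B>
  proof -
    have "charts P \<subseteq> matrix_chart B ` \<B>"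
      using image_mono[OF \<B>(2), of "matrix_chart B"] matrix_chart_image_inverse[OF B(2) P'(1)]
      by simp
    then have "matrix_chart B ` \<B> = charts P"
      using P'(2) translation_atlas_matrix[OF iB \<B>(1)] by blast
    then show ?thesis using matrix_chart_image_inverse[OF B(1) \<B>(1)] by simp
  qed
  then have "maximal_translation_atlas (surf P) (matrix_chart A ` charts P)"
    using translation_atlas_matrix[OF A P'(1)] by (auto simp: maximal_translation_atlas_def)
  then show ?thesis using P by (simp add: structures_def act_def)
qed

lemma is_iso_act:
  assumes P: "P \<in> structures" and h: "is_iso h P Q"
  shows "is_iso h (act A P) (act A Q)"
proof -
  let ?S = "topspace (surf P)"
  have "matrix_chart A (push_chart ?S h c) = push_chart ?S h (matrix_chart A c)"
    if "c \<in> charts P" for c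
  proof -
    obtain U \<phi> where c: "c = (U, \<phi>)" by (cases c)
    then have "U \<subseteq> ?S" using charts_structures(1)[OF P] that by auto
    moreover have "inj_on h ?S" using h by (auto simp: is_iso_def homeomorphic_eq_everything_map)
    ultimately show ?thesis
      by (auto simp: c matrix_chart_def push_chart_def restrict_def fun_eq_iff subset_iff)
  qed
  then show ?thesis using h by (auto simp: is_iso_def act_def image_image)
qed

lemma act_\<M>_class:
  assumes A: "invertible A" and P: "P \<in> structures"
  shows "act_\<M> A (iso_rel `` {P}) = iso_rel `` {act A P}"
  unfolding act_\<M>_def
  by (rule iso_class_congruent[OF equiv_iso_rel equiv_iso_rel P])
     (use A in \<open>auto simp: iso_rel_def intro: act_structures is_iso_act\<close>)

lemma act_\<E>_class:
  assumes A: "invertible A" and P: "(P, x) \<in> structures_pt"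
  shows "act_\<E> A (iso_rel_pt `` {(P, x)}) = iso_rel_pt `` {(act A P, x)}"
proof -
  have surf: "surf (act A Q) = surf Q" for Q :: "'a pointed_structure" by (simp add: act_def)
  have "(\<Union>e\<in>iso_rel_pt `` {(P, x)}. iso_rel_pt `` {(act A (fst e), snd e)})
      = iso_rel_pt `` {(act A (fst (P, x)), snd (P, x))}"
    by (rule iso_class_congruent[OF equiv_iso_rel_pt equiv_iso_rel_pt P])
       (use A in \<open>auto simp: iso_rel_pt_def structures_pt_def surf intro: act_structures intro!: is_iso_act exI\<close>)
  then show ?thesis by (simp add: act_\<E>_def case_prod_unfold)
qed

end

theory Submission
  imports Defs "HOL-Complex_Analysis.Conformal_Mappings"
begin

text \<open>
  Transition functions are translations, so a map \<open>\<beta>\<close> from a connected parameter space \<open>K\<close> to a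
  translation surface is determined by one value and by its developed map \<open>d : K \<rightarrow> \<real>\<^sup>2\<close>, the
  function that agrees with \<open>\<phi> \<circ> \<beta>\<close> up to a constant near each point, for every chart \<open>\<phi>\<close>
  (\<open>develops\<close>, \<open>develops_unique\<close>). A closed disk is the homeomorphic image of the unit disk, which is
  compact and convex, so its parametrization has a global developed map \<open>d\<close>, and the disk immerses
  in \<open>S\<close> iff \<open>d\<close> lifts to \<open>S\<close> from the basepoint (\<open>immerses_iff\<close>; \<open>\<M>_plus_iff\<close>, \<open>\<M>_minus_iff\<close>
  and \<open>\<E>_plus_iff\<close> say the same for the other subbasic sets). The matrix \<open>A\<close> just replaces
  developed maps \<open>d\<close> by \<open>A d\<close>: a lift of \<open>d\<close> to \<open>A S\<close> is a lift of \<open>A\<^sup>-\<^sup>1 d\<close> to \<open>S\<close>.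
  For a fixed \<open>A\<close> this makes the preimage of a subbasic set subbasic, with the disk moved to
  another structure. As the action is multiplicative, joint continuity then only has to be checked at
  the identity (\<open>action_continuous\<close>): if \<open>S\<^sub>0\<close> lies in a subbasic set, then so does \<open>A S\<close> for all
  \<open>A\<close> near the identity and all \<open>S\<close> near \<open>S\<^sub>0\<close>.

  The heart of the matter is therefore this: if \<open>d\<close> lifts to \<open>S\<^sub>0\<close>, then \<open>A d\<close> lifts to every \<open>S\<close>
  near \<open>S\<^sub>0\<close>, and the lift moves little. A closed disk slightly larger than the given one would
  do, but its boundary may be any Jordan curve, so that a collar could only come from a Schoenflies
  theorem for surfaces. The lift is instead rebuilt point by point. For each \<open>z\<close> in the unit disk, the
  image under \<open>d\<close> of the segment from the base parameter to \<open>z\<close> is approximated by a curve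
  \<open>F z\<close> in the plane with the same ends that is the restriction to \<open>[0,1]\<close> of an entire function with
  no critical point on \<open>[0,1]\<close>: a Bernstein polynomial, plus a tiny circle traversed so fast that its
  speed dominates (\<open>regular_approximation\<close>). A thin rectangle around \<open>[0,1]\<close>, with \<open>F z\<close> as
  its developed map, is a closed disk in a translation structure of its own, and it immerses in
  \<open>S\<^sub>0\<close>. That these tubes immerse in \<open>S\<close> is an open condition on \<open>S\<close>. Finitely many of them
  suffice, because the tube of \<open>z\<close> contains the lifts of \<open>A F z'\<close> for all \<open>z'\<close> near \<open>z\<close> and \<open>A\<close> near the
  identity, and the end points of these lifts form the lift of \<open>A d\<close> (\<open>tube_cover_exists\<close>). Uniqueness
  of lifts makes it well defined. One more small round disk at the basepoint
  guarantees that the loop belonging to the base parameter itself lifts to a loop.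

  The end point formula of \<open>tube_cover\<close> locates single points of the lift, which handles
  \<open>\<M>_plus\<close> and \<open>\<E>_plus\<close> (\<open>near_id_lifts_at\<close>) and \<open>\<M>_minus\<close> (\<open>near_id_lifts_avoiding\<close>). For the sets
  of surfaces in which an open disk \<open>U\<close> does not immerse, \<open>U\<close> is first shrunk to a smaller disk \<open>U'\<close>
  that still does not immerse in \<open>S\<^sub>0\<close>. Covering the closure of \<open>U'\<close> by tubes inside \<open>U\<close> shows that
  an immersion of \<open>U\<close> in \<open>A S\<close> yields one of \<open>U'\<close> in \<open>S\<close> (\<open>near_id_not_immerses\<close>).
\<close>

section \<open>Charts of a translation structure\<close>

lemma surf_act [simp]: "surf (act A P) = surf P" and bpt_act [simp]: "bpt (act A P) = bpt P"
  by (simp_all add: act_def)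

lemma structure_Hausdorff: "P \<in> structures \<Longrightarrow> Hausdorff_space (surf P)"
  and structure_bpt: "P \<in> structures \<Longrightarrow> bpt P \<in> topspace (surf P)"
  and structure_atlas: "P \<in> structures \<Longrightarrow> translation_atlas (surf P) (charts P)"
  and structure_maximal:
    "P \<in> structures \<Longrightarrow> translation_atlas (surf P) \<B> \<Longrightarrow> charts P \<subseteq> \<B> \<Longrightarrow> \<B> = charts P"
  by (auto simp: structures_def surface_def maximal_translation_atlas_def)

lemma chart_openin:
  assumes "P \<in> structures" "(U, \<phi>) \<in> charts P"
  shows "openin (surf P) U" "local_homeo_on (surf P) U \<phi>" "\<phi> \<in> extensional U"
  using structure_atlas[OF assms(1)] assms(2) unfolding translation_atlas_def by auto

lemma diff_swap: "a - b = c - d \<Longrightarrow> a - c = b - d" for a :: "'b::ab_group_add"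
  by (metis add_diff_cancel_left' add_diff_eq diff_add_cancel add.commute)

lemma chart_exists:
  assumes "P \<in> structures" "x \<in> topspace (surf P)"
  obtains U \<phi> where "(U, \<phi>) \<in> charts P" "x \<in> U"
proof -
  have "(\<Union>(U, \<phi>)\<in>charts P. U) = topspace (surf P)"
    using structure_atlas[OF assms(1)] unfolding translation_atlas_def by blast
  then show ?thesis using assms(2) that by auto
qed

lemma chart_compat:
  assumes "P \<in> structures" "(U, \<phi>) \<in> charts P" "(V, \<psi>) \<in> charts P" "x \<in> U" "x \<in> V"
  obtains W where "openin (surf P) W" "x \<in> W" "W \<subseteq> U \<inter> V"
    "\<And>y. y \<in> W \<Longrightarrow> \<phi> y - \<phi> x = \<psi> y - \<psi> x"
proof -
  have "\<forall>(U, \<phi>)\<in>charts P. \<forall>(V, \<psi>)\<in>charts P. \<forall>x\<in>U \<inter> V.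
        \<exists>W v. openin (surf P) W \<and> x \<in> W \<and> W \<subseteq> U \<inter> V \<and> (\<forall>y\<in>W. \<phi> y - \<psi> y = v)"
    using structure_atlas[OF assms(1)] unfolding translation_atlas_def by blast
  from bspec[OF bspec[OF bspec[OF this assms(2), unfolded split_conv] assms(3), unfolded split_conv], of x]
  obtain W v where W: "openin (surf P) W" "x \<in> W" "W \<subseteq> U \<inter> V" "\<forall>y\<in>W. \<phi> y - \<psi> y = v"
    using assms(4,5) by auto
  have "\<phi> y - \<phi> x = \<psi> y - \<psi> x" if "y \<in> W" for y
  proof -
    have "\<phi> y - \<psi> y = v" "\<phi> x - \<psi> x = v" using W that by auto
    then show ?thesis by (simp add: algebra_simps)
  qed
  then show ?thesis using W that by blast
qed

lemma continuous_map_local: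
  assumes "\<And>x. x \<in> topspace X \<Longrightarrow> \<exists>T. openin X T \<and> x \<in> T \<and> continuous_map (subtopology X T) Y f"
  shows "continuous_map X Y f"
proof -
  obtain T where T: "\<And>x. x \<in> topspace X \<Longrightarrow> openin X (T x) \<and> x \<in> T x \<and> continuous_map (subtopology X (T x)) Y f"
    using assms by metis
  show ?thesis
    by (rule pasting_lemma[of "topspace X" X T Y "\<lambda>_. f"]) (use T in auto)
qed

lemma local_homeo_on_continuous:
  assumes U: "openin X U" and \<phi>: "local_homeo_on X U \<phi>"
  shows "continuous_map (subtopology X U) euclidean \<phi>"
proof (rule continuous_map_local)
  fix x assume "x \<in> topspace (subtopology X U)"
  then have "x \<in> U" by simp
  then obtain W where W: "openin X W" "x \<in> W" "W \<subseteq> U" "open (\<phi> ` W)"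
    "homeomorphic_map (subtopology X W) (top_of_set (\<phi> ` W)) \<phi>"
    using \<phi> unfolding local_homeo_on_def by blast
  have "continuous_map (subtopology X W) euclidean \<phi>"
    using homeomorphic_imp_continuous_map[OF W(5)] by (auto simp: continuous_map_in_subtopology)
  moreover have "U \<inter> W = W" using W(3) by blast
  moreover have "openin (subtopology X U) W"
    using W U by (simp add: openin_open_subtopology)
  ultimately show "\<exists>T. openin (subtopology X U) T \<and> x \<in> T \<and> continuous_map (subtopology (subtopology X U) T) euclidean \<phi>"
    using W by (auto simp: subtopology_subtopology)
qed

lemma local_homeo_on_subset:
  assumes \<phi>: "local_homeo_on X U \<phi>" and V: "openin X V" "V \<subseteq> U" and eq: "\<And>x. x \<in> V \<Longrightarrow> \<psi> x = \<phi> x + v"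
  shows "local_homeo_on X V \<psi>"
  unfolding local_homeo_on_def
proof
  fix x assume x: "x \<in> V"
  then obtain W where W: "openin X W" "x \<in> W" "W \<subseteq> U" "open (\<phi> ` W)"
    "homeomorphic_map (subtopology X W) (top_of_set (\<phi> ` W)) \<phi>"
    using \<phi> V unfolding local_homeo_on_def by blast
  let ?W = "W \<inter> V"
  have WX: "W \<subseteq> topspace X" using W(1) openin_subset by blast
  have im: "\<psi> ` ?W = (+) v ` \<phi> ` ?W" using eq by (force simp: image_image add.commute)
  have "openin (subtopology X W) ?W" using W V by (auto simp: openin_subtopology)
  then have "openin (top_of_set (\<phi> ` W)) (\<phi> ` ?W)"
    using homeomorphic_map_openness[OF W(5), of ?W] WX by auto
  then have op: "open (\<phi> ` ?W)" using W(4) openin_open_trans by blast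
  have "homeomorphic_map (subtopology (subtopology X W) ?W) (subtopology (top_of_set (\<phi> ` W)) (\<phi> ` ?W)) \<phi>"
    by (rule homeomorphic_map_subtopologies_alt[OF W(5)]) (use WX homeomorphic_imp_injective_map[OF W(5)] in \<open>auto simp: inj_on_def\<close>)
  moreover have "W \<inter> ?W = ?W" "\<phi> ` W \<inter> \<phi> ` ?W = \<phi> ` ?W" by auto
  ultimately have hom: "homeomorphic_map (subtopology X ?W) (top_of_set (\<phi> ` ?W)) \<phi>"
    by (simp add: subtopology_subtopology)
  have "homeomorphic_maps (top_of_set (\<phi> ` ?W)) (top_of_set (\<psi> ` ?W)) ((+) v) ((+) (- v))"
    unfolding im homeomorphic_maps_def by (auto intro!: continuous_intros)
  then have "homeomorphic_map (top_of_set (\<phi> ` ?W)) (top_of_set (\<psi> ` ?W)) ((+) v)"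
    using homeomorphic_map_maps by blast
  from homeomorphic_map_compose[OF hom this]
  have "homeomorphic_map (subtopology X ?W) (top_of_set (\<psi> ` ?W)) \<psi>"
    by (rule homeomorphic_map_eq) (use eq in \<open>auto simp: add.commute\<close>)
  moreover have "open (\<psi> ` ?W)" unfolding im using op by (rule open_translation)
  ultimately show "\<exists>W. openin X W \<and> x \<in> W \<and> W \<subseteq> V \<and> open (\<psi> ` W) \<and>
      homeomorphic_map (subtopology X W) (top_of_set (\<psi> ` W)) \<psi>"
    using W V x by (intro exI[of _ ?W]) auto
qed

definition compatible :: "'a topology \<Rightarrow> 'a chart \<Rightarrow> 'a chart \<Rightarrow> bool" where
  "compatible X c c' \<longleftrightarrow> (\<forall>x\<in>fst c \<inter> fst c'. \<exists>W v. openin X W \<and> x \<in> W \<and> W \<subseteq> fst c \<inter> fst c' \<and>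
     (\<forall>y\<in>W. snd c y - snd c' y = v))"

lemma translation_atlas_iff:
  "translation_atlas X \<A> \<longleftrightarrow>
     (\<forall>(U, \<phi>)\<in>\<A>. openin X U \<and> \<phi> \<in> extensional U \<and> local_homeo_on X U \<phi>) \<and>
     (\<Union>(U, \<phi>)\<in>\<A>. U) = topspace X \<and> (\<forall>c\<in>\<A>. \<forall>c'\<in>\<A>. compatible X c c')"
  unfolding translation_atlas_def compatible_def split_def ..

lemma compatible_sym:
  assumes "compatible X c c'"
  shows "compatible X c' c"
  unfolding compatible_def
proof
  fix x assume "x \<in> fst c' \<inter> fst c"
  then obtain W v where W: "openin X W" "x \<in> W" "W \<subseteq> fst c \<inter> fst c'" "\<forall>y\<in>W. snd c y - snd c' y = v"
    using assms unfolding compatible_def by (metis Int_iff)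
  have "\<forall>y\<in>W. snd c' y - snd c y = - v" using W(4) by (metis minus_diff_eq)
  then show "\<exists>W v. openin X W \<and> x \<in> W \<and> W \<subseteq> fst c' \<inter> fst c \<and> (\<forall>y\<in>W. snd c' y - snd c y = v)"
    using W by (intro exI[of _ W] exI[of _ "- v"]) auto
qed

text \<open>
  Restricting a chart keeps it compatible with all others, so maximality of the atlas puts the
  restriction into it. Hence every point has arbitrarily small charts.
\<close>

lemma chart_restrict:
  assumes P: "P \<in> structures" and U: "(U, \<phi>) \<in> charts P" and V: "openin (surf P) V" "V \<subseteq> U"
  shows "(V, restrict \<phi> V) \<in> charts P"
proof -
  let ?X = "surf P" and ?c = "(V, restrict \<phi> V)"
  let ?B = "insert ?c (charts P)"
  note at = structure_atlas[OF P, unfolded translation_atlas_iff]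
  have 1: "compatible ?X ?c c'" if c': "c' \<in> charts P" for c'
    unfolding compatible_def fst_conv snd_conv
  proof
    fix x assume x: "x \<in> V \<inter> fst c'"
    obtain V' \<psi> where c'_eq: "c' = (V', \<psi>)" by (cases c')
    have V': "(V', \<psi>) \<in> charts P" and xU: "x \<in> U" "x \<in> V'" using c' x V c'_eq by auto
    obtain W where W: "openin (surf P) W" "x \<in> W" "W \<subseteq> U \<inter> V'"
      "\<And>y. y \<in> W \<Longrightarrow> \<phi> y - \<phi> x = \<psi> y - \<psi> x"
      using chart_compat[OF P U V' xU] by metis
    have "\<forall>y\<in>W \<inter> V. restrict \<phi> V y - snd c' y = \<phi> x - \<psi> x"
    proof
      fix y assume "y \<in> W \<inter> V"
      then show "restrict \<phi> V y - snd c' y = \<phi> x - \<psi> x"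
        using diff_swap[OF W(4)[of y]] c'_eq by auto
    qed
    moreover have "openin ?X (W \<inter> V)" "x \<in> W \<inter> V" "W \<inter> V \<subseteq> V \<inter> fst c'" using W(1-3) x V c'_eq by auto
    ultimately show "\<exists>W v. openin ?X W \<and> x \<in> W \<and> W \<subseteq> V \<inter> fst c' \<and> (\<forall>y\<in>W. restrict \<phi> V y - snd c' y = v)"
      by blast
  qed
  have 2: "compatible ?X ?c ?c" using V unfolding compatible_def by auto
  have "translation_atlas ?X ?B"
    unfolding translation_atlas_iff
  proof (intro conjI)
    have "local_homeo_on ?X V (restrict \<phi> V)"
      by (rule local_homeo_on_subset[OF chart_openin(2)[OF P U] V, where v = 0]) simp
    then show "\<forall>(U, \<phi>)\<in>?B. openin ?X U \<and> \<phi> \<in> extensional U \<and> local_homeo_on ?X U \<phi>"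
      using at V by simp
    have "V \<subseteq> topspace ?X" using V openin_subset by blast
    then show "(\<Union>(U, \<phi>)\<in>?B. U) = topspace ?X" using at by (simp add: sup.absorb2)
    show "\<forall>c\<in>?B. \<forall>c'\<in>?B. compatible ?X c c'"
      using at 1 2 compatible_sym[OF 1] by blast
  qed
  from structure_maximal[OF P this] show ?thesis by auto
qed

section \<open>Developed maps\<close>

text \<open>
  For connected \<open>K\<close>, the map \<open>d\<close> is determined by \<open>\<beta>\<close> up to a constant. It is the restriction to
  \<open>K\<close> of what is usually called the developing map; for \<open>d = id\<close>, the map \<open>\<beta>\<close> is a local inverse of
  a chart up to translation. The condition is imposed for all charts at \<open>\<beta> x\<close>; one of them is enough
  (\<open>developsI\<close>).
\<close>

definition develops ::
    "'a pointed_structure \<Rightarrow> 'k::topological_space set \<Rightarrow> ('k \<Rightarrow> 'a) \<Rightarrow> ('k \<Rightarrow> real^2) \<Rightarrow> bool" where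
  "develops P K \<beta> d \<longleftrightarrow> continuous_map (top_of_set K) (surf P) \<beta> \<and>
     (\<forall>x\<in>K. \<forall>(U, \<phi>)\<in>charts P. \<beta> x \<in> U \<longrightarrow>
        (\<forall>\<^sub>F y in nhds x. y \<in> K \<longrightarrow> \<phi> (\<beta> y) - \<phi> (\<beta> x) = d y - d x))"

lemma develops_continuous_map: "develops P K \<beta> d \<Longrightarrow> continuous_map (top_of_set K) (surf P) \<beta>"
  by (simp add: develops_def)

lemma develops_topspace: "develops P K \<beta> d \<Longrightarrow> x \<in> K \<Longrightarrow> \<beta> x \<in> topspace (surf P)"
  using continuous_map_image_subset_topspace[OF develops_continuous_map, of P K \<beta> d] by auto

lemma developsD:
  assumes "develops P K \<beta> d" "x \<in> K" "(U, \<phi>) \<in> charts P" "\<beta> x \<in> U"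
  shows "\<forall>\<^sub>F y in nhds x. y \<in> K \<longrightarrow> \<phi> (\<beta> y) - \<phi> (\<beta> x) = d y - d x"
  using assms unfolding develops_def by blast

lemma eventually_in_open:
  assumes "continuous_map (top_of_set K) X \<beta>" "openin X W" "x \<in> K" "\<beta> x \<in> W"
  shows "\<forall>\<^sub>F y in nhds x. y \<in> K \<longrightarrow> \<beta> y \<in> W"
proof -
  have "openin (top_of_set K) {y \<in> K. \<beta> y \<in> W}"
    using openin_continuous_map_preimage[OF assms(1,2)] by simp
  then obtain N where N: "open N" "{y \<in> K. \<beta> y \<in> W} = K \<inter> N" by (auto simp: openin_open)
  then have "x \<in> N" using assms by blast
  then show ?thesis using N unfolding eventually_nhds by blast
qed

lemma developsI:
  assumes P: "P \<in> structures" and cont: "continuous_map (top_of_set K) (surf P) \<beta>"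
    and ch: "\<And>x. x \<in> K \<Longrightarrow> \<exists>U \<phi>. (U, \<phi>) \<in> charts P \<and> \<beta> x \<in> U \<and>
       (\<forall>\<^sub>F y in nhds x. y \<in> K \<longrightarrow> \<phi> (\<beta> y) - \<phi> (\<beta> x) = d y - d x)"
  shows "develops P K \<beta> d"
  unfolding develops_def
proof (intro conjI cont ballI, clarify)
  fix x V \<psi> assume x: "x \<in> K" and V: "(V, \<psi>) \<in> charts P" "\<beta> x \<in> V"
  obtain U \<phi> where U: "(U, \<phi>) \<in> charts P" "\<beta> x \<in> U"
    and ev: "\<forall>\<^sub>F y in nhds x. y \<in> K \<longrightarrow> \<phi> (\<beta> y) - \<phi> (\<beta> x) = d y - d x"
    using ch[OF x] by blast
  obtain W where W: "openin (surf P) W" "\<beta> x \<in> W"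
    "\<And>y. y \<in> W \<Longrightarrow> \<phi> y - \<phi> (\<beta> x) = \<psi> y - \<psi> (\<beta> x)"
    using chart_compat[OF P U(1) V(1) U(2) V(2)] by metis
  show "\<forall>\<^sub>F y in nhds x. y \<in> K \<longrightarrow> \<psi> (\<beta> y) - \<psi> (\<beta> x) = d y - d x"
    using ev eventually_in_open[OF cont W(1) x W(2)] by eventually_elim (use W(3) in auto)
qed

lemma develops_subset:
  assumes "develops P K \<beta> d" "L \<subseteq> K"
  shows "develops P L \<beta> d"
  unfolding develops_def
proof (intro conjI ballI)
  show "continuous_map (top_of_set L) (surf P) \<beta>"
    using develops_continuous_map[OF assms(1)] assms(2) by (rule continuous_map_from_subtopology_mono)
  fix x c assume x: "x \<in> L" and c: "c \<in> charts P"
  obtain U \<phi> where [simp]: "c = (U, \<phi>)" by (cases c)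
  have "\<forall>\<^sub>F y in nhds x. y \<in> L \<longrightarrow> \<phi> (\<beta> y) - \<phi> (\<beta> x) = d y - d x" if "\<beta> x \<in> U"
    by (rule eventually_mono[OF developsD[OF assms(1), of x U \<phi>]]) (use x c that assms(2) in auto)
  then show "case c of (U, \<phi>) \<Rightarrow> \<beta> x \<in> U \<longrightarrow>
      (\<forall>\<^sub>F y in nhds x. y \<in> L \<longrightarrow> \<phi> (\<beta> y) - \<phi> (\<beta> x) = d y - d x)" by simp
qed

lemma develops_compose:
  assumes \<beta>: "develops P K \<beta> d" and g: "continuous_on L g" "g ` L \<subseteq> K"
  shows "develops P L (\<lambda>x. \<beta> (g x)) (\<lambda>x. d (g x))"
  unfolding develops_def
proof (intro conjI ballI)
  have "continuous_map (top_of_set L) (top_of_set K) g" using g by auto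
  from continuous_map_compose[OF this develops_continuous_map[OF \<beta>]]
  show "continuous_map (top_of_set L) (surf P) (\<lambda>x. \<beta> (g x))" by (simp add: o_def)
  fix x c assume x: "x \<in> L" and c: "c \<in> charts P"
  obtain U \<phi> where [simp]: "c = (U, \<phi>)" by (cases c)
  have "\<forall>\<^sub>F y in nhds x. y \<in> L \<longrightarrow> \<phi> (\<beta> (g y)) - \<phi> (\<beta> (g x)) = d (g y) - d (g x)"
    if "\<beta> (g x) \<in> U"
  proof -
    have "\<forall>\<^sub>F y in nhds (g x). y \<in> K \<longrightarrow> \<phi> (\<beta> y) - \<phi> (\<beta> (g x)) = d y - d (g x)"
      using developsD[OF \<beta>, of "g x" U \<phi>] x g c that by auto
    then obtain N where N: "open N" "g x \<in> N" "\<And>y. y \<in> N \<Longrightarrow> y \<in> K \<Longrightarrow> \<phi> (\<beta> y) - \<phi> (\<beta> (g x)) = d y - d (g x)"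
      unfolding eventually_nhds by blast
    have "\<forall>\<^sub>F y in nhds x. y \<in> L \<longrightarrow> g y \<in> N"
      using eventually_in_open[of L euclidean g N x] g N x by simp
    then show ?thesis by eventually_elim (use N(3) g in auto)
  qed
  then show "case c of (U, \<phi>) \<Rightarrow> \<beta> (g x) \<in> U \<longrightarrow>
      (\<forall>\<^sub>F y in nhds x. y \<in> L \<longrightarrow> \<phi> (\<beta> (g y)) - \<phi> (\<beta> (g x)) = d (g y) - d (g x))" by simp
qed

lemma develops_local:
  assumes loc: "\<And>x. x \<in> K \<Longrightarrow> \<exists>N. open N \<and> x \<in> N \<and> develops P (K \<inter> N) \<beta> d"
  shows "develops P K \<beta> d"
  unfolding develops_def
proof (intro conjI ballI)
  show "continuous_map (top_of_set K) (surf P) \<beta>"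
  proof (rule continuous_map_local)
    fix x assume "x \<in> topspace (top_of_set K)"
    then obtain N where N: "open N" "x \<in> N" "develops P (K \<inter> N) \<beta> d" "x \<in> K" using loc by auto
    then show "\<exists>T. openin (top_of_set K) T \<and> x \<in> T \<and> continuous_map (subtopology (top_of_set K) T) (surf P) \<beta>"
      by (intro exI[of _ "K \<inter> N"]) (auto simp: subtopology_subtopology openin_open dest: develops_continuous_map)
  qed
  fix x c assume x: "x \<in> K" and c: "c \<in> charts P"
  obtain U \<phi> where [simp]: "c = (U, \<phi>)" by (cases c)
  obtain N where N: "open N" "x \<in> N" "develops P (K \<inter> N) \<beta> d" using loc x by blast
  have "\<forall>\<^sub>F y in nhds x. y \<in> K \<longrightarrow> \<phi> (\<beta> y) - \<phi> (\<beta> x) = d y - d x" if "\<beta> x \<in> U"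
    using developsD[OF N(3), of x U \<phi>] eventually_nhds_in_open[OF N(1,2)] x c N that
    by (auto elim: eventually_elim2)
  then show "case c of (U, \<phi>) \<Rightarrow> \<beta> x \<in> U \<longrightarrow>
      (\<forall>\<^sub>F y in nhds x. y \<in> K \<longrightarrow> \<phi> (\<beta> y) - \<phi> (\<beta> x) = d y - d x)" by simp
qed

lemma develops_cong:
  assumes "develops P K \<beta> d" "\<And>x. x \<in> K \<Longrightarrow> \<beta>' x = \<beta> x" "\<And>x. x \<in> K \<Longrightarrow> d' x = d x + v"
  shows "develops P K \<beta>' d'"
  unfolding develops_def
proof (intro conjI ballI)
  show "continuous_map (top_of_set K) (surf P) \<beta>'"
    by (rule continuous_map_eq[OF develops_continuous_map[OF assms(1)]]) (use assms(2) in auto)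
  fix x c assume x: "x \<in> K" and c: "c \<in> charts P"
  obtain U \<phi> where [simp]: "c = (U, \<phi>)" by (cases c)
  have "\<forall>\<^sub>F y in nhds x. y \<in> K \<longrightarrow> \<phi> (\<beta>' y) - \<phi> (\<beta>' x) = d' y - d' x" if "\<beta>' x \<in> U"
    using developsD[OF assms(1) x, of U \<phi>] c that assms(2,3) x by (auto elim!: eventually_mono)
  then show "case c of (U, \<phi>) \<Rightarrow> \<beta>' x \<in> U \<longrightarrow>
      (\<forall>\<^sub>F y in nhds x. y \<in> K \<longrightarrow> \<phi> (\<beta>' y) - \<phi> (\<beta>' x) = d' y - d' x)" by simp
qed

lemma chart_injective_near:
  assumes P: "P \<in> structures" and x: "x \<in> topspace (surf P)"
  obtains U \<phi> where "(U, \<phi>) \<in> charts P" "x \<in> U" "open (\<phi> ` U)"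
    "homeomorphic_map (subtopology (surf P) U) (top_of_set (\<phi> ` U)) \<phi>"
proof -
  obtain V \<psi> where V: "(V, \<psi>) \<in> charts P" "x \<in> V" using chart_exists[OF P x] .
  then obtain W where W: "openin (surf P) W" "x \<in> W" "W \<subseteq> V" "open (\<psi> ` W)"
    "homeomorphic_map (subtopology (surf P) W) (top_of_set (\<psi> ` W)) \<psi>"
    using chart_openin(2)[OF P V(1)] unfolding local_homeo_on_def by blast
  have im: "restrict \<psi> W ` W = \<psi> ` W" by auto
  have "homeomorphic_map (subtopology (surf P) W) (top_of_set (restrict \<psi> W ` W)) (restrict \<psi> W)"
    unfolding im by (rule homeomorphic_map_eq[OF W(5)]) auto
  then show ?thesis using that[OF chart_restrict[OF P V(1) W(1,3)] W(2)] W(4) im by simp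
qed

text \<open>
  Near \<open>x\<close> both maps stay in one chart that is injective, and in this chart both are
  \<open>d\<close> plus the same constant.
\<close>

lemma develops_agree_near:
  assumes P: "P \<in> structures" and \<beta>: "develops P K \<beta> d" and \<gamma>: "develops P K \<gamma> d"
    and x: "x \<in> K" "\<beta> x = \<gamma> x"
  shows "\<forall>\<^sub>F y in nhds x. y \<in> K \<longrightarrow> \<beta> y = \<gamma> y"
proof -
  obtain U \<phi> where U: "(U, \<phi>) \<in> charts P" "\<beta> x \<in> U"
     "homeomorphic_map (subtopology (surf P) U) (top_of_set (\<phi> ` U)) \<phi>"
    using chart_injective_near[OF P develops_topspace[OF \<beta> x(1)]] by metis
  have oU: "openin (surf P) U" using chart_openin[OF P U(1)] by simp
  have inj: "inj_on \<phi> U"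
    using homeomorphic_imp_injective_map[OF U(3)] openin_subset[OF oU] by (simp add: inf.absorb2)
  have U': "\<gamma> x \<in> U" using U x by simp
  show ?thesis
    using developsD[OF \<beta> x(1) U(1,2)] developsD[OF \<gamma> x(1) U(1) U']
      eventually_in_open[OF develops_continuous_map[OF \<beta>] oU x(1) U(2)]
      eventually_in_open[OF develops_continuous_map[OF \<gamma>] oU x(1) U']
  proof eventually_elim
    case (elim y)
    then show ?case using x inj by (metis diff_add_cancel inj_onD)
  qed
qed

lemma connected_locally_constant_eq:
  fixes K :: "'k::topological_space set"
  assumes K: "connected K" and x0: "x0 \<in> K" "Q x0"
    and op: "\<And>x. x \<in> K \<Longrightarrow> Q x \<Longrightarrow> \<forall>\<^sub>F y in nhds x. y \<in> K \<longrightarrow> Q y"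
    and cl: "\<And>x. x \<in> K \<Longrightarrow> \<not> Q x \<Longrightarrow> \<forall>\<^sub>F y in nhds x. y \<in> K \<longrightarrow> \<not> Q y"
    and x: "x \<in> K"
  shows "Q x"
proof -
  have *: "openin (top_of_set K) {y \<in> K. R y}"
    if R: "\<And>x. x \<in> K \<Longrightarrow> R x \<Longrightarrow> \<forall>\<^sub>F y in nhds x. y \<in> K \<longrightarrow> R y" for R
  proof (subst openin_subopen, rule ballI)
    fix x assume "x \<in> {y \<in> K. R y}"
    then obtain N where "open N" "x \<in> N" "\<forall>y\<in>N. y \<in> K \<longrightarrow> R y"
      using R[of x] unfolding eventually_nhds by auto
    then show "\<exists>T. openin (top_of_set K) T \<and> x \<in> T \<and> T \<subseteq> {y \<in> K. R y}"
      using \<open>x \<in> {y \<in> K. R y}\<close> by (intro exI[of _ "K \<inter> N"]) auto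
  qed
  have "K - {y \<in> K. Q y} = {y \<in> K. \<not> Q y}" by auto
  then have "closedin (top_of_set K) {y \<in> K. Q y}"
    using *[of "\<lambda>y. \<not> Q y", OF cl] by (simp add: closedin_def)
  then have "{y \<in> K. Q y} = {} \<or> {y \<in> K. Q y} = K"
    using *[of Q, OF op] K[unfolded connected_clopen] by blast
  with x x0 show ?thesis by blast
qed

text \<open>
  The set where two lifts agree is open by \<open>develops_agree_near\<close> and closed because
  surfaces are Hausdorff. This is the reason why immersions are unique.
\<close>

lemma develops_unique:
  assumes P: "P \<in> structures" and K: "connected K" and \<beta>: "develops P K \<beta> d" and \<gamma>: "develops P K \<gamma> d"
    and x0: "x0 \<in> K" "\<beta> x0 = \<gamma> x0" and x: "x \<in> K"
  shows "\<beta> x = \<gamma> x"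
proof (rule connected_locally_constant_eq[OF K, where Q = "\<lambda>x. \<beta> x = \<gamma> x", OF x0 _ _ x])
  show "\<forall>\<^sub>F y in nhds x. y \<in> K \<longrightarrow> \<beta> y = \<gamma> y" if "x \<in> K" "\<beta> x = \<gamma> x" for x
    by (rule develops_agree_near[OF P \<beta> \<gamma> that])
  show "\<forall>\<^sub>F y in nhds x. y \<in> K \<longrightarrow> \<beta> y \<noteq> \<gamma> y" if x: "x \<in> K" and ne: "\<beta> x \<noteq> \<gamma> x" for x
  proof -
    obtain V W where V: "openin (surf P) V" "openin (surf P) W" "\<beta> x \<in> V" "\<gamma> x \<in> W" "disjnt V W"
      using structure_Hausdorff[OF P] ne develops_topspace[OF \<beta> x] develops_topspace[OF \<gamma> x]
      unfolding Hausdorff_space_def by metis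
    show ?thesis
      using eventually_in_open[OF develops_continuous_map[OF \<beta>] V(1) x V(3)]
        eventually_in_open[OF develops_continuous_map[OF \<gamma>] V(2) x V(4)]
      by eventually_elim (use V(5) in \<open>auto simp: disjnt_iff\<close>)
  qed
qed

lemma developed_map_unique:
  assumes P: "P \<in> structures" and K: "connected K" and d: "develops P K \<beta> d" and d': "develops P K \<beta> d'"
    and x0: "x0 \<in> K" "d x0 = d' x0" and x: "x \<in> K"
  shows "d x = d' x"
proof -
  have *: "\<forall>\<^sub>F y in nhds x. y \<in> K \<longrightarrow> d y - d' y = d x - d' x" if x: "x \<in> K" for x
  proof -
    obtain U \<phi> where U: "(U, \<phi>) \<in> charts P" "\<beta> x \<in> U" using chart_exists[OF P develops_topspace[OF d x]] .
    show ?thesis using developsD[OF d x U] developsD[OF d' x U]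
      by eventually_elim (metis diff_swap)
  qed
  show ?thesis
    by (rule connected_locally_constant_eq[OF K, where Q = "\<lambda>x. d x = d' x", OF x0 _ _ x])
       (use * in \<open>fastforce elim!: eventually_mono\<close>)+
qed

lemma developed_map_continuous:
  assumes P: "P \<in> structures" and d: "develops P K \<beta> d"
  shows "continuous_on K d"
  unfolding continuous_on_def
proof
  fix x assume x: "x \<in> K"
  obtain U \<phi> where U: "(U, \<phi>) \<in> charts P" "\<beta> x \<in> U" using chart_exists[OF P develops_topspace[OF d x]] .
  have oU: "openin (surf P) U" using chart_openin[OF P U(1)] by simp
  have c: "continuous_map (subtopology (surf P) U) euclidean \<phi>"
    using local_homeo_on_continuous chart_openin[OF P U(1)] by blast
  show "(d \<longlongrightarrow> d x) (at x within K)"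
  proof (rule topological_tendstoI)
    fix S assume S: "open S" "d x \<in> S"
    let ?S = "(\<lambda>v. v - d x + \<phi> (\<beta> x)) ` S"
    have "?S = (+) (\<phi> (\<beta> x) - d x) ` S" by (auto simp: algebra_simps)
    then have "open ?S" using open_translation[OF S(1)] by simp
    then have "openin (surf P) {y \<in> U. \<phi> y \<in> ?S}"
      using openin_continuous_map_preimage[OF c, of ?S] oU openin_subset[OF oU]
      by (simp add: openin_open_subtopology inf.absorb2)
    moreover have "\<beta> x \<in> {y \<in> U. \<phi> y \<in> ?S}" using U S by force
    ultimately have "\<forall>\<^sub>F y in nhds x. y \<in> K \<longrightarrow> \<beta> y \<in> {y \<in> U. \<phi> y \<in> ?S}"
      using eventually_in_open[OF develops_continuous_map[OF d] _ x] by blast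
    then have "\<forall>\<^sub>F y in nhds x. y \<in> K \<longrightarrow> d y \<in> S"
      using developsD[OF d x U] by eventually_elim (auto simp: algebra_simps)
    then show "\<forall>\<^sub>F y in at x within K. d y \<in> S"
      by (simp add: eventually_at_filter eventually_mono)
  qed
qed

text \<open>
  A local inverse of a chart, shifted so that it is defined on a ball with a given centre \<open>a\<close>.
\<close>

lemma sheet_exists:
  assumes P: "P \<in> structures" and G: "openin (surf P) G" "x \<in> G"
  obtains e r where "r > 0" "develops P (ball (a::real^2) r) e id" "e a = x" "e ` ball a r \<subseteq> G" "inj_on e (ball a r)"
proof -
  have xP: "x \<in> topspace (surf P)" using G openin_subset by blast
  obtain U \<phi> where U: "(U, \<phi>) \<in> charts P" "x \<in> U" "open (\<phi> ` U)"
    "homeomorphic_map (subtopology (surf P) U) (top_of_set (\<phi> ` U)) \<phi>"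
    using chart_injective_near[OF P xP] .
  have oU: "openin (surf P) U" using chart_openin[OF P U(1)] by simp
  have UP: "U \<subseteq> topspace (surf P)" using oU openin_subset by blast
  have "openin (subtopology (surf P) U) (U \<inter> G)" using oU G by (auto simp: openin_subtopology)
  then have "openin (top_of_set (\<phi> ` U)) (\<phi> ` (U \<inter> G))"
    using homeomorphic_map_openness[OF U(4), of "U \<inter> G"] UP by auto
  then have "open (\<phi> ` (U \<inter> G))" using U(3) openin_open_trans by blast
  then obtain r where r: "r > 0" "ball (\<phi> x) r \<subseteq> \<phi> ` (U \<inter> G)"
    using U(2) G by (metis IntI imageI open_contains_ball)
  obtain h where h: "homeomorphic_maps (subtopology (surf P) U) (top_of_set (\<phi> ` U)) \<phi> h"
    using U(4) homeomorphic_map_maps by blast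
  have hc: "continuous_map (top_of_set (\<phi> ` U)) (surf P) h"
    and h1: "\<And>y. y \<in> U \<Longrightarrow> h (\<phi> y) = y" and h2: "\<And>y. y \<in> \<phi> ` U \<Longrightarrow> \<phi> (h y) = y \<and> h y \<in> U"
    using h UP unfolding homeomorphic_maps_def by (auto simp: continuous_map_in_subtopology)
  let ?e = "\<lambda>v. h (v - a + \<phi> x)"
  have in_ball: "v - a + \<phi> x \<in> \<phi> ` (U \<inter> G)" if "v \<in> ball a r" for v
    using r that by (auto simp: dist_norm norm_minus_commute algebra_simps subset_eq)
  have dev: "develops P (\<phi> ` U) h id"
  proof (rule developsI[OF P hc])
    fix y assume y: "y \<in> \<phi> ` U"
    have "\<forall>\<^sub>F z in nhds y. z \<in> \<phi> ` U \<longrightarrow> \<phi> (h z) - \<phi> (h y) = id z - id y"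
      using h2 y by auto
    with U(1) h2[OF y] show "\<exists>U' \<psi>. (U', \<psi>) \<in> charts P \<and> h y \<in> U' \<and>
       (\<forall>\<^sub>F z in nhds y. z \<in> \<phi> ` U \<longrightarrow> \<psi> (h z) - \<psi> (h y) = id z - id y)"
      by blast
  qed
  show ?thesis
  proof (rule that[where e = ?e and r = r])
    have "develops P (ball a r) ?e (\<lambda>v. id (v - a + \<phi> x))"
    proof (rule develops_compose[OF dev])
      show "continuous_on (ball a r) (\<lambda>v. v - a + \<phi> x)" by (intro continuous_intros)
      show "(\<lambda>v. v - a + \<phi> x) ` ball a r \<subseteq> \<phi> ` U" using in_ball by blast
    qed
    then show "develops P (ball a r) ?e id"
      by (rule develops_cong[where v = "a - \<phi> x"]) auto
    show "?e ` ball a r \<subseteq> G"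
    proof clarify
      fix v assume "v \<in> ball a r"
      from in_ball[OF this] obtain y where "y \<in> U \<inter> G" "v - a + \<phi> x = \<phi> y" by (rule imageE)
      then show "?e v \<in> G" using h1[of y] by simp
    qed
    show "inj_on ?e (ball a r)"
    proof (rule inj_onI)
      fix v w assume vw: "v \<in> ball a r" "w \<in> ball a r" "?e v = ?e w"
      have "\<phi> (?e v) = v - a + \<phi> x" "\<phi> (?e w) = w - a + \<phi> x"
        using h2 image_mono[OF Int_lower1] in_ball[OF vw(1)] in_ball[OF vw(2)] subsetD by metis+
      then have "v - a + \<phi> x = w - a + \<phi> x" unfolding vw(3) by (rule trans[OF sym])
      then show "v = w" by simp
    qed
    show "r > 0" by fact
    show "?e a = x" using U h1 by simp
  qed
qed

section \<open>Thickening a lift and developing a disk\<close>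

text \<open>
  Each point of the lift \<open>\<gamma>\<close> lies in a sheet, a section over a ball around its developed image. Over
  compact \<open>K\<close> the radii can be bounded below, and sheets of nearby points agree where they
  overlap, because overlaps of balls are connected. So the lift extends to a uniform
  neighbourhood: any continuous map that stays \<open>\<delta>\<close>-close to \<open>d\<close> lifts as well. Since the domain is the product
  with a ball, it does not matter how the image of \<open>d\<close> overlaps itself.
\<close>

lemma thickening:
  fixes K :: "'k::metric_space set"
  assumes P: "P \<in> structures" and K: "compact K" and \<gamma>: "develops P K \<gamma> d"
    and G: "openin (surf P) G" "\<gamma> ` K \<subseteq> G"
  obtains \<delta> E where "\<delta> > 0" "develops P (K \<times> ball 0 \<delta>) (\<lambda>(x, v). E x v) (\<lambda>(x, v). d x + v)"
    "\<And>x. x \<in> K \<Longrightarrow> E x 0 = \<gamma> x" "\<And>x v. x \<in> K \<Longrightarrow> norm v < \<delta> \<Longrightarrow> E x v \<in> G"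
proof -
  have cd: "continuous_on K d" by (rule developed_map_continuous[OF P \<gamma>])
  have "\<forall>x\<in>K. \<exists>e r N. r > 0 \<and> develops P (ball (d x) r) e id \<and> e ` ball (d x) r \<subseteq> G \<and> open N \<and> x \<in> N \<and>
      (\<forall>y\<in>K \<inter> N. e (d y) = \<gamma> y \<and> dist (d x) (d y) < r / 2)"
  proof
    fix x assume x: "x \<in> K"
    have xG: "\<gamma> x \<in> G" using G x by auto
    obtain e r where e: "r > 0" "develops P (ball (d x) r) e id" "e (d x) = \<gamma> x" "e ` ball (d x) r \<subseteq> G"
      using sheet_exists[OF P G(1) xG] by metis
    have "\<forall>\<^sub>F y in nhds x. y \<in> K \<longrightarrow> d y \<in> ball (d x) (r / 2)"
      using eventually_in_open[of K euclidean d "ball (d x) (r / 2)" x] cd x e by simp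
    then obtain N where N: "open N" "x \<in> N" "\<And>y. y \<in> N \<Longrightarrow> y \<in> K \<longrightarrow> d y \<in> ball (d x) (r / 2)"
      unfolding eventually_nhds by blast
    have "develops P (K \<inter> N) (\<lambda>y. e (d y)) (\<lambda>y. id (d y))"
    proof (rule develops_compose[OF e(2)])
      show "continuous_on (K \<inter> N) d" using cd by (rule continuous_on_subset) auto
      show "d ` (K \<inter> N) \<subseteq> ball (d x) r" using N(3) e(1) by fastforce
    qed
    then have 1: "develops P (K \<inter> N) (\<lambda>y. e (d y)) d" by simp
    have "\<forall>\<^sub>F y in nhds x. y \<in> K \<inter> N \<longrightarrow> e (d y) = \<gamma> y"
      using develops_agree_near[OF P 1 develops_subset[OF \<gamma>]] x N e(3) by auto
    then obtain N' where N': "open N'" "x \<in> N'" "\<And>y. y \<in> N' \<Longrightarrow> y \<in> K \<inter> N \<longrightarrow> e (d y) = \<gamma> y"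
      unfolding eventually_nhds by blast
    show "\<exists>e r N. r > 0 \<and> develops P (ball (d x) r) e id \<and> e ` ball (d x) r \<subseteq> G \<and> open N \<and> x \<in> N \<and>
      (\<forall>y\<in>K \<inter> N. e (d y) = \<gamma> y \<and> dist (d x) (d y) < r / 2)"
      by (rule exI[of _ e], rule exI[of _ r], rule exI[of _ "N \<inter> N'"]) (use e N N' in auto)
  qed
  from this[unfolded bchoice_iff] obtain e r N where ern: "\<forall>x\<in>K. r x > 0 \<and> develops P (ball (d x) (r x)) (e x) id \<and>
      e x ` ball (d x) (r x) \<subseteq> G \<and> open (N x) \<and> x \<in> N x \<and>
      (\<forall>y\<in>K \<inter> N x. e x (d y) = \<gamma> y \<and> dist (d x) (d y) < r x / 2)"
    by (elim exE) (rule that)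
  then have er: "\<And>x. x \<in> K \<Longrightarrow> r x > 0" "\<And>x. x \<in> K \<Longrightarrow> develops P (ball (d x) (r x)) (e x) id"
      "\<And>x. x \<in> K \<Longrightarrow> e x ` ball (d x) (r x) \<subseteq> G"
    and N: "\<And>x. x \<in> K \<Longrightarrow> open (N x)" "\<And>x. x \<in> K \<Longrightarrow> x \<in> N x"
      "\<And>x y. x \<in> K \<Longrightarrow> y \<in> K \<Longrightarrow> y \<in> N x \<Longrightarrow> e x (d y) = \<gamma> y \<and> dist (d x) (d y) < r x / 2"
    by blast+
  obtain C where C: "C \<subseteq> K" "finite C" "K \<subseteq> (\<Union>c\<in>C. N c)"
    using compactE_image[OF K, of K N] N by blast
  \<comment> \<open>The radius 1 is only there to make the minimum meaningful when \<open>K\<close> is empty.\<close>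
  define \<delta> where "\<delta> = Min (insert 1 ((\<lambda>c. r c / 2) ` C))"
  have \<delta>: "\<delta> > 0" using C er(1) unfolding \<delta>_def by (subst Min_gr_iff) auto
  have \<delta>2: "\<delta> \<le> r c / 2" if "c \<in> C" for c
    unfolding \<delta>_def using C(2) that by (intro Min_le) auto
  obtain c where c: "\<And>y. y \<in> K \<Longrightarrow> c y \<in> C" "\<And>y. y \<in> K \<Longrightarrow> y \<in> N (c y)"
    using C(3) by (metis UN_E subsetD)
  define E where "E = (\<lambda>y v. e (c y) (d y + v))"
  have inb: "d y + v \<in> ball (d a) (r a)" if "a \<in> C" "y \<in> K" "y \<in> N a" "v \<in> ball 0 \<delta>" for a y v
  proof -
    have "dist (d a) (d y) < r a / 2" using N(3)[of a y] that C by auto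
    moreover have "dist (d y) (d y + v) < r a / 2" using \<delta>2[OF that(1)] that(4) by (simp add: dist_norm)
    ultimately show ?thesis using dist_triangle[of "d a" "d y + v" "d y"] by simp
  qed
  have E_eq: "E y v = e a (d y + v)" if "a \<in> C" "y \<in> K" "y \<in> N a" "v \<in> ball 0 \<delta>" for a y v
  proof -
    have sh: "develops P (ball 0 \<delta>) (\<lambda>v. e a (d y + v)) (\<lambda>v. id (d y + v))" if a: "a \<in> C" "y \<in> N a" for a
    proof (rule develops_compose[OF er(2)])
      show "(\<lambda>v. d y + v) ` ball 0 \<delta> \<subseteq> ball (d a) (r a)"
        using inb[OF a(1) \<open>y \<in> K\<close> a(2)] by blast
    qed (use a C in \<open>auto intro!: continuous_intros\<close>)
    have cy: "c y \<in> C" "y \<in> N (c y)" "c y \<in> K" using c C that by auto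
    have "e (c y) (d y + 0) = e a (d y + 0)"
      using N(3)[of "c y" y] N(3)[of a y] cy that C by auto
    note agree = this
    show ?thesis
      unfolding E_def
      by (rule develops_unique[where ?x0.0 = "0::real^2", OF P connected_ball sh[OF cy(1,2)] sh[OF that(1,3)] _ agree])
        (use that \<delta> in auto)
  qed
  have "develops P (K \<times> ball 0 \<delta>) (\<lambda>(x, v). E x v) (\<lambda>(x, v). d x + v)"
  proof (rule develops_local)
    fix p assume "p \<in> K \<times> ball (0::real^2) \<delta>"
    then obtain y0 v0 where p: "p = (y0, v0)" "y0 \<in> K" "v0 \<in> ball 0 \<delta>" by blast
    let ?a = "c y0"
    have a: "?a \<in> C" "?a \<in> K" "y0 \<in> N ?a" using c C p by auto
    let ?L = "(K \<times> ball 0 \<delta>) \<inter> (N ?a \<times> UNIV)"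
    have "continuous_on ?L (\<lambda>q. d (fst q))"
      by (rule continuous_on_compose2[OF cd]) (auto intro!: continuous_intros)
    then have "develops P ?L (\<lambda>q. e ?a (d (fst q) + snd q)) (\<lambda>q. id (d (fst q) + snd q))"
      by (intro develops_compose[OF er(2)[OF a(2)]] continuous_intros) (use inb[OF a(1)] in auto)
    then have "develops P ?L (\<lambda>(x, v). E x v) (\<lambda>(x, v). d x + v)"
      by (rule develops_cong[where v = 0]) (use E_eq[OF a(1)] in auto)
    then show "\<exists>N. open N \<and> p \<in> N \<and> develops P (K \<times> ball 0 \<delta> \<inter> N) (\<lambda>(x, v). E x v) (\<lambda>(x, v). d x + v)"
      using N(1)[OF a(2)] a p by (intro exI[of _ "N ?a \<times> UNIV"]) (auto intro: open_Times)
  qed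
  moreover have "E x 0 = \<gamma> x" if "x \<in> K" for x
    using N(3)[of "c x" x] c that C unfolding E_def by auto
  moreover have "E x v \<in> G" if "x \<in> K" "norm v < \<delta>" for x v
    using inb[of "c x" x v] er(3)[of "c x"] c that C unfolding E_def by force
  ultimately show ?thesis using that \<delta> by blast
qed

text \<open>
  On pieces of \<open>K\<close> smaller than a Lebesgue number of a cover by charts, the increment
  \<open>\<Delta> x y = \<psi> (h y) - \<psi> (h x)\<close> does not depend on the chart and is additive. Summing it along a
  subdivided segment from \<open>z0\<close> to \<open>z\<close> defines \<open>d z\<close>. Comparing the sums for two nearby end points
  gives a telescoping sum, so \<open>d\<close> has the right local increments.
\<close>

lemma develops_exists:
  fixes K :: "'k::real_normed_vector set"
  assumes P: "P \<in> structures" and K: "compact K" "convex K" and z0: "z0 \<in> K"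
    and h: "continuous_map (top_of_set K) (surf P) h"
  obtains d where "develops P K h d" "d z0 = 0"
proof -
  have "\<forall>x\<in>K. \<exists>U \<phi> N. (U, \<phi>) \<in> charts P \<and> open N \<and> x \<in> N \<and> (\<forall>y\<in>K \<inter> N. h y \<in> U)"
  proof
    fix x assume x: "x \<in> K"
    have "h x \<in> topspace (surf P)" using x continuous_map_image_subset_topspace[OF h] by auto
    then obtain U \<phi> where U: "(U, \<phi>) \<in> charts P" "h x \<in> U" using chart_exists[OF P] by blast
    have "\<forall>\<^sub>F y in nhds x. y \<in> K \<longrightarrow> h y \<in> U"
      using eventually_in_open[OF h _ x] chart_openin[OF P U(1)] U(2) by blast
    then obtain N where "open N" "x \<in> N" "\<And>y. y \<in> N \<Longrightarrow> y \<in> K \<longrightarrow> h y \<in> U"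
      unfolding eventually_nhds by blast
    then show "\<exists>U \<phi> N. (U, \<phi>) \<in> charts P \<and> open N \<and> x \<in> N \<and> (\<forall>y\<in>K \<inter> N. h y \<in> U)"
      using U by (intro exI[of _ U] exI[of _ \<phi>] exI[of _ N]) auto
  qed
  from this[unfolded bchoice_iff] obtain U0 \<phi>0 N
    where N: "\<forall>x\<in>K. (U0 x, \<phi>0 x) \<in> charts P \<and> open (N x) \<and> x \<in> N x \<and> (\<forall>y\<in>K \<inter> N x. h y \<in> U0 x)"
    by (elim exE) (rule that)
  have "K \<subseteq> \<Union>(N ` K)" "\<And>G. G \<in> N ` K \<Longrightarrow> open G" using N by auto
  from Heine_Borel_lemma[OF K(1) this] obtain e where e: "0 < e" "\<forall>x\<in>K. \<exists>G\<in>N ` K. ball x e \<subseteq> G"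
    by metis
  have "\<forall>x\<in>K. \<exists>U \<phi>. (U, \<phi>) \<in> charts P \<and> (\<forall>y\<in>K \<inter> ball x e. h y \<in> U)"
  proof
    fix x assume "x \<in> K"
    then obtain c where "c \<in> K" "ball x e \<subseteq> N c" using e(2) by blast
    then show "\<exists>U \<phi>. (U, \<phi>) \<in> charts P \<and> (\<forall>y\<in>K \<inter> ball x e. h y \<in> U)"
      using bspec[OF N, of c] by (intro exI[of _ "U0 c"] exI[of _ "\<phi>0 c"]) auto
  qed
  from this[unfolded bchoice_iff] obtain V \<psi>
    where "\<forall>x\<in>K. (V x, \<psi> x) \<in> charts P \<and> (\<forall>y\<in>K \<inter> ball x e. h y \<in> V x)"
    by (elim exE) (rule that)
  then have V: "\<And>x. x \<in> K \<Longrightarrow> (V x, \<psi> x) \<in> charts P"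
      "\<And>x y. x \<in> K \<Longrightarrow> y \<in> K \<Longrightarrow> dist x y < e \<Longrightarrow> h y \<in> V x"
    by auto
  define \<Delta> where "\<Delta> = (\<lambda>x y. \<psi> x (h y) - \<psi> x (h x))"
  have ind: "\<psi> x (h y) - \<psi> x (h y') = \<psi> x' (h y) - \<psi> x' (h y')"
    if x: "x \<in> K" "x' \<in> K" and y: "y \<in> K" "dist x y < e" "dist x' y < e"
      and y': "y' \<in> K" "dist x y' < e" "dist x' y' < e" for x x' y y'
  proof -
    let ?L = "K \<inter> ball x e \<inter> ball x' e"
    have *: "\<forall>\<^sub>F u in nhds z. u \<in> ?L \<longrightarrow> \<psi> x (h u) - \<psi> x' (h u) = \<psi> x (h z) - \<psi> x' (h z)" if z: "z \<in> ?L" for z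
    proof -
      have zV: "h z \<in> V x" "h z \<in> V x'" using V(2) x z by auto
      obtain W where W: "openin (surf P) W" "h z \<in> W"
        "\<And>y. y \<in> W \<Longrightarrow> \<psi> x y - \<psi> x (h z) = \<psi> x' y - \<psi> x' (h z)"
        using chart_compat[OF P V(1)[OF x(1)] V(1)[OF x(2)] zV] by metis
      have "\<forall>\<^sub>F u in nhds z. u \<in> K \<longrightarrow> h u \<in> W"
        using eventually_in_open[OF h W(1) _ W(2)] z by blast
      then show ?thesis
        by eventually_elim (use diff_swap[OF W(3)] in blast)
    qed
    have "connected ?L" using K(2) by (intro convex_connected convex_Int) auto
    then have "\<psi> x (h y) - \<psi> x' (h y) = \<psi> x (h y') - \<psi> x' (h y')"
      by (rule connected_locally_constant_eq[where ?x0.0 = y' and Q = "\<lambda>u. \<psi> x (h u) - \<psi> x' (h u) = \<psi> x (h y') - \<psi> x' (h y')"])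
        (use y y' * in \<open>fastforce elim!: eventually_mono\<close>)+
    then show ?thesis by (rule diff_swap)
  qed
  \<comment> \<open>Two charts around overlapping pieces give the same increments, which is \<open>ind\<close> with \<open>x\<close> and \<open>y\<close> as centres.\<close>
  have cocycle: "\<Delta> x y + \<Delta> y z = \<Delta> x z"
    if "x \<in> K" "y \<in> K" "z \<in> K" "dist x y < e" "dist y z < e" "dist x z < e" for x y z
    using ind[of y x z y] that e(1) unfolding \<Delta>_def by (simp add: dist_commute)
  obtain M where M: "\<And>z. z \<in> K \<Longrightarrow> norm (z - z0) \<le> M"
    using compact_imp_bounded[OF K(1)] bounded_any_center[of K z0] by (auto simp: dist_norm norm_minus_commute)
  obtain n :: nat where n: "real n > 2 * M / e" "n > 0"
    by (metis gr0I less_le_trans linear of_nat_0_less_iff reals_Archimedean2 not_less_iff_gr_or_eq order_less_trans zero_less_one of_nat_1 zero_less_iff_neq_zero)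
  define w where "w = (\<lambda>z k. z0 + (real k / real n) *\<^sub>R (z - z0))"
  define d where "d = (\<lambda>z. \<Sum>k<n. \<Delta> (w z k) (w z (Suc k)))"
  have wK: "w z k \<in> K" if "z \<in> K" "k \<le> n" for z k
  proof -
    have "w z k = (1 - real k / real n) *\<^sub>R z0 + (real k / real n) *\<^sub>R z" by (simp add: w_def algebra_simps)
    then show ?thesis using K(2)[unfolded convex_alt] z0 that n by (simp add: )
  qed
  have step: "dist (w z k) (w z (Suc k)) < e / 2" if "z \<in> K" for z k
  proof -
    have "w z (Suc k) - w z k = (real (Suc k) / real n - real k / real n) *\<^sub>R (z - z0)"
      by (simp add: w_def scaleR_left_diff_distrib)
    also have "real (Suc k) / real n - real k / real n = 1 / real n"
      by (simp flip: diff_divide_distrib)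
    finally have "w z (Suc k) - w z k = (1 / real n) *\<^sub>R (z - z0)" .
    then have "dist (w z k) (w z (Suc k)) = norm (z - z0) / real n"
      by (subst dist_commute) (simp add: dist_norm)
    also have "\<dots> \<le> M / real n" using M[OF that] n by (simp add: divide_right_mono)
    also have "\<dots> < e / 2" using n e(1) by (simp add: field_simps)
    finally show ?thesis .
  qed
  have across: "dist (w z k) (w z' k) < e / 2" if "dist z z' < e / 2" "k \<le> n" for z z' k
  proof -
    have "w z k - w z' k = (real k / real n) *\<^sub>R (z - z')" by (simp add: w_def algebra_simps)
    then have "dist (w z k) (w z' k) = real k / real n * dist z z'" by (simp add: dist_norm)
    also have "\<dots> \<le> 1 * dist z z'" using that n by (intro mult_right_mono) auto
    finally show ?thesis using that by simp
  qed
  have dd: "d z' - d z = \<Delta> z z'" if z: "z \<in> K" "z' \<in> K" "dist z z' < e / 2" for z z'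
  proof -
    have "\<Delta> (w z' k) (w z' (Suc k)) - \<Delta> (w z k) (w z (Suc k)) = \<Delta> (w z (Suc k)) (w z' (Suc k)) - \<Delta> (w z k) (w z' k)"
      if k: "k < n" for k
    proof -
      let ?a = "w z k" and ?b = "w z (Suc k)" and ?a' = "w z' k" and ?b' = "w z' (Suc k)"
      have ins: "?a \<in> K" "?b \<in> K" "?a' \<in> K" "?b' \<in> K" using wK z k by auto
      have ds: "dist ?a ?b < e / 2" "dist ?a' ?b' < e / 2" "dist ?a ?a' < e / 2" "dist ?b ?b' < e / 2"
        using step z across[OF z(3)] k by auto
      have ab': "dist ?a ?b' < e" using dist_triangle_half_l[of ?a ?b e ?b'] ds by (simp add: dist_commute)
      have "\<Delta> ?a ?b + \<Delta> ?b ?b' = \<Delta> ?a ?b'" "\<Delta> ?a ?a' + \<Delta> ?a' ?b' = \<Delta> ?a ?b'"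
        using ins ds ab' e(1) by (intro cocycle; simp)+
      then show ?thesis by (simp add: algebra_simps)
    qed
    then have "d z' - d z = (\<Sum>k<n. \<Delta> (w z (Suc k)) (w z' (Suc k)) - \<Delta> (w z k) (w z' k))"
      unfolding d_def sum_subtractf[symmetric] by (intro sum.cong) auto
    also have "\<dots> = \<Delta> (w z n) (w z' n) - \<Delta> (w z 0) (w z' 0)" by (rule sum_lessThan_telescope)
    also have "\<dots> = \<Delta> z z'" using n by (simp add: w_def \<Delta>_def)
    finally show ?thesis .
  qed
  have "develops P K h d"
  proof (rule developsI[OF P h])
    fix x assume x: "x \<in> K"
    have "\<forall>\<^sub>F y in nhds x. y \<in> ball x (e / 2)" using e(1) by (intro eventually_nhds_in_open) auto
    then have "\<forall>\<^sub>F y in nhds x. y \<in> K \<longrightarrow> \<psi> x (h y) - \<psi> x (h x) = d y - d x"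
      by eventually_elim (use dd x in \<open>auto simp: \<Delta>_def\<close>)
    then show "\<exists>U \<phi>. (U, \<phi>) \<in> charts P \<and> h x \<in> U \<and> (\<forall>\<^sub>F y in nhds x. y \<in> K \<longrightarrow> \<phi> (h y) - \<phi> (h x) = d y - d x)"
      using V(1)[OF x] V(2)[of x x] x e(1) by fastforce
  qed
  moreover have "d z0 = 0" by (simp add: d_def w_def \<Delta>_def)
  ultimately show ?thesis using that by blast
qed

section \<open>Immersions and developed maps\<close>

lemma develops_immersion:
  assumes P: "P \<in> structures" "Q \<in> structures" and i: "is_immersion P A Q B \<iota>"
    and h: "develops P K h d" "h ` K \<subseteq> A"
  shows "develops Q K (\<lambda>x. \<iota> (h x)) d" "\<And>x. x \<in> K \<Longrightarrow> \<iota> (h x) \<in> B" "\<iota> (bpt P) = bpt Q"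
proof -
  have ci: "continuous_map (subtopology (surf P) A) (subtopology (surf Q) B) \<iota>"
    using i by (simp add: is_immersion_def)
  have ch: "continuous_map (top_of_set K) (subtopology (surf P) A) h"
    using develops_continuous_map[OF h(1)] h(2) by (simp add: continuous_map_in_subtopology image_subset_iff_funcset)
  have cc: "continuous_map (top_of_set K) (subtopology (surf Q) B) (\<lambda>x. \<iota> (h x))"
    using continuous_map_compose[OF ch ci] by (simp add: o_def)
  then show "\<And>x. x \<in> K \<Longrightarrow> \<iota> (h x) \<in> B" using continuous_map_image_subset_topspace[OF cc] by auto
  show "\<iota> (bpt P) = bpt Q" using i by (simp add: is_immersion_def)
  show "develops Q K (\<lambda>x. \<iota> (h x)) d"
  proof (rule developsI[OF P(2)])
    show "continuous_map (top_of_set K) (surf Q) (\<lambda>x. \<iota> (h x))" using cc by (simp add: continuous_map_in_subtopology)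
    fix x assume x: "x \<in> K"
    then have "h x \<in> A" using h by auto
    moreover have "\<forall>s\<in>A. \<exists>U \<phi> V \<psi> v. (U, \<phi>) \<in> charts P \<and> s \<in> U \<and> (V, \<psi>) \<in> charts Q \<and>
        \<iota> ` (U \<inter> A) \<subseteq> V \<and> (\<forall>s'\<in>U \<inter> A. \<psi> (\<iota> s') = v + \<phi> s')"
      using i unfolding is_immersion_def by (elim conjE)
    ultimately obtain U \<phi> V \<psi> v where U: "(U, \<phi>) \<in> charts P" "h x \<in> U" and V: "(V, \<psi>) \<in> charts Q"
      and im: "\<iota> ` (U \<inter> A) \<subseteq> V" "\<forall>s'\<in>U \<inter> A. \<psi> (\<iota> s') = v + \<phi> s'"
      by meson
    have "\<forall>\<^sub>F y in nhds x. y \<in> K \<longrightarrow> \<psi> (\<iota> (h y)) - \<psi> (\<iota> (h x)) = d y - d x"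
      using eventually_in_open[OF develops_continuous_map[OF h(1)] chart_openin(1)[OF P(1) U(1)] x U(2)]
        developsD[OF h(1) x U]
    proof eventually_elim
      case (elim y)
      show ?case
      proof
        assume y: "y \<in> K"
        then have "h y \<in> U \<inter> A" "h x \<in> U \<inter> A" using elim h U x by auto
        then show "\<psi> (\<iota> (h y)) - \<psi> (\<iota> (h x)) = d y - d x" using im(2) elim y by simp
      qed
    qed
    moreover have "\<iota> (h x) \<in> V" using im(1) U \<open>h x \<in> A\<close> by auto
    ultimately show "\<exists>U \<phi>. (U, \<phi>) \<in> charts Q \<and> \<iota> (h x) \<in> U \<and>
       (\<forall>\<^sub>F y in nhds x. y \<in> K \<longrightarrow> \<phi> (\<iota> (h y)) - \<phi> (\<iota> (h x)) = d y - d x)" using V by blast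
  qed
qed

text \<open>
  The converse of \<open>develops_immersion\<close>: an immersion of a parametrized set is the same as a second map
  from the parameter space with the same developed map. The chart of \<open>P\<close> has to be shrunk by
  \<open>chart_restrict\<close>, since a chart domain may meet \<open>A\<close> in points whose parameters are far apart.
\<close>

lemma immersion_from_develops:
  assumes P: "P \<in> structures" "Q \<in> structures" and A: "A \<in> PC P"
    and h: "homeomorphic_maps (top_of_set K) (subtopology (surf P) A) h k" "develops P K h d"
    and z0: "z0 \<in> K" "h z0 = bpt P"
    and \<gamma>: "develops Q K \<gamma> d" "\<gamma> z0 = bpt Q" "\<gamma> ` K \<subseteq> B" and B: "B \<subseteq> topspace (surf Q)"
  shows "is_immersion P A Q B (\<lambda>s. \<gamma> (k s))"
  unfolding is_immersion_def
proof (intro conjI A B ballI)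
  have AP: "A \<subseteq> topspace (surf P)" using A path_connectedin_subset_topspace unfolding PC_def by blast
  have hk: "\<And>x. x \<in> K \<Longrightarrow> k (h x) = x" "\<And>s. s \<in> A \<Longrightarrow> h (k s) = s" "\<And>x. x \<in> K \<Longrightarrow> h x \<in> A" "\<And>s. s \<in> A \<Longrightarrow> k s \<in> K"
    and kc: "continuous_map (subtopology (surf P) A) (top_of_set K) k"
    using h(1) AP unfolding homeomorphic_maps_def by (auto simp: continuous_map_in_subtopology inf.absorb2 Pi_iff)
  have "continuous_map (top_of_set K) (subtopology (surf Q) B) \<gamma>"
    using develops_continuous_map[OF \<gamma>(1)] \<gamma>(3) by (simp add: continuous_map_in_subtopology image_subset_iff_funcset)
  from continuous_map_compose[OF kc this]
  show "continuous_map (subtopology (surf P) A) (subtopology (surf Q) B) (\<lambda>s. \<gamma> (k s))" by (simp add: o_def)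
  show "\<gamma> (k (bpt P)) = bpt Q" using \<gamma> z0 hk by metis
  fix s assume s: "s \<in> A"
  let ?x = "k s"
  have x: "?x \<in> K" "h ?x = s" using hk s by auto
  obtain U \<phi> where U: "(U, \<phi>) \<in> charts P" "s \<in> U" using chart_exists[OF P(1), of s] s AP by auto
  obtain V \<psi> where V: "(V, \<psi>) \<in> charts Q" "\<gamma> ?x \<in> V" using chart_exists[OF P(2) develops_topspace[OF \<gamma>(1) x(1)]] .
  have hU: "h ?x \<in> U" using x U by simp
  have "\<forall>\<^sub>F y in nhds ?x. y \<in> K \<longrightarrow> h y \<in> U \<and> \<gamma> y \<in> V \<and> \<phi> (h y) - \<phi> s = \<psi> (\<gamma> y) - \<psi> (\<gamma> ?x)"
    using eventually_in_open[OF develops_continuous_map[OF h(2)] chart_openin(1)[OF P(1) U(1)] x(1) hU]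
      eventually_in_open[OF develops_continuous_map[OF \<gamma>(1)] chart_openin(1)[OF P(2) V(1)] x(1) V(2)]
      developsD[OF h(2) x(1) U(1) hU] developsD[OF \<gamma>(1) x(1) V]
    by eventually_elim (simp add: x)
  then obtain N where N: "open N" "?x \<in> N" "\<And>y. y \<in> N \<Longrightarrow> y \<in> K \<Longrightarrow> h y \<in> U \<and> \<gamma> y \<in> V \<and> \<phi> (h y) - \<phi> s = \<psi> (\<gamma> y) - \<psi> (\<gamma> ?x)"
    unfolding eventually_nhds by blast
  have "openin (subtopology (surf P) A) {s \<in> A. k s \<in> N}"
    using openin_continuous_map_preimage[OF kc, of "K \<inter> N"] N(1) AP hk(4)
    by (simp add: openin_open_Int inf.absorb2) (metis (no_types, lifting) Collect_cong)
  then obtain O' where O': "openin (surf P) O'" "{s \<in> A. k s \<in> N} = O' \<inter> A" by (auto simp: openin_subtopology)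
  let ?U = "U \<inter> O'"
  have "(?U, restrict \<phi> ?U) \<in> charts P"
    using chart_restrict[OF P(1) U(1), of ?U] chart_openin(1)[OF P(1) U(1)] O' by auto
  moreover have "s \<in> ?U" using U s N O'(2) by auto
  moreover have "(\<lambda>s. \<gamma> (k s)) ` (?U \<inter> A) \<subseteq> V" using O'(2) N(3) hk by blast
  moreover have "\<forall>s'\<in>?U \<inter> A. \<psi> (\<gamma> (k s')) = (\<psi> (\<gamma> ?x) - \<phi> s) + restrict \<phi> ?U s'"
  proof
    fix s' assume s': "s' \<in> ?U \<inter> A"
    then have "k s' \<in> N" "k s' \<in> K" "h (k s') = s'" using O'(2) hk by auto
    from N(3)[OF this(1,2)] this(3) have "\<phi> s' - \<phi> s = \<psi> (\<gamma> (k s')) - \<psi> (\<gamma> ?x)" by simp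
    then show "\<psi> (\<gamma> (k s')) = (\<psi> (\<gamma> ?x) - \<phi> s) + restrict \<phi> ?U s'"
      using s' by (simp add: algebra_simps)
  qed
  ultimately show "\<exists>U \<phi> V \<psi> v. (U, \<phi>) \<in> charts P \<and> s \<in> U \<and> (V, \<psi>) \<in> charts Q \<and>
        (\<lambda>s. \<gamma> (k s)) ` (U \<inter> A) \<subseteq> V \<and> (\<forall>s'\<in>U \<inter> A. \<psi> (\<gamma> (k s')) = v + \<phi> s')"
    using V(1) by blast
qed

section \<open>Plane domains as translation surfaces\<close>

text \<open>
  Charts take values in \<open>real^2\<close>, whereas the tubes come from holomorphic functions; these are the two
  mutually inverse identifications of the planes.
\<close>

definition vcomplex :: "real^2 \<Rightarrow> complex" where
  "vcomplex v = Complex (v $ 1) (v $ 2)"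

definition cvec :: "complex \<Rightarrow> real^2" where
  "cvec w = vector [Re w, Im w]"

lemma cvec_nth [simp]: "cvec w $ 1 = Re w" "cvec w $ 2 = Im w"
  by (simp_all add: cvec_def)

lemma linear_cvec: "linear cvec"
  by (rule linearI) (simp_all add: vec_eq_iff forall_2)

lemma norm_cvec [simp]: "norm (cvec w) = norm w"
  by (simp add: norm_vec_def L2_set_def sum_2 cmod_def)

lemma inj_cvec: "inj cvec"
  by (rule injI) (simp add: vec_eq_iff forall_2 complex_eq_iff)

lemma cvec_vcomplex [simp]: "cvec (vcomplex v) = v"
  by (simp add: vcomplex_def vec_eq_iff forall_2)

lemma surj_cvec: "surj cvec"
  by (metis cvec_vcomplex surjI)

lemma norm_vcomplex [simp]: "norm (vcomplex v) = norm v"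
  using norm_cvec[of "vcomplex v"] by simp

lemma continuous_on_vcomplex [continuous_intros]:
  "continuous_on S g \<Longrightarrow> continuous_on S (\<lambda>x. vcomplex (g x))"
  unfolding vcomplex_def Complex_eq by (intro continuous_intros)

lemma continuous_on_cvec [continuous_intros]:
  fixes g :: "'k::topological_space \<Rightarrow> complex"
  assumes "continuous_on S g"
  shows "continuous_on S (\<lambda>x. cvec (g x))"
  using continuous_on_compose2[OF linear_continuous_on[of cvec UNIV] assms] linear_cvec
  by (simp add: linear_conv_bounded_linear)

lemma homeomorphism_imp_homeomorphic_maps:
  "homeomorphism S T f g \<Longrightarrow> homeomorphic_maps (top_of_set S) (top_of_set T) f g"
  unfolding homeomorphic_maps_def homeomorphism_def by auto

lemma second_countable_euclidean: "second_countable (euclidean :: 'k::second_countable_topology topology)"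
proof -
  obtain B :: "'k set set" where "countable B" "topological_basis B" using ex_countable_basis by blast
  then have "\<forall>V\<in>B. openin euclidean V" "\<forall>U x. openin euclidean U \<and> x \<in> U \<longrightarrow> (\<exists>V\<in>B. x \<in> V \<and> V \<subseteq> U)"
    by (simp add: topological_basis_open) (metis \<open>topological_basis B\<close> open_openin topological_basisE)
  then show ?thesis unfolding second_countable_def using \<open>countable B\<close> by blast
qed

text \<open>
  The plane domain \<open>\<Omega>\<close> becomes a translation surface with developed map \<open>f\<close>, which is continuous and
  locally injective, hence a local homeomorphism by invariance of domain; and the compact convex set \<open>B\<close> becomes a closed disk in it, based at 0.
\<close>

definition disk_model :: "complex set \<Rightarrow> complex set \<Rightarrow> (complex \<Rightarrow> real^2) \<Rightarrow> bool" where
  "disk_model \<Omega> B f \<longleftrightarrow> open \<Omega> \<and> convex \<Omega> \<and> compact B \<and> convex B \<and> B \<subseteq> \<Omega> \<and> 0 \<in> interior B \<and>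
     continuous_on \<Omega> f \<and> (\<forall>w\<in>\<Omega>. \<exists>N. open N \<and> w \<in> N \<and> N \<subseteq> \<Omega> \<and> inj_on f N)"

text \<open>
  A type that carries a surface is at least as large as the plane, so it has room for copies of all plane
  domains.
\<close>

lemma complex_injection:
  assumes P0: "(P0 :: 'a pointed_structure) \<in> structures"
  obtains \<kappa> :: "complex \<Rightarrow> 'a" where "inj \<kappa>"
proof -
  obtain e r where e: "r > 0" "inj_on (e :: real^2 \<Rightarrow> 'a) (ball 0 r)"
    using sheet_exists[OF P0 openin_topspace structure_bpt[OF P0], of 0] by metis
  have "(UNIV :: (real^2) set) homeomorphic ball (0::real^2) r"
    using homeomorphic_ball_UNIV[OF e(1)] homeomorphic_sym by blast
  then obtain j k where jk: "homeomorphism (UNIV :: (real^2) set) (ball (0::real^2) r) j k"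
    unfolding homeomorphic_def by blast
  then have j: "inj j" "range j = ball 0 r"
    using homeomorphism_apply1[OF jk] homeomorphism_image1[OF jk] by (metis UNIV_I injI, blast)
  have "inj (e \<circ> j \<circ> cvec)"
    using j e(2) by (intro comp_inj_on inj_cvec) (auto simp: surj_cvec)
  then show ?thesis by (rule that)
qed

text \<open>
  The maximal atlas consists of all functions that locally differ from \<open>g\<close> by a constant.
\<close>

lemma developing_structure:
  fixes X :: "'a topology" and g :: "'a \<Rightarrow> real^2"
  assumes X: "surface X" "b \<in> topspace X" and g: "local_homeo_on X (topspace X) g"
  obtains T where "T \<in> structures" "surf T = X" "bpt T = b" "(topspace X, restrict g (topspace X)) \<in> charts T"
proof -
  define Ch where "Ch = {(U, \<phi>). openin X U \<and> \<phi> \<in> extensional U \<and>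
    (\<forall>x\<in>U. \<exists>W v. openin X W \<and> x \<in> W \<and> W \<subseteq> U \<and> (\<forall>y\<in>W. \<phi> y = g y + v))}"
  let ?c0 = "(topspace X, restrict g (topspace X))"
  have c0: "?c0 \<in> Ch"
    unfolding Ch_def using openin_subset by (auto intro!: exI[of _ "topspace X"] exI[of _ 0])
  have loc: "local_homeo_on X U \<phi>" if ch: "(U, \<phi>) \<in> Ch" for U \<phi>
    unfolding local_homeo_on_def
  proof
    fix x assume "x \<in> U"
    then have "\<exists>W v. openin X W \<and> x \<in> W \<and> W \<subseteq> U \<and> (\<forall>y\<in>W. \<phi> y = g y + v)"
      using ch unfolding Ch_def by blast
    then obtain W v where W: "openin X W" "x \<in> W" "W \<subseteq> U" "\<forall>y\<in>W. \<phi> y = g y + v" by blast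
    have "local_homeo_on X W \<phi>"
      by (rule local_homeo_on_subset[OF g W(1)]) (use W openin_subset[OF W(1)] in auto)
    then show "\<exists>W. openin X W \<and> x \<in> W \<and> W \<subseteq> U \<and> open (\<phi> ` W) \<and> homeomorphic_map (subtopology X W) (top_of_set (\<phi> ` W)) \<phi>"
    proof -
      obtain W' where "openin X W'" "x \<in> W'" "W' \<subseteq> W" "open (\<phi> ` W')"
          "homeomorphic_map (subtopology X W') (top_of_set (\<phi> ` W')) \<phi>"
        using bspec[OF \<open>local_homeo_on X W \<phi>\<close>[unfolded local_homeo_on_def] W(2)] by blast
      then show ?thesis using W(3) by blast
    qed
  qed
  have comp: "compatible X c c'" if c: "c \<in> Ch" "c' \<in> Ch" for c c'
    unfolding compatible_def
  proof
    fix x assume x: "x \<in> fst c \<inter> fst c'"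
    have Ch: "\<exists>W v. openin X W \<and> x \<in> W \<and> W \<subseteq> fst c \<and> (\<forall>y\<in>W. snd c y = g y + v)"
      if "c \<in> Ch" "x \<in> fst c" for c
      using that unfolding Ch_def by (cases c) simp
    obtain W v where W: "openin X W" "x \<in> W" "W \<subseteq> fst c" "\<forall>y\<in>W. snd c y = g y + v"
      using Ch[OF c(1)] x by blast
    obtain W' v' where W': "openin X W'" "x \<in> W'" "W' \<subseteq> fst c'" "\<forall>y\<in>W'. snd c' y = g y + v'"
      using Ch[OF c(2)] x by blast
    have "\<forall>y\<in>W \<inter> W'. snd c y - snd c' y = v - v'" using W(4) W'(4) by simp
    moreover have "openin X (W \<inter> W')" "x \<in> W \<inter> W'" "W \<inter> W' \<subseteq> fst c \<inter> fst c'" using W W' by auto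
    ultimately show "\<exists>W v. openin X W \<and> x \<in> W \<and> W \<subseteq> fst c \<inter> fst c' \<and> (\<forall>y\<in>W. snd c y - snd c' y = v)"
      by blast
  qed
  have atlas: "translation_atlas X Ch"
    unfolding translation_atlas_iff
  proof (intro conjI)
    show "\<forall>(U, \<phi>)\<in>Ch. openin X U \<and> \<phi> \<in> extensional U \<and> local_homeo_on X U \<phi>"
      using loc by (auto simp: Ch_def)
    have "fst c \<subseteq> topspace X" if "c \<in> Ch" for c
      using that openin_subset[of X "fst c"] by (cases c) (simp add: Ch_def)
    moreover have "topspace X \<subseteq> (\<Union>c\<in>Ch. fst c)" using UN_upper[OF c0, of fst] by simp
    ultimately have "(\<Union>c\<in>Ch. fst c) = topspace X" by blast
    then show "(\<Union>(U, \<phi>)\<in>Ch. U) = topspace X" by (simp add: case_prod_unfold)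
    show "\<forall>c\<in>Ch. \<forall>c'\<in>Ch. compatible X c c'" using comp by blast
  qed
  have maxi: "\<B> = Ch" if \<B>: "translation_atlas X \<B>" "Ch \<subseteq> \<B>" for \<B>
  proof
    show "\<B> \<subseteq> Ch"
    proof
      fix c assume c: "c \<in> \<B>"
      obtain V \<psi> where cV: "c = (V, \<psi>)" by (cases c)
      have V: "openin X V" "\<psi> \<in> extensional V" "compatible X (V, \<psi>) ?c0"
      proof -
        note at = \<B>(1)[unfolded translation_atlas_iff]
        show "openin X V" "\<psi> \<in> extensional V" using at c cV by auto
        show "compatible X (V, \<psi>) ?c0" using at c cV c0 \<B>(2) by blast
      qed
      have VX: "V \<subseteq> topspace X" using V(1) openin_subset by blast
      have "\<exists>W v. openin X W \<and> x \<in> W \<and> W \<subseteq> V \<and> (\<forall>y\<in>W. \<psi> y = g y + v)" if x: "x \<in> V" for x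
      proof -
        have "x \<in> fst (V, \<psi>) \<inter> fst ?c0" using x VX by auto
        from bspec[OF V(3)[unfolded compatible_def] this] obtain W v where W: "openin X W" "x \<in> W" "W \<subseteq> V \<inter> topspace X"
          "\<forall>y\<in>W. \<psi> y - restrict g (topspace X) y = v" by (auto simp only: fst_conv snd_conv)
        have "\<forall>y\<in>W. \<psi> y = g y + v"
        proof
          fix y assume "y \<in> W"
          then have "\<psi> y - g y = v" using W(3,4) by (metis IntD2 restrict_apply' subsetD)
          then show "\<psi> y = g y + v" by (simp add: diff_eq_eq add.commute)
        qed
        then show ?thesis using W by blast
      qed
      then show "c \<in> Ch" using V cV unfolding Ch_def by blast
    qed
  qed (rule \<B>(2))
  define T where "T = \<lparr>surf = X, bpt = b, charts = Ch\<rparr>"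
  have "T \<in> structures"
    unfolding structures_def maximal_translation_atlas_def T_def using X atlas maxi by simp
  then show ?thesis by (rule that) (simp_all add: T_def c0)
qed

text \<open>
  The topology and the developed map of \<open>\<Omega>\<close> are transported along an injection of the plane into the
  type of the given structure \<open>P0\<close>.
\<close>

lemma model_structure:
  assumes P0: "(P0 :: 'a pointed_structure) \<in> structures" and M: "disk_model \<Omega> B f"
  obtains T :: "'a pointed_structure" and \<kappa> \<kappa>' where "T \<in> structures"
    "homeomorphic_maps (top_of_set \<Omega>) (surf T) \<kappa> \<kappa>'" "\<kappa> 0 = bpt T" "develops T \<Omega> \<kappa> f"
proof -
  obtain \<kappa> :: "complex \<Rightarrow> 'a" where \<kappa>: "inj \<kappa>" using complex_injection[OF P0] .
  let ?j = "inv \<kappa>"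
  have j [simp]: "?j (\<kappa> w) = w" for w using \<kappa> by simp
  have \<Omega>: "open \<Omega>" "convex \<Omega>" "0 \<in> \<Omega>" "continuous_on \<Omega> f"
    using M interior_subset unfolding disk_model_def by auto
  define X where "X = pullback_topology (\<kappa> ` \<Omega>) ?j euclidean"
  have opX: "openin X S \<longleftrightarrow> (\<exists>U. open U \<and> S = \<kappa> ` (U \<inter> \<Omega>))" for S
  proof -
    have "?j -` U \<inter> \<kappa> ` \<Omega> = \<kappa> ` (U \<inter> \<Omega>)" for U by auto
    then show ?thesis by (simp add: X_def openin_pullback_topology)
  qed
  have topX: "topspace X = \<kappa> ` \<Omega>" by (simp add: X_def topspace_pullback_topology)
  have hm: "homeomorphic_maps (top_of_set \<Omega>) X \<kappa> ?j"
    unfolding homeomorphic_maps_def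
  proof (intro conjI)
    show "continuous_map (top_of_set \<Omega>) X \<kappa>"
      unfolding continuous_map_def
    proof (intro conjI allI impI)
      fix S assume "openin X S"
      then obtain U where U: "open U" "S = \<kappa> ` (U \<inter> \<Omega>)" using opX by auto
      then have "{x \<in> topspace (top_of_set \<Omega>). \<kappa> x \<in> S} = \<Omega> \<inter> U" using \<kappa> by (auto simp: inj_def)
      then show "openin (top_of_set \<Omega>) {x \<in> topspace (top_of_set \<Omega>). \<kappa> x \<in> S}" using U(1) by (simp add: openin_open_Int)
    qed (use topX in auto)
    show "continuous_map X (top_of_set \<Omega>) ?j"
      unfolding continuous_map_def
    proof (intro conjI allI impI)
      fix S assume "openin (top_of_set \<Omega>) S"
      then obtain U where U: "open U" "S = \<Omega> \<inter> U" by (auto simp: openin_open)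
      then have "{x \<in> topspace X. ?j x \<in> S} = \<kappa> ` (U \<inter> \<Omega>)" using topX by auto
      then show "openin X {x \<in> topspace X. ?j x \<in> S}" using U(1) opX by auto
    qed (use topX in auto)
    show "\<forall>x\<in>topspace (top_of_set \<Omega>). ?j (\<kappa> x) = x" by simp
    show "\<forall>y\<in>topspace X. \<kappa> (?j y) = y" using topX by auto
  qed
  then have hs: "top_of_set \<Omega> homeomorphic_space X" unfolding homeomorphic_space_def by blast
  have cc: "continuous_on \<Omega> cvec" "inj_on cvec \<Omega>"
    using continuous_on_cvec[OF continuous_on_id] inj_on_subset[OF inj_cvec] by auto
  have oc: "open (cvec ` \<Omega>)" by (rule invariance_of_domain_gen[OF \<Omega>(1) cc]) simp
  obtain q where "homeomorphism \<Omega> (cvec ` \<Omega>) cvec q"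
    using invariance_of_domain_homeomorphism[OF \<Omega>(1) cc(1) _ cc(2)] by auto
  then have "top_of_set \<Omega> homeomorphic_space top_of_set (cvec ` \<Omega>)"
    using homeomorphism_imp_homeomorphic_maps unfolding homeomorphic_space_def by blast
  then have hs2: "X homeomorphic_space top_of_set (cvec ` \<Omega>)"
    using hs homeomorphic_space_sym homeomorphic_space_trans by blast
  have sX: "surface X"
    unfolding surface_def
  proof (intro conjI ballI)
    show "connected_space X"
      using homeomorphic_connected_space[OF hs] convex_connected[OF \<Omega>(2)]
      by (simp add: connectedin_def flip: connectedin_iff_connected)
    show "Hausdorff_space X"
      using homeomorphic_Hausdorff_space[OF hs] Hausdorff_space_subtopology[OF Hausdorff_space_euclidean] by blast
    show "second_countable X"
      using homeomorphic_space_second_countability[OF hs] second_countable_subtopology[OF second_countable_euclidean] by blast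
    fix x assume "x \<in> topspace X"
    then show "\<exists>U V. openin X U \<and> x \<in> U \<and> open (V :: (real^2) set) \<and> subtopology X U homeomorphic_space top_of_set V"
      using hs2 oc by (intro exI[of _ "topspace X"] exI[of _ "cvec ` \<Omega>"]) auto
  qed
  have bX: "\<kappa> 0 \<in> topspace X" using \<Omega>(3) topX by auto
  have lX: "local_homeo_on X (topspace X) (\<lambda>x. f (?j x))"
    unfolding local_homeo_on_def
  proof
    fix x assume "x \<in> topspace X"
    then obtain w where w: "x = \<kappa> w" "w \<in> \<Omega>" using topX by auto
    then obtain N where N: "open N" "w \<in> N" "N \<subseteq> \<Omega>" "inj_on f N"
      using M unfolding disk_model_def by blast
    have cN: "continuous_on N f" using \<Omega>(4) N(3) continuous_on_subset by blast
    have im: "(\<lambda>x. f (?j x)) ` \<kappa> ` N = f ` N" by (auto simp: image_image)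
    have "open (f ` N)" using N cN by (intro invariance_of_domain_gen) auto
    moreover obtain q where "homeomorphism N (f ` N) f q"
      using invariance_of_domain_homeomorphism[OF N(1) cN _ N(4)] by auto
    then have "homeomorphic_map (top_of_set N) (top_of_set (f ` N)) f"
      using homeomorphism_imp_homeomorphic_maps unfolding homeomorphic_map_maps by blast
    moreover have "homeomorphic_map (subtopology X (\<kappa> ` N)) (top_of_set N) ?j"
    proof -
      have "homeomorphic_maps X (top_of_set \<Omega>) ?j \<kappa>" using hm homeomorphic_maps_sym by blast
      moreover have "?j ` (topspace X \<inter> \<kappa> ` N) = topspace (top_of_set \<Omega>) \<inter> N"
      proof -
        have "topspace X \<inter> \<kappa> ` N = \<kappa> ` N" using N(3) topX by blast
        then show ?thesis using N(3) by (auto simp: image_image)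
      qed
      ultimately have "homeomorphic_maps (subtopology X (\<kappa> ` N)) (subtopology (top_of_set \<Omega>) N) ?j \<kappa>"
        by (rule homeomorphic_maps_subtopologies)
      then show ?thesis using N(3) by (auto simp: homeomorphic_map_maps subtopology_subtopology inf.absorb2)
    qed
    ultimately have "homeomorphic_map (subtopology X (\<kappa> ` N)) (top_of_set (f ` N)) (f \<circ> ?j)"
      using homeomorphic_map_compose by blast
    moreover have "openin X (\<kappa> ` N)" using N(1,3) opX by (metis inf.absorb1)
    ultimately show "\<exists>W. openin X W \<and> x \<in> W \<and> W \<subseteq> topspace X \<and> open ((\<lambda>x. f (?j x)) ` W) \<and>
        homeomorphic_map (subtopology X W) (top_of_set ((\<lambda>x. f (?j x)) ` W)) (\<lambda>x. f (?j x))"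
      using w N topX \<open>open (f ` N)\<close> im by (intro exI[of _ "\<kappa> ` N"]) (auto simp: o_def)
  qed
  obtain T where T: "T \<in> structures" "surf T = X" "bpt T = \<kappa> 0"
    "(topspace X, restrict (\<lambda>x. f (?j x)) (topspace X)) \<in> charts T"
    by (rule developing_structure[OF sX bX lX])
  have "develops T \<Omega> \<kappa> f"
  proof (rule developsI[OF T(1)])
    show "continuous_map (top_of_set \<Omega>) (surf T) \<kappa>" using hm T(2) by (simp add: homeomorphic_maps_def)
    fix x assume x: "x \<in> \<Omega>"
    have "\<forall>\<^sub>F y in nhds x. y \<in> \<Omega> \<longrightarrow> restrict (\<lambda>x. f (?j x)) (topspace X) (\<kappa> y) - restrict (\<lambda>x. f (?j x)) (topspace X) (\<kappa> x) = f y - f x"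
      using x topX by simp
    then show "\<exists>U \<phi>. (U, \<phi>) \<in> charts T \<and> \<kappa> x \<in> U \<and> (\<forall>\<^sub>F y in nhds x. y \<in> \<Omega> \<longrightarrow> \<phi> (\<kappa> y) - \<phi> (\<kappa> x) = f y - f x)"
      using T(4) x topX by blast
  qed
  then show ?thesis using that[OF T(1), of \<kappa> ?j] hm T by simp
qed

section \<open>Subbasic sets in terms of lifts\<close>

text \<open>
  A subset \<open>D\<close> of \<open>R\<close> containing the basepoint, its parametrization \<open>h\<close> with inverse \<open>k\<close>, the developed
  map \<open>d\<close> of \<open>h\<close> and the parameter \<open>z0\<close> of the basepoint. Below, \<open>K\<close> is a round disk or a tube.
\<close>

definition parametrizes where
  "parametrizes R D K h k d z0 \<longleftrightarrow> R \<in> structures \<and> D \<in> PC R \<and>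
     homeomorphic_maps (top_of_set K) (subtopology (surf R) D) h k \<and> develops R K h d \<and> z0 \<in> K \<and> h z0 = bpt R"

definition lifts where
  "lifts P K d z0 \<gamma> \<longleftrightarrow> develops P K \<gamma> d \<and> \<gamma> z0 = bpt P"

lemma parametrizesD:
  assumes "parametrizes R D K h k d z0"
  shows "R \<in> structures" "D \<in> PC R" "homeomorphic_maps (top_of_set K) (subtopology (surf R) D) h k"
    "develops R K h d" "z0 \<in> K" "h z0 = bpt R" "D \<subseteq> topspace (surf R)"
    "\<And>x. x \<in> K \<Longrightarrow> k (h x) = x" "\<And>s. s \<in> D \<Longrightarrow> h (k s) = s" "\<And>x. x \<in> K \<Longrightarrow> h x \<in> D" "\<And>s. s \<in> D \<Longrightarrow> k s \<in> K"
    "continuous_map (subtopology (surf R) D) (top_of_set K) k"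
proof -
  show 1: "R \<in> structures" "D \<in> PC R" "homeomorphic_maps (top_of_set K) (subtopology (surf R) D) h k"
    "develops R K h d" "z0 \<in> K" "h z0 = bpt R"
    using assms by (auto simp: parametrizes_def)
  show 2: "D \<subseteq> topspace (surf R)" using 1(2) path_connectedin_subset_topspace unfolding PC_def by blast
  have *: "continuous_map (subtopology (surf R) D) (top_of_set K) k" "continuous_map (top_of_set K) (subtopology (surf R) D) h"
    "\<forall>x\<in>K. k (h x) = x" "\<forall>s\<in>D. h (k s) = s"
    using 1(3) 2 unfolding homeomorphic_maps_def by (auto simp: inf.absorb2)
  then show "continuous_map (subtopology (surf R) D) (top_of_set K) k" "\<And>x. x \<in> K \<Longrightarrow> k (h x) = x" "\<And>s. s \<in> D \<Longrightarrow> h (k s) = s"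
    by auto
  show "\<And>x. x \<in> K \<Longrightarrow> h x \<in> D" using continuous_map_image_subset_topspace[OF *(2)] 2 by auto
  show "\<And>s. s \<in> D \<Longrightarrow> k s \<in> K" using continuous_map_image_subset_topspace[OF *(1)] 2 by auto
qed

lemma develops_iso:
  assumes P: "P \<in> structures" "Q \<in> structures" and j: "is_iso j P Q" and \<gamma>: "develops P K \<gamma> d"
  shows "develops Q K (\<lambda>x. j (\<gamma> x)) d"
proof (rule developsI[OF P(2)])
  let ?S = "topspace (surf P)"
  have jm: "homeomorphic_map (surf P) (surf Q) j" using j by (simp add: is_iso_def)
  then have inj: "inj_on j ?S" using homeomorphic_imp_injective_map by blast
  show "continuous_map (top_of_set K) (surf Q) (\<lambda>x. j (\<gamma> x))"
    using continuous_map_compose[OF develops_continuous_map[OF \<gamma>] homeomorphic_imp_continuous_map[OF jm]]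
    by (simp add: o_def)
  fix x assume x: "x \<in> K"
  obtain U \<phi> where U: "(U, \<phi>) \<in> charts P" "\<gamma> x \<in> U" using chart_exists[OF P(1) develops_topspace[OF \<gamma> x]] .
  let ?\<psi> = "restrict (\<phi> \<circ> inv_into ?S j) (j ` U)"
  have "push_chart ?S j (U, \<phi>) \<in> charts Q" using j U(1) unfolding is_iso_def by (metis imageI)
  then have ch: "(j ` U, ?\<psi>) \<in> charts Q" by (simp add: push_chart_def)
  have US: "U \<subseteq> ?S" using charts_structures(1)[OF P(1) U(1)] .
  have \<psi>: "?\<psi> (j s) = \<phi> s" if "s \<in> U" for s
    using that US inj by (simp add: subset_iff)
  have "\<forall>\<^sub>F y in nhds x. y \<in> K \<longrightarrow> ?\<psi> (j (\<gamma> y)) - ?\<psi> (j (\<gamma> x)) = d y - d x"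
    using developsD[OF \<gamma> x U] eventually_in_open[OF develops_continuous_map[OF \<gamma>] chart_openin(1)[OF P(1) U(1)] x U(2)]
    by eventually_elim (metis \<psi> U(2))
  then show "\<exists>U \<phi>. (U, \<phi>) \<in> charts Q \<and> j (\<gamma> x) \<in> U \<and>
       (\<forall>\<^sub>F y in nhds x. y \<in> K \<longrightarrow> \<phi> (j (\<gamma> y)) - \<phi> (j (\<gamma> x)) = d y - d x)"
    using ch U(2) by blast
qed

lemma \<M>_classE:
  assumes "c \<in> \<M>"
  obtains P where "P \<in> structures" "c = iso_rel `` {P}"
  using assms unfolding \<M>_def by (rule quotientE) (rule that)

lemma class_in_\<M>: "P \<in> structures \<Longrightarrow> iso_rel `` {P} \<in> \<M>"
  unfolding \<M>_def by (rule quotientI)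

lemma \<E>_classE:
  assumes "e \<in> \<E>"
  obtains P x where "P \<in> structures" "x \<in> topspace (surf P)" "e = iso_rel_pt `` {(P, x)}"
proof -
  obtain p where "p \<in> structures_pt" "e = iso_rel_pt `` {p}"
    using assms unfolding \<E>_def by (rule quotientE)
  then show ?thesis using that by (cases p) (auto simp: structures_pt_def)
qed

lemma class_in_\<E>: "P \<in> structures \<Longrightarrow> x \<in> topspace (surf P) \<Longrightarrow> iso_rel_pt `` {(P, x)} \<in> \<E>"
  unfolding \<E>_def by (rule quotientI) (simp add: structures_pt_def)

lemma self_in_class: "P \<in> structures \<Longrightarrow> P \<in> iso_rel `` {P}"
  using is_iso_id unfolding iso_rel_def by blast

lemma self_in_class_pt: "P \<in> structures \<Longrightarrow> x \<in> topspace (surf P) \<Longrightarrow> (P, x) \<in> iso_rel_pt `` {(P, x)}"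
  using is_iso_id[of P] unfolding iso_rel_pt_def structures_pt_def by fastforce

lemma class_memberE:
  assumes "P' \<in> iso_rel `` {P}"
  obtains j where "P' \<in> structures" "is_iso j P' P"
  using assms is_iso_inverse unfolding iso_rel_def by blast

lemma class_pt_memberE:
  assumes "(P', x') \<in> iso_rel_pt `` {(P, x)}"
  obtains j where "P' \<in> structures" "x' \<in> topspace (surf P')" "is_iso j P' P" "j x' = x"
proof -
  have "((P', x'), (P, x)) \<in> iso_rel_pt"
    using assms equiv_iso_rel_pt by (meson Image_singleton_iff equivE symE)
  then show ?thesis using that by (auto simp: iso_rel_pt_def structures_pt_def)
qed

text \<open>
  The isomorphism \<open>j\<close> appears because membership of a class in a subbasic set is witnessed by some
  representative \<open>P'\<close>, and the lift is wanted in a given representative \<open>P\<close>.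
\<close>

lemma immersion_lifts:
  assumes p: "parametrizes R D K h k d z0" and P: "P \<in> structures" "P' \<in> structures" and j: "is_iso j P' P"
    and i: "is_immersion R D P' (topspace (surf P')) \<iota>"
  shows "lifts P K d z0 (\<lambda>z. j (\<iota> (h z)))"
proof -
  note p = parametrizesD[OF p]
  have "h ` K \<subseteq> D" using p(10) by blast
  note i' = develops_immersion[OF p(1) P(2) i p(4) this]
  have "j (\<iota> (h z0)) = bpt P" using i'(3) j p(6) by (simp add: is_iso_def)
  then show ?thesis using develops_iso[OF P(2,1) j i'(1)] by (simp add: lifts_def)
qed

lemma lifts_immersion:
  assumes p: "parametrizes R D K h k d z0" and P: "P \<in> structures" and \<gamma>: "lifts P K d z0 \<gamma>"
  shows "is_immersion R D P (topspace (surf P)) (\<lambda>s. \<gamma> (k s))"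
proof -
  note p = parametrizesD[OF p]
  have "\<gamma> ` K \<subseteq> topspace (surf P)" using \<gamma> develops_topspace unfolding lifts_def by blast
  then show ?thesis using \<gamma> unfolding lifts_def
    by (intro immersion_from_develops[OF p(1) P p(2,3,4,5,6)]) auto
qed

lemma immerses_iff:
  assumes p: "parametrizes R D K h k d z0" and P: "P \<in> structures"
  shows "immerses R D (iso_rel `` {P}) \<longleftrightarrow> (\<exists>\<gamma>. lifts P K d z0 \<gamma>)"
proof
  assume "immerses R D (iso_rel `` {P})"
  then obtain P' \<iota> where P': "P' \<in> iso_rel `` {P}" "is_immersion R D P' (topspace (surf P')) \<iota>"
    unfolding immerses_def by blast
  from P'(1) obtain j where j: "P' \<in> structures" "is_iso j P' P" by (rule class_memberE)
  show "\<exists>\<gamma>. lifts P K d z0 \<gamma>" using immersion_lifts[OF p P j P'(2)] by blast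
next
  assume "\<exists>\<gamma>. lifts P K d z0 \<gamma>"
  then show "immerses R D (iso_rel `` {P})"
    using lifts_immersion[OF p P] self_in_class[OF P] unfolding immerses_def by blast
qed

lemma image_parametrized:
  assumes p: "parametrizes R D K h k d z0" and U: "U \<subseteq> D"
  shows "(\<lambda>s. \<gamma> (k s)) ` U = \<gamma> ` {z \<in> K. h z \<in> U}"
proof -
  note p = parametrizesD[OF p]
  have "k ` U = {z \<in> K. h z \<in> U}"
  proof (intro equalityI subsetI)
    fix z assume "z \<in> k ` U"
    then show "z \<in> {z \<in> K. h z \<in> U}" using p(9,11) U by (metis (mono_tags, lifting) image_iff mem_Collect_eq subsetD)
  next
    fix z assume "z \<in> {z \<in> K. h z \<in> U}"
    then show "z \<in> k ` U" using p(8) by (metis (mono_tags, lifting) image_eqI mem_Collect_eq)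
  qed
  then show ?thesis by (metis image_image)
qed

lemma image_unparametrized:
  assumes p: "parametrizes R D K h k d z0" and U: "U \<subseteq> D"
  shows "\<gamma> ` U = (\<lambda>z. \<gamma> (h z)) ` {z \<in> K. h z \<in> U}"
proof -
  have "\<gamma> ` U = (\<lambda>s. \<gamma> (h (k s))) ` U" using parametrizesD(9)[OF p] U by (intro image_cong) auto
  then show ?thesis using image_parametrized[OF p U, of "\<lambda>z. \<gamma> (h z)"] by simp
qed

lemma \<M>_plus_iff:
  assumes p: "parametrizes R D K h k d z0" and P: "P \<in> structures" and U: "U \<subseteq> D"
  shows "iso_rel `` {P} \<in> \<M>_plus R D U \<longleftrightarrow> (\<exists>\<gamma>. lifts P K d z0 \<gamma> \<and> bpt P \<in> \<gamma> ` {z \<in> K. h z \<in> U})"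
proof
  assume "iso_rel `` {P} \<in> \<M>_plus R D U"
  then obtain P' \<iota> where P': "P' \<in> iso_rel `` {P}" "is_immersion R D P' (topspace (surf P')) \<iota>" "bpt P' \<in> \<iota> ` U"
    unfolding \<M>_plus_def by blast
  from P'(1) obtain j where j: "P' \<in> structures" "is_iso j P' P" by (rule class_memberE)
  have "bpt P = j (bpt P')" using j(2) by (simp add: is_iso_def)
  then have "bpt P \<in> (\<lambda>s. j (\<iota> s)) ` U" using P'(3) by auto
  then show "\<exists>\<gamma>. lifts P K d z0 \<gamma> \<and> bpt P \<in> \<gamma> ` {z \<in> K. h z \<in> U}"
    using immersion_lifts[OF p P j P'(2)] unfolding image_unparametrized[OF p U] by blast
next
  assume "\<exists>\<gamma>. lifts P K d z0 \<gamma> \<and> bpt P \<in> \<gamma> ` {z \<in> K. h z \<in> U}"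
  then obtain \<gamma> where "lifts P K d z0 \<gamma>" "bpt P \<in> (\<lambda>s. \<gamma> (k s)) ` U"
    unfolding image_parametrized[OF p U] by blast
  then show "iso_rel `` {P} \<in> \<M>_plus R D U"
    using lifts_immersion[OF p P] self_in_class[OF P] class_in_\<M>[OF P] unfolding \<M>_plus_def by blast
qed

lemma \<M>_minus_iff:
  assumes p: "parametrizes R D K h k d z0" and P: "P \<in> structures" and C: "C \<subseteq> D"
  shows "iso_rel `` {P} \<in> \<M>_minus R D C \<longleftrightarrow> (\<exists>\<gamma>. lifts P K d z0 \<gamma> \<and> bpt P \<notin> \<gamma> ` {z \<in> K. h z \<in> C})"
proof
  assume "iso_rel `` {P} \<in> \<M>_minus R D C"
  then obtain P' \<iota> where P': "P' \<in> iso_rel `` {P}" "is_immersion R D P' (topspace (surf P')) \<iota>" "bpt P' \<notin> \<iota> ` C"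
    unfolding \<M>_minus_def by blast
  from P'(1) obtain j where j: "P' \<in> structures" "is_iso j P' P" by (rule class_memberE)
  have inj: "inj_on j (topspace (surf P'))" and b: "bpt P = j (bpt P')"
    using j(2) homeomorphic_imp_injective_map by (auto simp: is_iso_def)
  have "continuous_map (subtopology (surf R) D) (surf P') \<iota>"
    using P'(2) unfolding is_immersion_def by simp
  from continuous_map_image_subset_topspace[OF this]
  have im: "\<iota> ` D \<subseteq> topspace (surf P')" using parametrizesD(7)[OF p] by (simp add: inf.absorb2)
  have "bpt P \<notin> (\<lambda>s. j (\<iota> s)) ` C"
  proof (rule contrapos_nn)
    assume "bpt P \<in> (\<lambda>s. j (\<iota> s)) ` C"
    then obtain s where s: "s \<in> C" "j (bpt P') = j (\<iota> s)" using b by auto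
    then have "\<iota> s \<in> topspace (surf P')" using im C by blast
    then have "bpt P' = \<iota> s" using inj_onD[OF inj s(2) structure_bpt[OF j(1)]] by blast
    then show "bpt P' \<in> \<iota> ` C" using s(1) by blast
  qed (rule P'(3))
  then show "\<exists>\<gamma>. lifts P K d z0 \<gamma> \<and> bpt P \<notin> \<gamma> ` {z \<in> K. h z \<in> C}"
    using immersion_lifts[OF p P j P'(2)] unfolding image_unparametrized[OF p C] by blast
next
  assume "\<exists>\<gamma>. lifts P K d z0 \<gamma> \<and> bpt P \<notin> \<gamma> ` {z \<in> K. h z \<in> C}"
  then obtain \<gamma> where "lifts P K d z0 \<gamma>" "bpt P \<notin> (\<lambda>s. \<gamma> (k s)) ` C"
    unfolding image_parametrized[OF p C] by blast
  then show "iso_rel `` {P} \<in> \<M>_minus R D C"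
    using lifts_immersion[OF p P] self_in_class[OF P] class_in_\<M>[OF P] unfolding \<M>_minus_def by blast
qed

lemma \<E>_plus_iff:
  assumes p: "parametrizes R D K h k d z0" and P: "P \<in> structures" "x \<in> topspace (surf P)" and U: "U \<subseteq> D"
  shows "iso_rel_pt `` {(P, x)} \<in> \<E>_plus R D U \<longleftrightarrow> (\<exists>\<gamma>. lifts P K d z0 \<gamma> \<and> x \<in> \<gamma> ` {z \<in> K. h z \<in> U})"
proof
  assume "iso_rel_pt `` {(P, x)} \<in> \<E>_plus R D U"
  then obtain P' x' \<iota> where P': "(P', x') \<in> iso_rel_pt `` {(P, x)}" "is_immersion R D P' (topspace (surf P')) \<iota>" "x' \<in> \<iota> ` U"
    unfolding \<E>_plus_def by blast
  from P'(1) obtain j where j: "P' \<in> structures" "is_iso j P' P" "j x' = x" by (rule class_pt_memberE)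
  have "x \<in> (\<lambda>s. j (\<iota> s)) ` U" using P'(3) j(3) by auto
  then show "\<exists>\<gamma>. lifts P K d z0 \<gamma> \<and> x \<in> \<gamma> ` {z \<in> K. h z \<in> U}"
    using immersion_lifts[OF p P(1) j(1,2) P'(2)] unfolding image_unparametrized[OF p U] by blast
next
  assume "\<exists>\<gamma>. lifts P K d z0 \<gamma> \<and> x \<in> \<gamma> ` {z \<in> K. h z \<in> U}"
  then obtain \<gamma> where "lifts P K d z0 \<gamma>" "x \<in> (\<lambda>s. \<gamma> (k s)) ` U"
    unfolding image_parametrized[OF p U] by blast
  then show "iso_rel_pt `` {(P, x)} \<in> \<E>_plus R D U"
    using lifts_immersion[OF p P(1)] self_in_class_pt[OF P] class_in_\<E>[OF P] unfolding \<E>_plus_def by blast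
qed

lemma model_parametrizes:
  assumes P0: "(P0 :: 'a pointed_structure) \<in> structures" and M: "disk_model \<Omega> B f"
  obtains T :: "'a pointed_structure" and \<kappa> \<kappa>' where "parametrizes T (\<kappa> ` B) B \<kappa> \<kappa>' f 0" "closed_disk T (\<kappa> ` B)"
    "inj_on \<kappa> B"
    "\<And>U. open U \<Longrightarrow> U \<subseteq> B \<Longrightarrow> openin (surf T) (\<kappa> ` U) \<and> \<kappa> ` U \<subseteq> surf T interior_of (\<kappa> ` B)"
    "\<And>C. compact C \<Longrightarrow> C \<subseteq> B \<Longrightarrow> closedin (surf T) (\<kappa> ` C)"
proof -
  obtain T :: "'a pointed_structure" and \<kappa> \<kappa>' where T: "T \<in> structures"
    "homeomorphic_maps (top_of_set \<Omega>) (surf T) \<kappa> \<kappa>'" "\<kappa> 0 = bpt T" "develops T \<Omega> \<kappa> f"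
    using model_structure[OF P0 M] by metis
  have B: "compact B" "convex B" "B \<subseteq> \<Omega>" "0 \<in> interior B" "0 \<in> B" and \<Omega>: "open \<Omega>"
    using M interior_subset unfolding disk_model_def by auto
  have hm: "homeomorphic_map (top_of_set \<Omega>) (surf T) \<kappa>" using T(2) homeomorphic_map_maps by blast
  have cm: "continuous_map (top_of_set \<Omega>) (surf T) \<kappa>" using hm homeomorphic_imp_continuous_map by blast
  have inj: "inj_on \<kappa> \<Omega>" using homeomorphic_imp_injective_map[OF hm] by simp
  have top: "topspace (surf T) = \<kappa> ` \<Omega>" using homeomorphic_imp_surjective_map[OF hm] by simp
  have op: "openin (surf T) (\<kappa> ` U)" if "open U" "U \<subseteq> B" for U
  proof -
    have "openin (top_of_set \<Omega>) U" using that B \<Omega> by (meson open_subset order_trans)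
    then show ?thesis using homeomorphic_map_openness[OF hm, of U] that B by auto
  qed
  have "homeomorphic_maps (subtopology (top_of_set \<Omega>) B) (subtopology (surf T) (\<kappa> ` B)) \<kappa> \<kappa>'"
    by (rule homeomorphic_maps_subtopologies[OF T(2)]) (use B top in auto)
  then have hmB: "homeomorphic_maps (top_of_set B) (subtopology (surf T) (\<kappa> ` B)) \<kappa> \<kappa>'"
    using B(3) by (simp add: subtopology_subtopology inf.absorb2)
  have "path_connectedin (surf T) (\<kappa> ` B)"
  proof (rule path_connectedin_continuous_map_image[OF cm])
    show "path_connectedin (top_of_set \<Omega>) B"
      using convex_imp_path_connected[OF B(2)] B(3) by (simp add: path_connectedin_subtopology)
  qed
  then have PC: "\<kappa> ` B \<in> PC T" unfolding PC_def using B(5) T(3) by (auto simp: image_iff) metis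
  have int: "\<kappa> ` U \<subseteq> surf T interior_of (\<kappa> ` B)" if "open U" "U \<subseteq> B" for U
    by (rule interior_of_maximal) (use that op in auto)
  show ?thesis
  proof (rule that)
    show "parametrizes T (\<kappa> ` B) B \<kappa> \<kappa>' f 0"
      unfolding parametrizes_def using T PC hmB B develops_subset[OF T(4) B(3)] by simp
    have "aff_dim B = aff_dim (cball (0::real^2) 1)"
      using aff_dim_nonempty_interior[of B] aff_dim_nonempty_interior[of "cball (0::real^2) 1"] B(4) by auto
    then have "B homeomorphic cball (0::real^2) 1"
      using B by (intro homeomorphic_convex_compact_sets) auto
    then obtain q q' where "homeomorphism B (cball (0::real^2) 1) q q'" unfolding homeomorphic_def by blast
    then have "top_of_set B homeomorphic_space top_of_set (cball (0::real^2) 1)"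
      using homeomorphism_imp_homeomorphic_maps homeomorphic_space_def by blast
    moreover have "subtopology (surf T) (\<kappa> ` B) homeomorphic_space top_of_set B"
      using hmB homeomorphic_space_def homeomorphic_space_sym by blast
    moreover have "bpt T \<in> surf T interior_of (\<kappa> ` B)"
      using int[OF open_interior interior_subset] B(4) T(3) by (metis imageI subsetD)
    ultimately show "closed_disk T (\<kappa> ` B)"
      unfolding closed_disk_def using top B(3) homeomorphic_space_trans by blast
    show "inj_on \<kappa> B" using inj B(3) inj_on_subset by blast
    show "openin (surf T) (\<kappa> ` U) \<and> \<kappa> ` U \<subseteq> surf T interior_of (\<kappa> ` B)" if "open U" "U \<subseteq> B" for U
      using op int that by blast
    show "closedin (surf T) (\<kappa> ` C)" if C: "compact C" "C \<subseteq> B" for C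
    proof (rule compactin_imp_closedin[OF structure_Hausdorff[OF T(1)]])
      show "compactin (surf T) (\<kappa> ` C)"
        by (rule image_compactin[OF _ cm]) (use C B in \<open>auto simp: compactin_subtopology\<close>)
    qed
  qed
qed

definition subbasis_\<M> :: "'a pointed_structure set set set" where
  "subbasis_\<M> = insert \<M>
       ({{c \<in> \<M>. immerses R D c} | R D. R \<in> structures \<and> closed_disk R D} \<union>
        {{c \<in> \<M>. \<not> immerses R U c} | R U. R \<in> structures \<and> open_disk R U} \<union>
        {\<M>_plus R D U | R D U. R \<in> structures \<and> closed_disk R D \<and>
           openin (surf R) U \<and> U \<subseteq> surf R interior_of D} \<union>
        {\<M>_minus R D K | R D K. R \<in> structures \<and> closed_disk R D \<and>
           closedin (surf R) K \<and> K \<subseteq> D})"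

definition subbasis_\<E> :: "('a pointed_structure \<times> 'a) set set set" where
  "subbasis_\<E> = {{e \<in> \<E>. proj_\<E> e \<in> W} | W. openin immersive_topology_\<M> W} \<union>
      {\<E>_plus R D U | R D U. R \<in> structures \<and> closed_disk R D \<and>
         openin (surf R) U \<and> U \<subseteq> surf R interior_of D}"

lemma immersive_topology_\<M>_subbasis: "immersive_topology_\<M> = topology_generated_by subbasis_\<M>"
  unfolding immersive_topology_\<M>_def subbasis_\<M>_def ..

lemma immersive_topology_\<E>_subbasis: "immersive_topology_\<E> = topology_generated_by subbasis_\<E>"
  unfolding immersive_topology_\<E>_def subbasis_\<E>_def ..

lemma \<M>_subbasis_open:
  assumes "R \<in> structures" "closed_disk R D"
  shows "openin immersive_topology_\<M> {c \<in> \<M>. immerses R D c}"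
    "\<And>U. openin (surf R) U \<Longrightarrow> U \<subseteq> surf R interior_of D \<Longrightarrow> openin immersive_topology_\<M> (\<M>_plus R D U)"
    "\<And>C. closedin (surf R) C \<Longrightarrow> C \<subseteq> D \<Longrightarrow> openin immersive_topology_\<M> (\<M>_minus R D C)"
    "\<And>U. openin (surf R) U \<Longrightarrow> U \<subseteq> surf R interior_of D \<Longrightarrow> openin immersive_topology_\<E> (\<E>_plus R D U)"
proof -
  show "openin immersive_topology_\<M> {c \<in> \<M>. immerses R D c}"
    unfolding immersive_topology_\<M>_subbasis subbasis_\<M>_def
    by (rule topology_generated_by_Basis, rule insertI2, rule UnI1, rule UnI1, rule UnI1) (use assms in blast)
  show "openin immersive_topology_\<M> (\<M>_plus R D U)" if "openin (surf R) U" "U \<subseteq> surf R interior_of D" for U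
    unfolding immersive_topology_\<M>_subbasis subbasis_\<M>_def
    by (rule topology_generated_by_Basis, rule insertI2, rule UnI1, rule UnI2) (use assms that in blast)
  show "openin immersive_topology_\<M> (\<M>_minus R D C)" if "closedin (surf R) C" "C \<subseteq> D" for C
    unfolding immersive_topology_\<M>_subbasis subbasis_\<M>_def
    by (rule topology_generated_by_Basis, rule insertI2, rule UnI2) (use assms that in blast)
  show "openin immersive_topology_\<E> (\<E>_plus R D U)" if "openin (surf R) U" "U \<subseteq> surf R interior_of D" for U
    unfolding immersive_topology_\<E>_subbasis subbasis_\<E>_def
    by (rule topology_generated_by_Basis, rule UnI2) (use assms that in blast)
qed

lemma open_disk_subbasis_open:
  assumes "R \<in> structures" "open_disk R U"
  shows "openin immersive_topology_\<M> {c \<in> \<M>. \<not> immerses R U c}"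
  unfolding immersive_topology_\<M>_subbasis subbasis_\<M>_def
  by (rule topology_generated_by_Basis, rule insertI2, rule UnI1, rule UnI1, rule UnI2) (use assms in blast)

lemma proj_preimage_open: "openin immersive_topology_\<M> W \<Longrightarrow> openin immersive_topology_\<E> {e \<in> \<E>. proj_\<E> e \<in> W}"
  unfolding immersive_topology_\<E>_subbasis subbasis_\<E>_def by (rule topology_generated_by_Basis, rule UnI1) blast

text \<open>
  Together with the three lemmas that follow, this turns the subbasic sets of the immersive topologies
  into open conditions on lifts of functions \<open>f\<close> defined on plane sets \<open>B\<close>, without mention of the
  auxiliary structure in which \<open>B\<close> is a disk.
\<close>

lemma open_lifts:
  assumes P0: "(P0 :: 'a pointed_structure) \<in> structures" and M: "disk_model \<Omega> B f"
  obtains W :: "'a pointed_structure set set" where "openin immersive_topology_\<M> W"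
    "\<And>P. P \<in> structures \<Longrightarrow> iso_rel `` {P} \<in> W \<longleftrightarrow> (\<exists>\<beta>. lifts P B f 0 \<beta>)"
proof -
  obtain T :: "'a pointed_structure" and \<kappa> \<kappa>' where p: "parametrizes T (\<kappa> ` B) B \<kappa> \<kappa>' f 0" and D: "closed_disk T (\<kappa> ` B)"
    using model_parametrizes[OF P0 M] by metis
  show ?thesis
    by (rule that[OF \<M>_subbasis_open(1)[OF parametrizesD(1)[OF p] D]])
       (use immerses_iff[OF p] class_in_\<M> in blast)
qed

lemma open_lifts_plus:
  assumes P0: "(P0 :: 'a pointed_structure) \<in> structures" and M: "disk_model \<Omega> B f" and U: "open U" "U \<subseteq> B"
  obtains W :: "'a pointed_structure set set" where "openin immersive_topology_\<M> W"
    "\<And>P. P \<in> structures \<Longrightarrow> iso_rel `` {P} \<in> W \<longleftrightarrow> (\<exists>\<beta>. lifts P B f 0 \<beta> \<and> bpt P \<in> \<beta> ` U)"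
proof -
  obtain T :: "'a pointed_structure" and \<kappa> \<kappa>' where p: "parametrizes T (\<kappa> ` B) B \<kappa> \<kappa>' f 0" and D: "closed_disk T (\<kappa> ` B)"
    and inj: "inj_on \<kappa> B" and op: "openin (surf T) (\<kappa> ` U)" "\<kappa> ` U \<subseteq> surf T interior_of (\<kappa> ` B)"
    using model_parametrizes[OF P0 M] U by metis
  have "{z \<in> B. \<kappa> z \<in> \<kappa> ` U} = U" using inj_on_image_mem_iff[OF inj] U(2) by blast
  moreover have "\<kappa> ` U \<subseteq> \<kappa> ` B" using U(2) by blast
  ultimately show ?thesis
    using \<M>_plus_iff[OF p, where U = "\<kappa> ` U"] by (intro that[OF \<M>_subbasis_open(2)[OF parametrizesD(1)[OF p] D op]]) simp
qed

lemma open_lifts_minus: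
  assumes P0: "(P0 :: 'a pointed_structure) \<in> structures" and M: "disk_model \<Omega> B f" and C: "compact C" "C \<subseteq> B"
  obtains W :: "'a pointed_structure set set" where "openin immersive_topology_\<M> W"
    "\<And>P. P \<in> structures \<Longrightarrow> iso_rel `` {P} \<in> W \<longleftrightarrow> (\<exists>\<beta>. lifts P B f 0 \<beta> \<and> bpt P \<notin> \<beta> ` C)"
proof -
  obtain T :: "'a pointed_structure" and \<kappa> \<kappa>' where p: "parametrizes T (\<kappa> ` B) B \<kappa> \<kappa>' f 0" and D: "closed_disk T (\<kappa> ` B)"
    and inj: "inj_on \<kappa> B" and cl: "closedin (surf T) (\<kappa> ` C)"
    using model_parametrizes[OF P0 M] C by metis
  have "{z \<in> B. \<kappa> z \<in> \<kappa> ` C} = C" using inj_on_image_mem_iff[OF inj] C(2) by blast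
  moreover have "\<kappa> ` C \<subseteq> \<kappa> ` B" using C(2) by blast
  ultimately show ?thesis
    using \<M>_minus_iff[OF p, where C = "\<kappa> ` C"]
    by (intro that[OF \<M>_subbasis_open(3)[OF parametrizesD(1)[OF p] D cl]]) simp_all
qed

lemma open_lifts_\<E>:
  assumes P0: "(P0 :: 'a pointed_structure) \<in> structures" and M: "disk_model \<Omega> B f" and U: "open U" "U \<subseteq> B"
  obtains W :: "('a pointed_structure \<times> 'a) set set" where "openin immersive_topology_\<E> W"
    "\<And>P x. P \<in> structures \<Longrightarrow> x \<in> topspace (surf P) \<Longrightarrow>
       iso_rel_pt `` {(P, x)} \<in> W \<longleftrightarrow> (\<exists>\<beta>. lifts P B f 0 \<beta> \<and> x \<in> \<beta> ` U)"
proof -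
  obtain T :: "'a pointed_structure" and \<kappa> \<kappa>' where p: "parametrizes T (\<kappa> ` B) B \<kappa> \<kappa>' f 0" and D: "closed_disk T (\<kappa> ` B)"
    and inj: "inj_on \<kappa> B" and op: "openin (surf T) (\<kappa> ` U)" "\<kappa> ` U \<subseteq> surf T interior_of (\<kappa> ` B)"
    using model_parametrizes[OF P0 M] U by metis
  have "{z \<in> B. \<kappa> z \<in> \<kappa> ` U} = U" using inj_on_image_mem_iff[OF inj] U(2) by blast
  moreover have "\<kappa> ` U \<subseteq> \<kappa> ` B" using U(2) by blast
  ultimately show ?thesis
    using \<E>_plus_iff[OF p, where U = "\<kappa> ` U"] by (intro that[OF \<M>_subbasis_open(4)[OF parametrizesD(1)[OF p] D op]]) simp
qed

lemma closed_disk_parametrization: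
  assumes R: "R \<in> structures" and D: "closed_disk R D"
  obtains h k d z0 where "parametrizes R D (cball (0::real^2) 1) h k d z0" "d z0 = 0"
proof -
  have DR: "D \<subseteq> topspace (surf R)" using D by (simp add: closed_disk_def)
  have o: "bpt R \<in> D" using D interior_of_subset[of "surf R" D] by (auto simp: closed_disk_def)
  have hs: "top_of_set (cball (0::real^2) 1) homeomorphic_space subtopology (surf R) D"
  proof -
    have "subtopology (surf R) D homeomorphic_space top_of_set (cball (0::real^2) 1)"
      using D by (simp add: closed_disk_def)
    then show ?thesis by (rule homeomorphic_space_sym[THEN iffD1])
  qed
  then obtain h k where hk: "homeomorphic_maps (top_of_set (cball (0::real^2) 1)) (subtopology (surf R) D) h k"
    unfolding homeomorphic_space_def by blast
  then have c: "continuous_map (top_of_set (cball 0 1)) (surf R) h" "continuous_map (subtopology (surf R) D) (top_of_set (cball 0 1)) k"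
    "\<forall>s\<in>D. h (k s) = s"
    using DR unfolding homeomorphic_maps_def by (simp_all add: continuous_map_in_subtopology[of _ "surf R"] inf.absorb2)
  have "k ` D \<subseteq> cball 0 1" using continuous_map_image_subset_topspace[OF c(2)] DR by (simp add: inf.absorb2)
  then have z0: "k (bpt R) \<in> cball 0 1" using o by blast
  have hz0: "h (k (bpt R)) = bpt R" using c(3) o by blast
  obtain d where d: "develops R (cball 0 1) h d" "d (k (bpt R)) = 0"
    using develops_exists[OF R compact_cball convex_cball z0 c(1)] .
  have "path_connected_space (top_of_set (cball (0::real^2) 1))"
    using convex_imp_path_connected[OF convex_cball] by simp
  then have "path_connected_space (subtopology (surf R) D)"
    using homeomorphic_path_connected_space[OF hs] by blast
  then have "D \<in> PC R" using DR o by (simp add: PC_def path_connectedin_def)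
  then have "parametrizes R D (cball 0 1) h k d (k (bpt R))"
    unfolding parametrizes_def using R hk d z0 hz0 by blast
  then show ?thesis using that d(2) by blast
qed

text \<open>
  At a parameter of an interior point of \<open>D\<close>, the developed map is a chart composed with the
  homeomorphism \<open>h\<close> onto a neighbourhood in the surface.
\<close>

lemma developed_map_open:
  assumes p: "parametrizes R D K h k d z0" and U: "openin (surf R) U" "U \<subseteq> D"
    and z: "z \<in> K" "h z \<in> U" "open N" "z \<in> N"
  obtains \<epsilon> where "\<epsilon> > 0" "ball (d z) \<epsilon> \<subseteq> d ` {y \<in> K \<inter> N. h y \<in> U}"
proof -
  note p = parametrizesD[OF p]
  have hz: "h z \<in> topspace (surf R)" using z U(1) openin_subset by blast
  obtain V \<phi> where V: "(V, \<phi>) \<in> charts R" "h z \<in> V" "open (\<phi> ` V)"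
    "homeomorphic_map (subtopology (surf R) V) (top_of_set (\<phi> ` V)) \<phi>"
    using chart_injective_near[OF p(1) hz] .
  have oV: "openin (surf R) V" using chart_openin(1)[OF p(1) V(1)] .
  have VX: "V \<subseteq> topspace (surf R)" using oV openin_subset by blast
  obtain N' where N': "open N'" "z \<in> N'" "\<And>y. y \<in> N' \<Longrightarrow> y \<in> K \<longrightarrow> \<phi> (h y) - \<phi> (h z) = d y - d z"
    using developsD[OF p(4) z(1) V(1,2)] unfolding eventually_nhds by blast
  have "openin (top_of_set K) (K \<inter> (N \<inter> N'))" using z(3) N'(1) by (intro openin_open_Int open_Int)
  from openin_continuous_map_preimage[OF p(12) this]
  have "openin (subtopology (surf R) D) {s \<in> D. k s \<in> N \<inter> N'}"
    using p(7,11) by (simp add: inf.absorb2 cong: conj_cong)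
  then obtain Q where Q: "openin (surf R) Q" "{s \<in> D. k s \<in> N \<inter> N'} = Q \<inter> D" by (auto simp: openin_subtopology)
  let ?W = "Q \<inter> U \<inter> V"
  have oW: "openin (surf R) ?W" using Q(1) U(1) oV by (intro openin_Int)
  have W: "k s \<in> K \<and> k s \<in> N \<inter> N' \<and> h (k s) = s \<and> s \<in> U" if "s \<in> ?W" for s
    using that U(2) Q(2) p(9,11) by blast
  have "h z \<in> {s \<in> D. k s \<in> N \<inter> N'}" using z N'(2) U(2) p(8) by auto
  then have zW: "h z \<in> ?W" using Q(2) z(2) V(2) by blast
  have "openin (subtopology (surf R) V) ?W" using oW by (simp add: openin_open_subtopology oV)
  then have "openin (top_of_set (\<phi> ` V)) (\<phi> ` ?W)"
    using homeomorphic_map_openness[OF V(4), of ?W] VX by auto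
  then have "open (\<phi> ` ?W)" using V(3) openin_open_trans by blast
  then obtain \<epsilon> where \<epsilon>: "\<epsilon> > 0" "ball (\<phi> (h z)) \<epsilon> \<subseteq> \<phi> ` ?W"
    using zW by (metis imageI open_contains_ball)
  have "ball (d z) \<epsilon> \<subseteq> d ` {y \<in> K \<inter> N. h y \<in> U}"
  proof
    fix v assume "v \<in> ball (d z) \<epsilon>"
    then have "v - d z + \<phi> (h z) \<in> ball (\<phi> (h z)) \<epsilon>" by (simp add: dist_norm norm_minus_commute)
    then obtain s where s: "s \<in> ?W" "v - d z + \<phi> (h z) = \<phi> s" using \<epsilon>(2) by blast
    note ks = W[OF s(1)]
    have "\<phi> (h (k s)) - \<phi> (h z) = d (k s) - d z" using N'(3) ks by blast
    then have "v = d (k s)" using s(2) ks by (simp add: algebra_simps)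
    then show "v \<in> d ` {y \<in> K \<inter> N. h y \<in> U}" using ks by auto
  qed
  then show ?thesis using that \<epsilon>(1) by blast
qed

section \<open>Regular analytic curves close to the rays of a disk\<close>

text \<open>
  This is the variance of \<open>k/n\<close> under a binomial law of mean \<open>t\<close>. It equals the second moment minus
  \<open>t\<^sup>2\<close>, so it is small by the approximation theorem for the function \<open>t\<^sup>2\<close>.
\<close>

lemma Bernstein_variance_small:
  assumes "e > 0"
  obtains n where "n > 0" "\<And>t. t \<in> {0..1} \<Longrightarrow> (\<Sum>k\<le>n. (t - k / n)\<^sup>2 * Bernstein n k t) < (e::real)"
proof -
  have "continuous_on {0..1} (\<lambda>x::real. x\<^sup>2)" by (intro continuous_intros)
  from Bernstein_Weierstrass[OF this assms] obtain N where
    N: "\<And>n x. N \<le> n \<Longrightarrow> x \<in> {0..1} \<Longrightarrow> \<bar>x\<^sup>2 - (\<Sum>k\<le>n. (k/n)\<^sup>2 * Bernstein n k x)\<bar> < e"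
    by blast
  let ?n = "Suc N"
  have "(\<Sum>k\<le>?n. (t - k / ?n)\<^sup>2 * Bernstein ?n k t) < e" if t: "t \<in> {0..1}" for t
  proof -
    have "(\<Sum>k\<le>?n. (t - k / ?n)\<^sup>2 * Bernstein ?n k t)
        = (\<Sum>k\<le>?n. t\<^sup>2 * Bernstein ?n k t - 2 * t / ?n * (k * Bernstein ?n k t) + (k/?n)\<^sup>2 * Bernstein ?n k t)"
      by (intro sum.cong refl) (simp add: power2_diff algebra_simps)
    also have "\<dots> = t\<^sup>2 * (\<Sum>k\<le>?n. Bernstein ?n k t) - 2 * t / ?n * (\<Sum>k\<le>?n. k * Bernstein ?n k t)
        + (\<Sum>k\<le>?n. (k/?n)\<^sup>2 * Bernstein ?n k t)"
      by (simp only: sum.distrib sum_subtractf sum_distrib_left)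
    also have "\<dots> = (\<Sum>k\<le>?n. (k/?n)\<^sup>2 * Bernstein ?n k t) - t\<^sup>2"
      unfolding sum_Bernstein sum_k_Bernstein by (simp add: power2_eq_square)
    also have "\<dots> < e" using N[of ?n t] t by (simp add: abs_less_iff)
    finally show ?thesis .
  qed
  then show ?thesis using that[of ?n] by blast
qed

text \<open>
  Bernstein's argument with a parameter: the terms with \<open>k/n\<close> far from \<open>t\<close> are controlled by the
  variance. Bernstein polynomials have the advantage of keeping both end values.
\<close>

lemma Bernstein_approximation_uniform:
  fixes G :: "real \<Rightarrow> 'k::metric_space \<Rightarrow> 'b::real_normed_vector"
  assumes K: "compact K" and G: "continuous_on ({0..1} \<times> K) (\<lambda>(t, z). G t z)" and e: "e > 0"
  obtains n where "n > 0"
    "\<And>t z. t \<in> {0..1} \<Longrightarrow> z \<in> K \<Longrightarrow> norm (G t z - (\<Sum>k\<le>n. Bernstein n k t *\<^sub>R G (k / n) z)) < e"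
proof -
  have cK: "compact ({0..1::real} \<times> K)" using K by (intro compact_Times) auto
  have "compact ((\<lambda>(t, z). G t z) ` ({0..1} \<times> K))" by (rule compact_continuous_image[OF G cK])
  then obtain M where M: "M > 0" "\<And>x. x \<in> (\<lambda>(t, z). G t z) ` ({0..1} \<times> K) \<Longrightarrow> norm x \<le> M"
    using compact_imp_bounded bounded_pos by metis
  have GM: "norm (G t z) \<le> M" if "t \<in> {0..1}" "z \<in> K" for t z
    using M(2)[of "G t z"] that by force
  have "uniformly_continuous_on ({0..1} \<times> K) (\<lambda>(t, z). G t z)"
    by (rule compact_uniformly_continuous[OF G cK])
  then obtain \<delta> where \<delta>: "\<delta> > 0" "\<And>p q. p \<in> {0..1} \<times> K \<Longrightarrow> q \<in> {0..1} \<times> K \<Longrightarrow> dist q p < \<delta> \<Longrightarrow>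
      dist ((\<lambda>(t, z). G t z) q) ((\<lambda>(t, z). G t z) p) < e / 2"
    using e unfolding uniformly_continuous_on_def by (metis half_gt_zero)
  have near: "norm (G t z - G s z) < e / 2" if "t \<in> {0..1}" "s \<in> {0..1}" "z \<in> K" "\<bar>t - s\<bar> < \<delta>" for t s z
    using \<delta>(2)[of "(s, z)" "(t, z)"] that by (simp add: dist_Pair_Pair dist_norm)
  define e' where "e' = e * \<delta>\<^sup>2 / (4 * M)"
  have e': "e' > 0" using e \<delta>(1) M(1) by (simp add: e'_def)
  obtain n where n: "n > 0" "\<And>t. t \<in> {0..1} \<Longrightarrow> (\<Sum>k\<le>n. (t - k / n)\<^sup>2 * Bernstein n k t) < e'"
    using Bernstein_variance_small[OF e'] by metis
  have "norm (G t z - (\<Sum>k\<le>n. Bernstein n k t *\<^sub>R G (k / n) z)) < e" if t: "t \<in> {0..1}" and z: "z \<in> K" for t z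
  proof -
    have b: "0 \<le> Bernstein n k t" for k using t by (simp add: Bernstein_nonneg)
    have kn: "real k / real n \<in> {0..1}" if "k \<le> n" for k using that n(1) by simp
    have each: "norm (G t z - G (k / n) z) \<le> e / 2 + 2 * M / \<delta>\<^sup>2 * (t - k / n)\<^sup>2" if "k \<le> n" for k
    proof (cases "\<bar>t - k / n\<bar> < \<delta>")
      case True
      then have "norm (G t z - G (k / n) z) \<le> e / 2" using near[OF t kn[OF that] z] by simp
      moreover have "0 \<le> 2 * M / \<delta>\<^sup>2 * (t - k / n)\<^sup>2" using M(1) by simp
      ultimately show ?thesis by linarith
    next
      case False
      then have "\<delta>\<^sup>2 \<le> (t - k / n)\<^sup>2" using \<delta>(1) power_mono[of \<delta> "\<bar>t - k / n\<bar>" 2] by simp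
      then have "2 * M * 1 \<le> 2 * M * ((t - k / n)\<^sup>2 / \<delta>\<^sup>2)" using M(1) \<delta>(1) by (intro mult_left_mono) auto
      moreover have "norm (G t z - G (k / n) z) \<le> M + M"
        using norm_triangle_ineq4[of "G t z" "G (k / n) z"] GM[OF t z] GM[OF kn[OF that] z] by linarith
      ultimately show ?thesis using e by simp
    qed
    have "G t z - (\<Sum>k\<le>n. Bernstein n k t *\<^sub>R G (k / n) z) = (\<Sum>k\<le>n. Bernstein n k t *\<^sub>R (G t z - G (k / n) z))"
      by (simp add: scaleR_diff_right sum_subtractf flip: scaleR_sum_left)
    also have "norm \<dots> \<le> (\<Sum>k\<le>n. Bernstein n k t * (e / 2 + 2 * M / \<delta>\<^sup>2 * (t - k / n)\<^sup>2))"
      by (rule sum_norm_le) (use each b in \<open>auto intro!: mult_left_mono\<close>)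
    also have "\<dots> = (\<Sum>k\<le>n. e / 2 * Bernstein n k t + 2 * M / \<delta>\<^sup>2 * ((t - k / n)\<^sup>2 * Bernstein n k t))"
      by (intro sum.cong refl) (simp add: distrib_left mult_ac)
    also have "\<dots> = e / 2 * (\<Sum>k\<le>n. Bernstein n k t) + 2 * M / \<delta>\<^sup>2 * (\<Sum>k\<le>n. (t - k / n)\<^sup>2 * Bernstein n k t)"
      by (simp only: sum.distrib sum_distrib_left)
    also have "\<dots> < e / 2 * 1 + 2 * M / \<delta>\<^sup>2 * e'"
      unfolding sum_Bernstein using n(2)[OF t] M(1) \<delta>(1) by (intro add_strict_left_mono mult_strict_left_mono) auto
    also have "\<dots> = e" using M(1) \<delta>(1) by (simp add: e'_def)
    finally show ?thesis .
  qed
  with n(1) show ?thesis using that by blast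
qed

text \<open>
  The curve \<open>F z\<close> is the sum of the Bernstein polynomial of \<open>t \<mapsto> d (z0 + t (z - z0))\<close> and of the
  loop \<open>\<eta> (exp (2 \<pi> i m t) - 1)\<close>. The loop vanishes at both ends and has size at most \<open>2 \<eta>\<close>, but
  its speed is the constant \<open>2 \<pi> \<eta> m\<close>, which exceeds the speed of all the Bernstein polynomials
  once \<open>m\<close> is large. So \<open>F z\<close> has no critical point on \<open>[0,1]\<close>, whatever the path that it approximates;
  and \<open>F z\<close> depends continuously on \<open>z\<close>.
\<close>

lemma regular_approximation:
  fixes d :: "'k::real_normed_vector \<Rightarrow> real^2"
  assumes K: "compact K" "convex K" "z0 \<in> K" and d: "continuous_on K d" "d z0 = 0" and \<delta>: "\<delta> > 0"
  obtains F :: "'k \<Rightarrow> complex \<Rightarrow> complex" where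
    "\<forall>z\<in>K. F z holomorphic_on UNIV \<and> F z 0 = 0 \<and> cvec (F z 1) = d z \<and>
       (\<forall>t\<in>{0..1::real}. deriv (F z) (of_real t) \<noteq> 0 \<and>
          norm (cvec (F z (of_real t)) - d (z0 + t *\<^sub>R (z - z0))) < \<delta>)"
    "continuous_on ({0..1} \<times> K) (\<lambda>(t, z). F z (of_real t))"
proof -
  define D where "D = (\<lambda>z. vcomplex (d z))"
  have cD: "cvec (D z) = d z" for z by (simp add: D_def)
  have D0: "D z0 = 0" using d(2) by (simp add: D_def vcomplex_def complex_eq_iff)
  have contD: "continuous_on K D"
    unfolding D_def by (intro continuous_intros d)
  define w where "w = (\<lambda>(t::real) z. z0 + t *\<^sub>R (z - z0))"
  have wK: "w t z \<in> K" if "t \<in> {0..1}" "z \<in> K" for t z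
  proof -
    have "w t z = (1 - t) *\<^sub>R z0 + t *\<^sub>R z" by (simp add: w_def algebra_simps)
    then show ?thesis using K(2)[unfolded convex_alt] K(3) that by simp
  qed
  have "continuous_on ({0..1} \<times> K) (\<lambda>p. D (w (fst p) (snd p)))"
    by (rule continuous_on_compose2[OF contD]) (auto simp: w_def intro!: continuous_intros wK[unfolded w_def])
  then have contG: "continuous_on ({0..1} \<times> K) (\<lambda>(t, z). D (w t z))" by (simp add: case_prod_unfold)
  obtain n where n: "n > 0" "\<And>t z. t \<in> {0..1} \<Longrightarrow> z \<in> K \<Longrightarrow>
      norm (D (w t z) - (\<Sum>k\<le>n. Bernstein n k t *\<^sub>R D (w (k / n) z))) < \<delta> / 2"
    using Bernstein_approximation_uniform[OF K(1) contG, of "\<delta> / 2"] \<delta> by auto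
  define b where "b = (\<lambda>k (x::complex). of_nat (n choose k) * x ^ k * (1 - x) ^ (n - k))"
  have b_real: "b k (of_real t) = of_real (Bernstein n k t)" for k t
    by (simp add: b_def Bernstein_def)
  have b_hol: "b k holomorphic_on S" for k S unfolding b_def by (intro holomorphic_intros)
  have b_deriv: "(b k has_field_derivative deriv (b k) x) (at x)" for k x
    using holomorphic_derivI[OF b_hol, of UNIV] by auto
  obtain Md where Md: "Md > 0" "\<And>z. z \<in> K \<Longrightarrow> norm (D z) \<le> Md"
    using compact_imp_bounded[OF compact_continuous_image[OF contD K(1)]] unfolding bounded_pos by auto
  have "\<exists>c. \<forall>t\<in>{0..1}. norm (deriv (b k) (of_real t)) \<le> c" for k
  proof -
    have "continuous_on UNIV (deriv (b k))"
      by (intro holomorphic_on_imp_continuous_on holomorphic_deriv b_hol) auto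
    then have "continuous_on {0..1::real} (\<lambda>t. deriv (b k) (of_real t))"
      by (rule continuous_on_compose2) (auto intro!: continuous_intros)
    then have "bounded ((\<lambda>t. deriv (b k) (of_real t)) ` {0..1::real})"
      by (intro compact_imp_bounded compact_continuous_image) auto
    then show ?thesis unfolding bounded_iff by auto
  qed
  then obtain c where c: "\<And>k t. t \<in> {0..1} \<Longrightarrow> norm (deriv (b k) (of_real t)) \<le> c k" by metis
  define M where "M = (\<Sum>k\<le>n. Md * c k)"
  define \<eta> where "\<eta> = \<delta> / 8"
  have \<eta>: "\<eta> > 0" using \<delta> by (simp add: \<eta>_def)
  obtain m :: nat where m: "real m > M / \<eta>" "m > 0"
    by (metis gr0I less_le_trans linear of_nat_0_less_iff reals_Archimedean2 not_less_iff_gr_or_eq order_less_trans zero_less_one of_nat_1 zero_less_iff_neq_zero)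
  define a where "a = 2 * of_real pi * of_nat m * \<i>"
  define F where "F = (\<lambda>z x. (\<Sum>k\<le>n. D (w (k / n) z) * b k x) + of_real \<eta> * (exp (a * x) - 1))"
  have F_real: "F z (of_real t) = (\<Sum>k\<le>n. Bernstein n k t *\<^sub>R D (w (k / n) z)) + of_real \<eta> * (exp (a * of_real t) - 1)" for z t
    by (simp add: F_def b_real scaleR_conv_of_real mult.commute)
  have norm_exp: "norm (exp (a * of_real t)) = 1" for t :: real
    by (simp add: a_def norm_exp_eq_Re)
  show ?thesis
  proof (rule that[of F], intro ballI conjI)
    fix z assume z: "z \<in> K"
    show "F z holomorphic_on UNIV"
      unfolding F_def by (intro holomorphic_intros b_hol)
    show "F z 0 = 0"
    proof -
      have "(\<Sum>k\<le>n. D (w (k / n) z) * b k 0) = (\<Sum>k\<le>n. if k = 0 then D (w (k / n) z) else 0)"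
        by (intro sum.cong) (auto simp: b_def)
      then show ?thesis using D0 by (simp add: F_def w_def)
    qed
    show "cvec (F z 1) = d z"
    proof -
      have "(\<Sum>k\<le>n. D (w (k / n) z) * b k 1) = (\<Sum>k\<le>n. if k = n then D (w (k / n) z) else 0)"
        by (intro sum.cong) (auto simp: b_def)
      moreover have "exp a = 1" unfolding a_def exp_eq_1 by (auto intro: exI[of _ "int m"])
      ultimately show ?thesis using n(1) by (simp add: F_def w_def cD)
    qed
    fix t :: real assume t: "t \<in> {0..1}"
    show "deriv (F z) (of_real t) \<noteq> 0"
    proof
      let ?x = "of_real t :: complex"
      have "(F z has_field_derivative (\<Sum>k\<le>n. D (w (k / n) z) * deriv (b k) ?x) + of_real \<eta> * (exp (a * ?x) * a)) (at ?x)"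
        unfolding F_def
        by (intro DERIV_add DERIV_sum DERIV_cmult b_deriv) (auto intro!: derivative_eq_intros)
      moreover assume "deriv (F z) ?x = 0"
      ultimately have "(\<Sum>k\<le>n. D (w (k / n) z) * deriv (b k) ?x) + of_real \<eta> * (exp (a * ?x) * a) = 0"
        by (metis DERIV_imp_deriv)
      then have "norm (of_real \<eta> * (exp (a * ?x) * a)) = norm (\<Sum>k\<le>n. D (w (k / n) z) * deriv (b k) ?x)"
        by (metis add_eq_0_iff norm_minus_cancel)
      also have "\<dots> \<le> M"
        unfolding M_def
      proof (rule sum_norm_le)
        fix k assume "k \<in> {..n}"
        then have "w (k / n) z \<in> K" using n(1) z by (intro wK) auto
        then show "norm (D (w (k / n) z) * deriv (b k) ?x) \<le> Md * c k"
          unfolding norm_mult using Md c[OF t] by (intro mult_mono) auto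
      qed
      finally have "\<eta> * (2 * pi * real m) \<le> M"
        using \<eta> norm_exp[of t] by (simp add: norm_mult a_def)
      moreover have "M < \<eta> * real m" using m(1) \<eta> by (simp add: field_simps)
      moreover have "\<eta> * real m * 1 \<le> \<eta> * real m * (2 * pi)" using \<eta> pi_ge_two by (intro mult_left_mono) auto
      ultimately show False by (simp add: mult_ac)
    qed
    have "norm (F z (of_real t) - D (w t z)) < \<delta>"
    proof -
      have "F z (of_real t) - D (w t z) =
          of_real \<eta> * (exp (a * of_real t) - 1) - (D (w t z) - (\<Sum>k\<le>n. Bernstein n k t *\<^sub>R D (w (k / n) z)))"
        unfolding F_real by simp
      also have "norm \<dots> \<le> norm (of_real \<eta> * (exp (a * of_real t) - 1)) +
          norm (D (w t z) - (\<Sum>k\<le>n. Bernstein n k t *\<^sub>R D (w (k / n) z)))"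
        by (rule norm_triangle_ineq4)
      finally have "norm (F z (of_real t) - D (w t z)) \<le> norm (of_real \<eta> * (exp (a * of_real t) - 1)) +
          norm (D (w t z) - (\<Sum>k\<le>n. Bernstein n k t *\<^sub>R D (w (k / n) z)))" .
      moreover have "norm (exp (a * of_real t) - 1) \<le> 2"
        using norm_triangle_ineq4[of "exp (a * of_real t)" 1] unfolding norm_exp by simp
      then have "norm (of_real \<eta> * (exp (a * of_real t) - 1)) \<le> \<eta> * 2"
        using \<eta> by (simp add: norm_mult)
      ultimately show ?thesis using n(2)[OF t z] \<delta> \<eta> unfolding \<eta>_def by linarith
    qed
    then have "norm (cvec (F z (of_real t) - D (w t z))) < \<delta>" by simp
    then show "norm (cvec (F z (of_real t)) - d (z0 + t *\<^sub>R (z - z0))) < \<delta>"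
      by (simp add: linear_diff[OF linear_cvec] cD w_def)
  next
    have cb: "continuous_on S (\<lambda>p. Bernstein n k (fst p))" for k and S :: "(real \<times> 'k) set"
      unfolding Bernstein_def by (intro continuous_intros)
    have "continuous_on ({0..1} \<times> K) (\<lambda>p. (\<Sum>k\<le>n. Bernstein n k (fst p) *\<^sub>R D (w (k / n) (snd p))) + of_real \<eta> * (exp (a * of_real (fst p)) - 1))"
    proof (intro continuous_intros cb)
      fix k assume "k \<in> {..n}"
      then have "w (k / n) (snd p) \<in> K" if "p \<in> {0..1} \<times> K" for p :: "real \<times> 'k"
        using n(1) that by (intro wK) auto
      then have im: "(\<lambda>p. w (k / n) (snd p)) ` ({0..1::real} \<times> K) \<subseteq> K" by blast
      have "continuous_on ({0..1::real} \<times> K) (\<lambda>p. w (k / n) (snd p))"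
        unfolding w_def by (intro continuous_intros)
      from continuous_on_compose2[OF contD this im]
      show "continuous_on ({0..1::real} \<times> K) (\<lambda>p. D (w (k / n) (snd p)))" .
    qed
    then show "continuous_on ({0..1} \<times> K) (\<lambda>(t, z). F z (of_real t))"
      by (simp add: F_real case_prod_unfold)
  qed
qed

section \<open>Tubes around regular curves\<close>

text \<open>
  Rectangles with \<open>[0,1]\<close> on their axis are convex, and a thin one avoids the critical points of \<open>F\<close>.
\<close>

lemma tube_domain:
  assumes F: "F holomorphic_on UNIV" "\<And>t::real. t \<in> {0..1} \<Longrightarrow> deriv F (of_real t) \<noteq> 0"
    and Q: "open Q" "of_real ` {0..1::real} \<subseteq> Q"
  obtains \<Omega> B where "disk_model \<Omega> B (\<lambda>w. cvec (F w))" "B \<subseteq> Q" "of_real ` {0..1::real} \<subseteq> interior B"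
proof -
  define Q' where "Q' = Q \<inter> {w. deriv F w \<noteq> 0}"
  have "continuous_on UNIV (deriv F)"
    by (intro holomorphic_on_imp_continuous_on holomorphic_deriv F) auto
  then have "open {w. deriv F w \<noteq> 0}" by (intro open_Collect_neq) auto
  then have oQ': "open Q'" using Q(1) by (auto simp: Q'_def)
  have "compact (of_real ` {0..1::real} :: complex set)"
    by (intro compact_continuous_image) (auto intro!: continuous_intros)
  moreover have "of_real ` {0..1::real} \<subseteq> Q'" using Q(2) F(2) by (auto simp: Q'_def)
  ultimately obtain e where e: "e > 0" "(\<Union>x\<in>of_real ` {0..1::real}. ball x e) \<subseteq> Q'"
    using compact_subset_open_imp_ball_epsilon_subset oQ' by metis
  define \<eta> where "\<eta> = e / 4"
  have \<eta>: "\<eta> > 0" using e(1) by (simp add: \<eta>_def)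
  define \<Omega> where "\<Omega> = box (Complex (-2*\<eta>) (-2*\<eta>)) (Complex (1+2*\<eta>) (2*\<eta>))"
  define B where "B = cbox (Complex (-\<eta>) (-\<eta>)) (Complex (1+\<eta>) \<eta>)"
  have intB: "interior B = box (Complex (-\<eta>) (-\<eta>)) (Complex (1+\<eta>) \<eta>)"
    unfolding B_def by (rule interior_cbox)
  have seg: "of_real ` {0..1::real} \<subseteq> interior B"
    unfolding intB using \<eta> by (auto simp: in_box_complex_iff)
  have B\<Omega>: "B \<subseteq> \<Omega>"
    unfolding B_def \<Omega>_def using \<eta> by (auto simp: in_box_complex_iff in_cbox_complex_iff)
  have \<Omega>Q: "\<Omega> \<subseteq> Q'"
  proof
    fix w assume "w \<in> \<Omega>"
    then have w: "-2*\<eta> < Re w" "Re w < 1 + 2*\<eta>" "-2*\<eta> < Im w" "Im w < 2*\<eta>"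
      by (auto simp: \<Omega>_def in_box_complex_iff)
    define t where "t = max 0 (min 1 (Re w))"
    have "cmod (of_real t - w) \<le> \<bar>t - Re w\<bar> + \<bar>Im w\<bar>" using cmod_le[of "of_real t - w"] by simp
    also have "\<dots> < e" using w \<eta> unfolding \<eta>_def t_def by (auto simp: max_def min_def)
    finally have "w \<in> ball (of_real t) e" by (simp add: dist_norm)
    moreover have "t \<in> {0..1}" by (simp add: t_def)
    ultimately show "w \<in> Q'" using e(2) by blast
  qed
  have "disk_model \<Omega> B (\<lambda>w. cvec (F w))"
    unfolding disk_model_def
  proof (intro conjI ballI)
    show "open \<Omega>" "convex \<Omega>" by (auto simp: \<Omega>_def open_box convex_box)
    show "compact B" "convex B" by (auto simp: B_def compact_cbox convex_box)
    show "B \<subseteq> \<Omega>" by (rule B\<Omega>)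
    show "0 \<in> interior B" using seg by (force simp: image_subset_iff)
    show "continuous_on \<Omega> (\<lambda>w. cvec (F w))"
      by (intro continuous_on_cvec holomorphic_on_imp_continuous_on holomorphic_on_subset[OF F(1)]) auto
    fix w assume w: "w \<in> \<Omega>"
    then have "deriv F w \<noteq> 0" using \<Omega>Q by (auto simp: Q'_def)
    then obtain r where r: "r > 0" "ball w r \<subseteq> \<Omega>" "inj_on F (ball w r)"
      using has_complex_derivative_locally_injective[OF holomorphic_on_subset[OF F(1)] w] \<open>open \<Omega>\<close>
      by (metis subset_UNIV)
    have "inj_on (\<lambda>w. cvec (F w)) (ball w r)"
      using r(3) injD[OF inj_cvec] by (auto simp: inj_on_def)
    then show "\<exists>N. open N \<and> w \<in> N \<and> N \<subseteq> \<Omega> \<and> inj_on (\<lambda>w. cvec (F w)) N"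
      using r by (intro exI[of _ "ball w r"]) auto
  qed
  moreover have "B \<subseteq> Q" using B\<Omega> \<Omega>Q by (auto simp: Q'_def)
  ultimately show ?thesis using that seg by blast
qed

text \<open>
  All paths close to \<open>f\<close> on \<open>[0,1]\<close> lift to the tube. This is \<open>thickening\<close> applied inside the tube, seen
  as a surface, to the segment \<open>[0,1]\<close> itself.
\<close>

lemma tube_sections:
  assumes P0: "(P0 :: 'a pointed_structure) \<in> structures" and M: "disk_model \<Omega> B f"
    and seg: "of_real ` {0..1::real} \<subseteq> interior B"
  obtains \<epsilon> and g :: "real \<Rightarrow> real^2 \<Rightarrow> complex" where "\<epsilon> > 0" "continuous_on ({0..1} \<times> ball 0 \<epsilon>) (\<lambda>(t, v). g t v)"
    "\<forall>t\<in>{0..1}. \<forall>v. norm v < \<epsilon> \<longrightarrow> g t v \<in> interior B \<and> f (g t v) = f (of_real t) + v"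
    "\<forall>t\<in>{0..1}. g t 0 = of_real t"
proof -
  obtain T :: "'a pointed_structure" and \<kappa> \<kappa>' where T: "T \<in> structures"
    "homeomorphic_maps (top_of_set \<Omega>) (surf T) \<kappa> \<kappa>'" "\<kappa> 0 = bpt T" "develops T \<Omega> \<kappa> f"
    using model_structure[OF P0 M] by metis
  have B: "B \<subseteq> \<Omega>" "open \<Omega>" using M by (auto simp: disk_model_def)
  have iB: "interior B \<subseteq> \<Omega>" using B interior_subset by blast
  have hm: "homeomorphic_map (top_of_set \<Omega>) (surf T) \<kappa>" using T(2) homeomorphic_map_maps by blast
  have k1: "\<And>w. w \<in> \<Omega> \<Longrightarrow> \<kappa>' (\<kappa> w) = w" and k2: "\<And>x. x \<in> topspace (surf T) \<Longrightarrow> \<kappa> (\<kappa>' x) = x"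
    and ck': "continuous_map (surf T) (top_of_set \<Omega>) \<kappa>'"
    using T(2) by (auto simp: homeomorphic_maps_def)
  have "openin (top_of_set \<Omega>) (interior B)" using iB by (simp add: open_subset)
  then have oG: "openin (surf T) (\<kappa> ` interior B)"
    using homeomorphic_map_openness[OF hm, of "interior B"] iB by simp
  have d1: "develops T {0..1::real} (\<lambda>t. \<kappa> (of_real t)) (\<lambda>t. f (of_real t))"
    by (rule develops_compose[OF T(4)]) (use seg iB in \<open>auto intro!: continuous_intros\<close>)
  have "(\<lambda>t. \<kappa> (of_real t)) ` {0..1::real} \<subseteq> \<kappa> ` interior B" using seg by auto
  then obtain \<epsilon> E where \<epsilon>: "\<epsilon> > 0" "develops T ({0..1} \<times> ball 0 \<epsilon>) (\<lambda>(t, v). E t v) (\<lambda>(t, v). f (of_real t) + v)"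
    "\<And>t. t \<in> {0..1} \<Longrightarrow> E t 0 = \<kappa> (of_real t)" "\<And>t v. t \<in> {0..1} \<Longrightarrow> norm v < \<epsilon> \<Longrightarrow> E t v \<in> \<kappa> ` interior B"
    using thickening[OF T(1) compact_Icc d1 oG] by metis
  define g where "g = (\<lambda>t v. \<kappa>' (E t v))"
  have gB: "g t v \<in> interior B" "\<kappa> (g t v) = E t v" if tv: "t \<in> {0..1}" "norm v < \<epsilon>" for t v
  proof -
    obtain w where w: "w \<in> interior B" "E t v = \<kappa> w" using \<epsilon>(4)[OF tv] by blast
    then have "g t v = w" using k1 iB by (auto simp: g_def)
    then show "g t v \<in> interior B" "\<kappa> (g t v) = E t v" using w by auto
  qed
  have cg: "continuous_on ({0..1} \<times> ball 0 \<epsilon>) (\<lambda>(t, v). g t v)"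
    using continuous_map_compose[OF develops_continuous_map[OF \<epsilon>(2)] ck']
    by (simp add: g_def o_def case_prod_unfold continuous_map_in_subtopology)
  have g0: "g t 0 = of_real t" if "t \<in> {0..1}" for t
  proof -
    have "of_real t \<in> \<Omega>" using seg iB that by blast
    then show ?thesis using \<epsilon>(3)[OF that] k1 by (simp add: g_def)
  qed
  have d2: "develops T ({0..1} \<times> ball 0 \<epsilon>) (\<lambda>p. \<kappa> ((\<lambda>(t, v). g t v) p)) (\<lambda>p. f ((\<lambda>(t, v). g t v) p))"
    by (rule develops_compose[OF T(4) cg]) (use gB(1) iB in auto)
  have d3: "develops T ({0..1} \<times> ball 0 \<epsilon>) (\<lambda>(t, v). E t v) (\<lambda>p. f ((\<lambda>(t, v). g t v) p))"
    by (rule develops_cong[OF d2, where v = 0]) (use gB(2) in auto)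
  have conn: "connected ({0..1::real} \<times> ball (0::real^2) \<epsilon>)" by (intro connected_Times) auto
  have "f (g t v) = f (of_real t) + v" if tv: "t \<in> {0..1}" "norm v < \<epsilon>" for t v
    using developed_map_unique[OF T(1) conn d3 \<epsilon>(2), of "(0, 0)" "(t, v)"] tv \<epsilon>(1) g0[of 0] by simp
  then show ?thesis using that[OF \<epsilon>(1) cg] gB(1) g0 by blast
qed

text \<open>
  A point \<open>w\<close> of the tube is sent into the sheet over the point of the segment nearest to \<open>w\<close> in real
  part. The parameter \<open>Re w\<close> is clamped to \<open>[0,1]\<close> since the tube sticks out beyond both ends.
\<close>

lemma tube_lift:
  fixes K :: "'k::real_normed_vector set"
  assumes K: "convex K" "z0 \<in> K" "z \<in> K" and d: "continuous_on K d" "d z0 = 0"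
    and E: "develops S (K \<times> ball 0 \<delta>) (\<lambda>(x, v). E x v) (\<lambda>(x, v). d x + v)" "E z0 0 = bpt S"
    and f: "continuous_on B f" "f 0 = 0"
      "\<And>w. w \<in> B \<Longrightarrow> norm (f w - d (z0 + max 0 (min 1 (Re w)) *\<^sub>R (z - z0))) < \<delta>"
  shows "lifts S B f 0 (\<lambda>w. E (z0 + max 0 (min 1 (Re w)) *\<^sub>R (z - z0)) (f w - d (z0 + max 0 (min 1 (Re w)) *\<^sub>R (z - z0))))"
proof -
  let ?s = "\<lambda>w. z0 + max 0 (min 1 (Re w)) *\<^sub>R (z - z0)"
  have sK: "?s w \<in> K" for w
  proof -
    let ?t = "max 0 (min 1 (Re w))"
    have "?s w = (1 - ?t) *\<^sub>R z0 + ?t *\<^sub>R z" by (simp add: algebra_simps)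
    moreover have "0 \<le> ?t" "?t \<le> 1" by auto
    ultimately show ?thesis using K(1)[unfolded convex_alt] K(2,3) by presburger
  qed
  have cs: "continuous_on B ?s" by (intro continuous_intros)
  have cds: "continuous_on B (\<lambda>w. d (?s w))"
    by (rule continuous_on_compose2[OF d(1) cs]) (use sK in blast)
  let ?h = "\<lambda>w. (?s w, f w - d (?s w))"
  have "develops S B (\<lambda>w. (\<lambda>(x, v). E x v) (?h w)) (\<lambda>w. (\<lambda>(x, v). d x + v) (?h w))"
  proof (rule develops_compose[OF E(1)])
    show "continuous_on B ?h" by (intro continuous_on_Pair continuous_on_diff cs cds f)
    show "?h ` B \<subseteq> K \<times> ball 0 \<delta>" using sK f(3) by auto
  qed
  then have "develops S B (\<lambda>w. E (?s w) (f w - d (?s w))) f" by simp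
  moreover have "E (?s 0) (f 0 - d (?s 0)) = bpt S" using E(2) f(2) d(2) by simp
  ultimately show ?thesis by (simp add: lifts_def)
qed

section \<open>Matrices near the identity\<close>

lemma norm_matrix_minus_id_le:
  fixes A :: "real^2^2"
  shows "norm (A *v x - x) \<le> 4 * dist A (mat 1) * norm x"
proof -
  have "\<bar>(A - mat 1) $ i $ j\<bar> \<le> dist A (mat 1)" for i j
    using component_le_norm_cart[of "(A - mat 1) $ i" j] Finite_Cartesian_Product.norm_nth_le[of "A - mat 1" i] by (simp add: dist_norm)
  then have "onorm ((*v) (A - mat 1)) \<le> 4 * dist A (mat 1)"
    using onorm_le_matrix_component[of "A - mat 1" "dist A (mat 1)"] by simp
  then have "onorm ((*v) (A - mat 1)) * norm x \<le> 4 * dist A (mat 1) * norm x" by (rule mult_right_mono) simp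
  moreover have "norm ((A - mat 1) *v x) \<le> onorm ((*v) (A - mat 1)) * norm x"
    by (rule onorm) (rule matrix_vector_mul_bounded_linear)
  ultimately show ?thesis by (simp add: matrix_vector_mult_diff_rdistrib)
qed

lemma eventually_matrix_near_id:
  assumes "e > 0"
  shows "\<forall>\<^sub>F A in nhds (mat 1 :: real^2^2). \<forall>x. norm x \<le> M \<longrightarrow> norm (A *v x - x) < e"
proof -
  let ?r = "e / (4 * (\<bar>M\<bar> + 1))"
  have "\<forall>\<^sub>F A in nhds (mat 1 :: real^2^2). A \<in> ball (mat 1) ?r"
    using assms by (intro eventually_nhds_in_open) auto
  then show ?thesis
  proof eventually_elim
    case (elim A)
    show ?case
    proof (intro allI impI)
      fix x :: "real^2" assume x: "norm x \<le> M"
      have "norm (A *v x - x) \<le> 4 * dist A (mat 1) * norm x" by (rule norm_matrix_minus_id_le)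
      also have "\<dots> \<le> 4 * dist A (mat 1) * (\<bar>M\<bar> + 1)" using x by (intro mult_left_mono) auto
      also have "\<dots> < 4 * ?r * (\<bar>M\<bar> + 1)" using elim by (intro mult_strict_right_mono) (auto simp: dist_commute)
      also have "\<dots> = e" by (simp add: field_simps)
      finally show "norm (A *v x - x) < e" .
    qed
  qed
qed

lemma matrix_inv_works:
  fixes A :: "real^2^2"
  assumes "invertible A"
  shows "A ** matrix_inv A = mat 1" "matrix_inv A ** A = mat 1" "A *v (matrix_inv A *v x) = x" "matrix_inv A *v (A *v x) = x"
  "invertible (matrix_inv A)"
proof -
  show 1: "A ** matrix_inv A = mat 1" "matrix_inv A ** A = mat 1"
    using someI_ex[OF assms[unfolded invertible_def]] unfolding matrix_inv_def by auto
  then show "A *v (matrix_inv A *v x) = x" "matrix_inv A *v (A *v x) = x" "invertible (matrix_inv A)"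
    by (auto simp: matrix_vector_mul_assoc invertible_def)
qed

text \<open>
  For \<open>y = A\<^sup>-\<^sup>1 x\<close>, the vector \<open>x - y\<close> equals \<open>A y - y\<close>, which is small compared with \<open>y\<close>.
\<close>

lemma dist_matrix_inv_id_le:
  fixes A :: "real^2^2"
  assumes A: "invertible A" "dist A (mat 1) < 1 / 8"
  shows "dist (matrix_inv A) (mat 1) \<le> 32 * dist A (mat 1)"
proof -
  let ?B = "matrix_inv A"
  have *: "norm (?B *v x - x) \<le> 8 * dist A (mat 1) * norm x" for x
  proof -
    let ?y = "?B *v x"
    have 1: "norm (x - ?y) \<le> 4 * dist A (mat 1) * norm ?y"
      using norm_matrix_minus_id_le[of A ?y] matrix_inv_works(3)[OF A(1)] by simp
    also have "\<dots> \<le> 4 * (1 / 8) * norm ?y" using A(2) by (intro mult_right_mono mult_left_mono) auto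
    finally have "norm ?y \<le> 2 * norm x" using norm_triangle_ineq4[of x "x - ?y"] by simp
    then have "4 * dist A (mat 1) * norm ?y \<le> 4 * dist A (mat 1) * (2 * norm x)" by (intro mult_left_mono) auto
    also have "\<dots> = 8 * dist A (mat 1) * norm x" by simp
    finally show ?thesis using order_trans[OF 1] by (simp only: norm_minus_commute[of ?y])
  qed
  have c: "\<bar>(?B - mat 1) $ i $ j\<bar> \<le> 8 * dist A (mat 1)" for i j
  proof -
    have "(?B - mat 1) $ i $ j = ((?B - mat 1) *v axis j 1) $ i"
      by (simp add: matrix_vector_mult_basis column_def)
    also have "\<bar>\<dots>\<bar> \<le> norm ((?B - mat 1) *v axis j 1)" by (rule component_le_norm_cart)
    also have "\<dots> \<le> 8 * dist A (mat 1)" using *[of "axis j 1"] by (simp add: matrix_vector_mult_diff_rdistrib)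
    finally show ?thesis .
  qed
  have "norm (?B - mat 1) \<le> (\<Sum>i\<in>UNIV. norm ((?B - mat 1) $ i))"
    unfolding norm_vec_def by (rule L2_set_le_sum) simp
  also have "\<dots> \<le> (\<Sum>i\<in>(UNIV :: 2 set). 16 * dist A (mat 1))"
  proof (rule sum_mono)
    fix i :: 2
    have "norm ((?B - mat 1) $ i) \<le> (\<Sum>j\<in>UNIV. \<bar>(?B - mat 1) $ i $ j\<bar>)" by (rule norm_le_l1_cart)
    also have "\<dots> \<le> (\<Sum>j\<in>(UNIV :: 2 set). 8 * dist A (mat 1))" by (rule sum_mono) (rule c)
    finally show "norm ((?B - mat 1) $ i) \<le> 16 * dist A (mat 1)" by simp
  qed
  finally show ?thesis by (simp add: dist_norm)
qed

lemma eventually_matrix_inv: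
  fixes \<Phi> :: "real^2^2 \<Rightarrow> bool"
  assumes "\<forall>\<^sub>F A in nhds (mat 1). \<Phi> A"
  shows "\<forall>\<^sub>F A in nhds (mat 1). invertible A \<longrightarrow> \<Phi> (matrix_inv A)"
proof -
  obtain r where r: "r > 0" "\<And>B. dist B (mat 1) < r \<Longrightarrow> \<Phi> B"
    using assms unfolding eventually_nhds_metric by blast
  have "\<forall>\<^sub>F A in nhds (mat 1 :: real^2^2). A \<in> ball (mat 1) (min (1 / 8) (r / 32))"
    using r(1) by (intro eventually_nhds_in_open) auto
  then show ?thesis
  proof eventually_elim
    case (elim A)
    then show ?case using dist_matrix_inv_id_le[of A] r(2)[of "matrix_inv A"] by (auto simp: dist_commute)
  qed
qed

section \<open>Lifting nearby developed maps through tubes\<close>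

lemma continuous_on_matrix_vector [continuous_intros]:
  fixes A :: "real^2^2"
  shows "continuous_on S g \<Longrightarrow> continuous_on S (\<lambda>x. A *v g x)"
  using continuous_on_compose2[OF matrix_vector_mult_linear_continuous_on[of UNIV A]] by blast

text \<open>
  For each parameter \<open>z\<close>, \<open>B z\<close> is a tube with developed map \<open>f z\<close>, and \<open>g z\<close> is a local
  inverse of \<open>f z\<close> near the far end of the tube; \<open>B'\<close> is a disk around the basepoint. The last clause says
  that whenever these tubes lift to \<open>S\<close> for \<open>z\<close> in a finite set \<open>Z\<close> such that the balls of radius
  \<open>\<rho> z\<close> cover \<open>K\<close>, then \<open>A d\<close> lifts to \<open>S\<close> too, for all \<open>A\<close> in a neighbourhood of the identity that
  does not depend on \<open>S\<close>; and it says where the lift sends each point. The set \<open>G\<close> keeps track of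
  the part of \<open>S0\<close> that contains the tubes.
\<close>

definition tube_cover ::
    "'a pointed_structure \<Rightarrow> 'a set \<Rightarrow> 'k::metric_space set \<Rightarrow> ('k \<Rightarrow> real^2) \<Rightarrow> 'k \<Rightarrow>
     ('k \<Rightarrow> complex set) \<Rightarrow> ('k \<Rightarrow> complex \<Rightarrow> real^2) \<Rightarrow> ('k \<Rightarrow> real) \<Rightarrow> ('k \<Rightarrow> real) \<Rightarrow>
     ('k \<Rightarrow> real^2 \<Rightarrow> complex) \<Rightarrow> complex set \<Rightarrow> (complex \<Rightarrow> real^2) \<Rightarrow> bool" where
  "tube_cover S0 G K d z0 B f \<epsilon> \<rho> g B' f' \<longleftrightarrow>
     (\<forall>z\<in>K. (\<exists>\<Omega>. disk_model \<Omega> (B z) (f z)) \<and> (\<exists>\<beta>. lifts S0 (B z) (f z) 0 \<beta> \<and> \<beta> ` B z \<subseteq> G)) \<and>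
     (\<exists>\<Omega>. disk_model \<Omega> B' f') \<and> (\<exists>\<beta>. lifts S0 B' f' 0 \<beta> \<and> \<beta> ` B' \<subseteq> G) \<and>
     (\<forall>z\<in>K. 0 < \<epsilon> z \<and> 0 < \<rho> z \<and> continuous_on (ball (d z) (\<epsilon> z)) (g z) \<and>
       (\<forall>x\<in>ball (d z) (\<epsilon> z). g z x \<in> interior (B z) \<and> f z (g z x) = x)) \<and>
     (\<forall>Z. finite Z \<longrightarrow> Z \<subseteq> K \<longrightarrow> K \<subseteq> (\<Union>z\<in>Z. ball z (\<rho> z)) \<longrightarrow>
       (\<forall>\<^sub>F A in nhds (mat 1). (\<forall>z\<in>Z. \<forall>z'\<in>K \<inter> ball z (\<rho> z). A *v d z' \<in> ball (d z) (\<epsilon> z)) \<and>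
         (\<forall>S\<in>structures. \<forall>\<beta> \<beta>'. (\<forall>z\<in>Z. lifts (S :: 'a pointed_structure) (B z) (f z) 0 (\<beta> z)) \<longrightarrow> lifts S B' f' 0 \<beta>' \<longrightarrow>
           (\<exists>\<gamma>. lifts S K (\<lambda>z. A *v d z) z0 \<gamma> \<and> (\<forall>z\<in>Z. \<forall>z'\<in>K \<inter> ball z (\<rho> z). \<gamma> z' = \<beta> z (g z (A *v d z')))))))"

text \<open>
  The lift of \<open>A d\<close> at \<open>z'\<close> is the end point of the lift of the path \<open>A C(_, z')\<close>, where
  \<open>C(t, z') = F z' t\<close>. For \<open>z'\<close> near \<open>z\<close> this path is close to \<open>C(_, z)\<close> and so lifts to the tube of \<open>z\<close>
  by \<open>tube_sections\<close>. Two tubes that both contain the path give the same end point, because paths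
  lift uniquely to \<open>S\<close>.
\<close>

lemma tube_cover_exists:
  fixes K :: "'k::real_normed_vector set" and S0 :: "'a pointed_structure"
  assumes S0: "S0 \<in> structures" and K: "compact K" "convex K" "z0 \<in> K"
    and \<gamma>0: "lifts S0 K d z0 \<gamma>0" and d0: "d z0 = 0" and G: "openin (surf S0) G" "\<gamma>0 ` K \<subseteq> G"
  obtains B f \<epsilon> \<rho> g B' f' where "tube_cover S0 G K d z0 B f \<epsilon> \<rho> g B' f'"
proof -
  have dev0: "develops S0 K \<gamma>0 d" "\<gamma>0 z0 = bpt S0" using \<gamma>0 by (auto simp: lifts_def)
  obtain \<delta> E where \<delta>: "\<delta> > 0" and E: "develops S0 (K \<times> ball 0 \<delta>) (\<lambda>(x, v). E x v) (\<lambda>(x, v). d x + v)"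
    "\<And>x. x \<in> K \<Longrightarrow> E x 0 = \<gamma>0 x" "\<And>x v. x \<in> K \<Longrightarrow> norm v < \<delta> \<Longrightarrow> E x v \<in> G"
    using thickening[OF S0 K(1) dev0(1) G] by metis
  have cd: "continuous_on K d" by (rule developed_map_continuous[OF S0 dev0(1)])
  have Ez0: "E z0 0 = bpt S0" using E(2)[OF K(3)] dev0(2) by simp
  have \<delta>4: "\<delta> / 4 > 0" using \<delta> by simp
  obtain F :: "'k \<Rightarrow> complex \<Rightarrow> complex" where F':
    "\<forall>z\<in>K. F z holomorphic_on UNIV \<and> F z 0 = 0 \<and> cvec (F z 1) = d z \<and>
       (\<forall>t\<in>{0..1::real}. deriv (F z) (of_real t) \<noteq> 0 \<and>
          norm (cvec (F z (of_real t)) - d (z0 + t *\<^sub>R (z - z0))) < \<delta> / 4)"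
    "continuous_on ({0..1} \<times> K) (\<lambda>(t, z). F z (of_real t))"
    by (rule regular_approximation[OF K cd d0 \<delta>4])
  then have F: "\<And>z. z \<in> K \<Longrightarrow> F z holomorphic_on UNIV"
    "\<And>z t. z \<in> K \<Longrightarrow> t \<in> {0..1} \<Longrightarrow> deriv (F z) (of_real t) \<noteq> 0"
    "\<And>z. z \<in> K \<Longrightarrow> F z 0 = 0" "\<And>z. z \<in> K \<Longrightarrow> cvec (F z 1) = d z"
    "continuous_on ({0..1} \<times> K) (\<lambda>(t, z). F z (of_real t))"
    "\<And>z t. z \<in> K \<Longrightarrow> t \<in> {0..1} \<Longrightarrow> norm (cvec (F z (of_real t)) - d (z0 + t *\<^sub>R (z - z0))) < \<delta> / 4"
    by simp_all
  define C where "C = (\<lambda>(t::real) z. cvec (F z (of_real t)))"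
  have C0: "C 0 z = 0" and C1: "C 1 z = d z" if "z \<in> K" for z
    using F(3,4)[OF that] linear_0[OF linear_cvec] by (auto simp: C_def)
  have cC2: "continuous_on ({0..1} \<times> K) (\<lambda>(t, z). C t z)"
    using continuous_on_cvec[OF F(5)] by (simp add: C_def case_prod_unfold)
  have cC: "continuous_on {0..1} (\<lambda>t. C t z)" if "z \<in> K" for z
  proof -
    have "(\<lambda>t. (t, z)) ` {0..1::real} \<subseteq> {0..1} \<times> K" using that by auto
    moreover have "continuous_on {0..1::real} (\<lambda>t. (t, z))" by (intro continuous_intros)
    ultimately have "continuous_on {0..1} (\<lambda>t. (\<lambda>(t, z). C t z) (t, z))"
      by (intro continuous_on_compose2[OF cC2])
    then show ?thesis by simp
  qed
  have C_near: "norm (C t z0) < \<delta> / 4" if "t \<in> {0..1}" for t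
    using F(6)[OF K(3) that] d0 by (simp add: C_def)

  \<comment> \<open>On a thin enough tube, \<open>F z\<close> stays \<open>\<delta>\<close>-close to the developed segment, so the tube lifts to \<open>S0\<close>
      through the thickening \<open>E\<close> of \<open>\<gamma>0\<close>.\<close>
  have "\<forall>z\<in>K. \<exists>\<Omega> B. disk_model \<Omega> B (\<lambda>w. cvec (F z w)) \<and> of_real ` {0..1::real} \<subseteq> interior B \<and>
      (\<exists>\<beta>. lifts S0 B (\<lambda>w. cvec (F z w)) 0 \<beta> \<and> \<beta> ` B \<subseteq> G)"
  proof
    fix z assume z: "z \<in> K"
    let ?s = "\<lambda>w. z0 + max 0 (min 1 (Re w)) *\<^sub>R (z - z0)"
    have sK: "?s w \<in> K" for w
    proof -
      let ?t = "max 0 (min 1 (Re w))"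
      have "?s w = (1 - ?t) *\<^sub>R z0 + ?t *\<^sub>R z" by (simp add: algebra_simps)
      moreover have "0 \<le> ?t" "?t \<le> 1" by auto
      ultimately show ?thesis using K(2)[unfolded convex_alt] K(3) z by presburger
    qed
    have cf: "continuous_on U (\<lambda>w. cvec (F z w))" for U
      by (intro continuous_on_cvec holomorphic_on_imp_continuous_on holomorphic_on_subset[OF F(1)[OF z]]) auto
    have "continuous_on UNIV (\<lambda>w. d (?s w))"
      by (rule continuous_on_compose2[OF cd]) (use sK in \<open>auto intro!: continuous_intros\<close>)
    then have oQ: "open {w. norm (cvec (F z w) - d (?s w)) < \<delta>}"
      by (intro open_Collect_less continuous_intros cf)
    have seg: "of_real ` {0..1::real} \<subseteq> {w. norm (cvec (F z w) - d (?s w)) < \<delta>}"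
    proof clarify
      fix t :: real assume t: "t \<in> {0..1}"
      then have "max 0 (min 1 t) = t" by auto
      then show "norm (cvec (F z (of_real t)) - d (?s (of_real t))) < \<delta>" using F(6)[OF z t] \<delta> by simp
    qed
    obtain \<Omega> B where \<Omega>B:
      "disk_model \<Omega> B (\<lambda>w. cvec (F z w))" "B \<subseteq> {w. norm (cvec (F z w) - d (?s w)) < \<delta>}"
      "of_real ` {0..1::real} \<subseteq> interior B"
      by (rule tube_domain[OF F(1)[OF z] F(2)[OF z] oQ seg])
    have "lifts S0 B (\<lambda>w. cvec (F z w)) 0 (\<lambda>w. E (?s w) (cvec (F z w) - d (?s w)))"
      by (rule tube_lift[OF K(2,3) z cd d0 E(1) Ez0 cf]) (use \<Omega>B(2) C0[OF z] in \<open>auto simp: C_def\<close>)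
    moreover have "(\<lambda>w. E (?s w) (cvec (F z w) - d (?s w))) ` B \<subseteq> G"
      using E(3)[OF sK] \<Omega>B(2) by blast
    ultimately show "\<exists>\<Omega> B. disk_model \<Omega> B (\<lambda>w. cvec (F z w)) \<and> of_real ` {0..1::real} \<subseteq> interior B \<and>
      (\<exists>\<beta>. lifts S0 B (\<lambda>w. cvec (F z w)) 0 \<beta> \<and> \<beta> ` B \<subseteq> G)" using \<Omega>B(1,3) by blast
  qed
  from this[unfolded bchoice_iff] obtain \<Omega> B where \<Omega>B: "\<forall>z\<in>K. disk_model (\<Omega> z) (B z) (\<lambda>w. cvec (F z w)) \<and>
      of_real ` {0..1::real} \<subseteq> interior (B z) \<and> (\<exists>\<beta>. lifts S0 (B z) (\<lambda>w. cvec (F z w)) 0 \<beta> \<and> \<beta> ` B z \<subseteq> G)"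
    by (elim exE) (rule that)
  have "\<forall>z\<in>K. \<exists>\<epsilon> g. \<epsilon> > 0 \<and> continuous_on ({0..1} \<times> ball 0 \<epsilon>) (\<lambda>(t, v). g t v) \<and>
    (\<forall>t\<in>{0..1}. \<forall>v. norm v < \<epsilon> \<longrightarrow> g t v \<in> interior (B z) \<and> cvec (F z (g t v)) = C t z + v) \<and>
    (\<forall>t\<in>{0..1}. g t 0 = complex_of_real t)"
  proof
    fix z assume z: "z \<in> K"
    have m: "disk_model (\<Omega> z) (B z) (\<lambda>w. cvec (F z w))" "of_real ` {0..1::real} \<subseteq> interior (B z)"
      using \<Omega>B z by auto
    obtain \<epsilon> and g :: "real \<Rightarrow> real^2 \<Rightarrow> complex" where "\<epsilon> > 0" "continuous_on ({0..1} \<times> ball 0 \<epsilon>) (\<lambda>(t, v). g t v)"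
      "\<forall>t\<in>{0..1}. \<forall>v. norm v < \<epsilon> \<longrightarrow> g t v \<in> interior (B z) \<and> cvec (F z (g t v)) = cvec (F z (of_real t)) + v"
      "\<forall>t\<in>{0..1}. g t 0 = of_real t"
      by (rule tube_sections[OF S0 m])
    then show "\<exists>\<epsilon> g. \<epsilon> > 0 \<and> continuous_on ({0..1} \<times> ball 0 \<epsilon>) (\<lambda>(t, v). g t v) \<and>
      (\<forall>t\<in>{0..1}. \<forall>v. norm v < \<epsilon> \<longrightarrow> g t v \<in> interior (B z) \<and> cvec (F z (g t v)) = C t z + v) \<and>
      (\<forall>t\<in>{0..1}. g t 0 = complex_of_real t)"
      unfolding C_def by blast
  qed
  from this[unfolded bchoice_iff] obtain \<epsilon> h where h: "\<forall>z\<in>K. \<epsilon> z > 0 \<and> continuous_on ({0..1} \<times> ball 0 (\<epsilon> z)) (\<lambda>(t, v). h z t v) \<and>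
    (\<forall>t\<in>{0..1}. \<forall>v. norm v < \<epsilon> z \<longrightarrow> h z t v \<in> interior (B z) \<and> cvec (F z (h z t v)) = C t z + v) \<and>
    (\<forall>t\<in>{0..1}. h z t 0 = complex_of_real t)"
    by (elim exE) (rule that)

  \<comment> \<open>Half of the width \<open>\<epsilon> z\<close> of a tube is reserved for moving \<open>z\<close>, the other half for moving the matrix away
      from the identity.\<close>
  have "\<forall>z\<in>K. \<exists>r. r > 0 \<and> (\<forall>t\<in>{0..1}. \<forall>z'\<in>K \<inter> ball z r. norm (C t z' - C t z) < \<epsilon> z / 2)"
  proof
    fix z assume z: "z \<in> K"
    have "uniformly_continuous_on ({0..1} \<times> K) (\<lambda>(t, z). C t z)"
      using K(1) by (intro compact_uniformly_continuous[OF cC2] compact_Times) auto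
    moreover have "\<epsilon> z / 2 > 0" using h z by simp
    ultimately obtain r where r: "r > 0" "\<And>p q. p \<in> {0..1} \<times> K \<Longrightarrow> q \<in> {0..1} \<times> K \<Longrightarrow> dist q p < r \<Longrightarrow>
      dist ((\<lambda>(t, z). C t z) q) ((\<lambda>(t, z). C t z) p) < \<epsilon> z / 2"
      unfolding uniformly_continuous_on_def by metis
    have "norm (C t z' - C t z) < \<epsilon> z / 2" if "t \<in> {0..1}" "z' \<in> K \<inter> ball z r" for t z'
      using r(2)[of "(t, z)" "(t, z')"] that z by (simp add: dist_Pair_Pair dist_commute) (simp add: dist_norm)
    then show "\<exists>r. r > 0 \<and> (\<forall>t\<in>{0..1}. \<forall>z'\<in>K \<inter> ball z r. norm (C t z' - C t z) < \<epsilon> z / 2)" using r(1) by blast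
  qed
  from this[unfolded bchoice_iff] obtain \<rho>
    where \<rho>: "\<forall>z\<in>K. \<rho> z > 0 \<and> (\<forall>t\<in>{0..1}. \<forall>z'\<in>K \<inter> ball z (\<rho> z). norm (C t z' - C t z) < \<epsilon> z / 2)"
    by (elim exE) (rule that)
  have "bounded ((\<lambda>(t, z). C t z) ` ({0..1} \<times> K))"
    using K(1) by (intro compact_imp_bounded compact_continuous_image[OF cC2] compact_Times) auto
  then obtain M where M: "\<And>x. x \<in> (\<lambda>(t, z). C t z) ` ({0..1} \<times> K) \<Longrightarrow> norm x \<le> M" unfolding bounded_iff by blast
  have CM: "norm (C t z) \<le> M" if "t \<in> {0..1}" "z \<in> K" for t z
    using M[of "C t z"] that by force
  define ok where "ok = (\<lambda>z (A :: real^2^2). \<forall>t\<in>{0..1}. \<forall>z'\<in>K \<inter> ball z (\<rho> z). norm (A *v C t z' - C t z) < \<epsilon> z)"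
  define ok' where "ok' = (\<lambda>A :: real^2^2. \<forall>t\<in>{0..1}. norm (A *v C t z0) < \<delta> / 2)"
  have ev_ok: "\<forall>\<^sub>F A in nhds (mat 1). ok z A" if z: "z \<in> K" for z
  proof -
    have "\<epsilon> z / 2 > 0" using h z by simp
    from eventually_matrix_near_id[OF this, of M] show ?thesis
    proof eventually_elim
      case (elim A)
      show ?case unfolding ok_def
      proof (intro ballI)
        fix t :: real and z' assume tz: "t \<in> {0..1}" "z' \<in> K \<inter> ball z (\<rho> z)"
        then have "norm (A *v C t z' - C t z') < \<epsilon> z / 2" using elim CM by blast
        moreover have "norm (C t z' - C t z) < \<epsilon> z / 2" using \<rho> z tz by blast
        ultimately show "norm (A *v C t z' - C t z) < \<epsilon> z"
          using norm_triangle_ineq[of "A *v C t z' - C t z'" "C t z' - C t z"] by simp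
      qed
    qed
  qed
  have ev_ok': "\<forall>\<^sub>F A in nhds (mat 1). ok' A"
  proof -
    have "\<delta> / 4 > 0" using \<delta> by simp
    from eventually_matrix_near_id[OF this, of M] show ?thesis
    proof eventually_elim
      case (elim A)
      show ?case unfolding ok'_def
      proof
        fix t :: real assume t: "t \<in> {0..1}"
        then have "norm (A *v C t z0 - C t z0) < \<delta> / 4" using elim CM K(3) by blast
        then show "norm (A *v C t z0) < \<delta> / 2"
          using norm_triangle_ineq[of "A *v C t z0 - C t z0" "C t z0"] C_near[OF t] by simp
      qed
    qed
  qed

  \<comment> \<open>The path \<open>C(_, z0)\<close> is a loop of size less than \<open>\<delta> / 4\<close>, not a constant. The disk \<open>?B'\<close> contains its
      images under matrices near the identity; where \<open>?B'\<close> lifts, these loops lift to loops.\<close>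
  let ?B' = "cball (0::complex) (\<delta> / 2)"
  have base: "disk_model UNIV ?B' cvec \<and> (\<exists>\<beta>. lifts S0 ?B' cvec 0 \<beta> \<and> \<beta> ` ?B' \<subseteq> G)"
  proof
    show "disk_model UNIV ?B' cvec"
      unfolding disk_model_def using \<delta> inj_cvec by (auto intro!: continuous_intros)
    have "develops S0 ?B' (\<lambda>w. (\<lambda>(x, v). E x v) (z0, cvec w)) (\<lambda>w. (\<lambda>(x, v). d x + v) (z0, cvec w))"
      by (rule develops_compose[OF E(1)]) (use K(3) \<delta> in \<open>auto intro!: continuous_intros\<close>)
    then have "develops S0 ?B' (\<lambda>w. E z0 (cvec w)) cvec" using d0 by simp
    then have "lifts S0 ?B' cvec 0 (\<lambda>w. E z0 (cvec w))"
      using Ez0 linear_0[OF linear_cvec] by (simp add: lifts_def)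
    moreover have "(\<lambda>w. E z0 (cvec w)) ` ?B' \<subseteq> G" using E(3)[OF K(3)] \<delta> by auto
    ultimately show "\<exists>\<beta>. lifts S0 ?B' cvec 0 \<beta> \<and> \<beta> ` ?B' \<subseteq> G" by blast
  qed
  define g where "g = (\<lambda>z x. h z 1 (x - d z))"
  have cg: "continuous_on (ball (d z) (\<epsilon> z)) (g z)" and gB: "\<And>x. x \<in> ball (d z) (\<epsilon> z) \<Longrightarrow> g z x \<in> interior (B z) \<and> cvec (F z (g z x)) = x"
    if z: "z \<in> K" for z
  proof -
    have ch: "continuous_on ({0..1} \<times> ball 0 (\<epsilon> z)) (\<lambda>(t, v). h z t v)" using h z by blast
    have "continuous_on (ball (d z) (\<epsilon> z)) (\<lambda>x. (\<lambda>(t, v). h z t v) (1, x - d z))"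
      by (rule continuous_on_compose2[OF ch]) (auto simp: dist_norm norm_minus_commute intro!: continuous_intros)
    then show "continuous_on (ball (d z) (\<epsilon> z)) (g z)" by (simp add: g_def)
    fix x assume "x \<in> ball (d z) (\<epsilon> z)"
    then have "norm (x - d z) < \<epsilon> z" by (simp add: dist_norm norm_minus_commute)
    then have "h z 1 (x - d z) \<in> interior (B z) \<and> cvec (F z (h z 1 (x - d z))) = C 1 z + (x - d z)"
      using h z by simp
    then show "g z x \<in> interior (B z) \<and> cvec (F z (g z x)) = x" using C1[OF z] by (simp add: g_def)
  qed
  have okd: "A *v d z' \<in> ball (d z) (\<epsilon> z)" if "z \<in> K" "ok z A" "z' \<in> K \<inter> ball z (\<rho> z)" for z z' A
  proof -
    have "norm (A *v C 1 z' - C 1 z) < \<epsilon> z" using that unfolding ok_def by simp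
    then show ?thesis using C1 that by (simp add: dist_norm norm_minus_commute)
  qed

  have main: "\<exists>\<gamma>. lifts S K (\<lambda>z. A *v d z) z0 \<gamma> \<and> (\<forall>z\<in>Z. \<forall>z'\<in>K \<inter> ball z (\<rho> z). \<gamma> z' = \<beta> z (g z (A *v d z')))"
    if S: "S \<in> structures" and Z: "Z \<subseteq> K" "K \<subseteq> (\<Union>z\<in>Z. ball z (\<rho> z))"
      and \<beta>: "\<And>z. z \<in> Z \<Longrightarrow> ok z A \<and> lifts S (B z) (\<lambda>w. cvec (F z w)) 0 (\<beta> z)"
      and A': "ok' A" and \<beta>': "lifts S ?B' cvec 0 \<beta>'"
    for S :: "'a pointed_structure" and A Z \<beta> \<beta>'
  proof -
    have path: "develops S {0..1} (\<lambda>t. \<beta> z (h z t (A *v C t z' - C t z))) (\<lambda>t. A *v C t z')"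
        "\<beta> z (h z 0 (A *v C 0 z' - C 0 z)) = bpt S"
        "\<beta> z (h z 1 (A *v C 1 z' - C 1 z)) = \<beta> z (g z (A *v d z'))"
      if z: "z \<in> Z" and z': "z' \<in> K \<inter> ball z (\<rho> z)" for z z'
    proof -
      have zK: "z \<in> K" and z'K: "z' \<in> K" using z z' Z by auto
      have small: "norm (A *v C t z' - C t z) < \<epsilon> z" if "t \<in> {0..1}" for t
        using \<beta>[OF z] that z' unfolding ok_def by blast
      let ?q = "\<lambda>t. h z t (A *v C t z' - C t z)"
      have ch: "continuous_on ({0..1} \<times> ball 0 (\<epsilon> z)) (\<lambda>(t, v). h z t v)" using h zK by blast
      have "continuous_on {0..1} (\<lambda>t. (\<lambda>(t, v). h z t v) (t, A *v C t z' - C t z))"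
        by (rule continuous_on_compose2[OF ch]) (use small in \<open>auto intro!: continuous_intros cC zK z'K\<close>)
      then have cq: "continuous_on {0..1} ?q" by simp
      have q: "?q t \<in> interior (B z) \<and> cvec (F z (?q t)) = C t z + (A *v C t z' - C t z)" if "t \<in> {0..1}" for t
        using h zK small[OF that] that by blast
      have "develops S (B z) (\<beta> z) (\<lambda>w. cvec (F z w))" using \<beta>[OF z] by (simp add: lifts_def)
      then have "develops S {0..1} (\<lambda>t. \<beta> z (?q t)) (\<lambda>t. cvec (F z (?q t)))"
        by (rule develops_compose[OF _ cq]) (use q interior_subset in blast)
      then show "develops S {0..1} (\<lambda>t. \<beta> z (?q t)) (\<lambda>t. A *v C t z')"
        by (rule develops_cong[where v = 0]) (use q in auto)
      have "h z 0 0 = 0" using h zK by simp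
      then show "\<beta> z (?q 0) = bpt S" using C0 zK z'K \<beta>[OF z] by (simp add: lifts_def)
      show "\<beta> z (?q 1) = \<beta> z (g z (A *v d z'))" using C1 zK z'K by (simp add: g_def)
    qed
    have indep: "\<beta> z1 (g z1 (A *v d z')) = \<beta> z2 (g z2 (A *v d z'))"
      if "z1 \<in> Z" "z2 \<in> Z" "z' \<in> K" "z' \<in> ball z1 (\<rho> z1)" "z' \<in> ball z2 (\<rho> z2)" for z1 z2 z'
    proof -
      have a: "z' \<in> K \<inter> ball z1 (\<rho> z1)" "z' \<in> K \<inter> ball z2 (\<rho> z2)" using that by auto
      note p1 = path[OF that(1) a(1)] and p2 = path[OF that(2) a(2)]
      have "\<beta> z1 (h z1 1 (A *v C 1 z' - C 1 z1)) = \<beta> z2 (h z2 1 (A *v C 1 z' - C 1 z2))"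
        by (rule develops_unique[OF S connected_Icc p1(1) p2(1), of 0]) (use p1(2) p2(2) in auto)
      then show ?thesis using p1(3) p2(3) by simp
    qed
    have "\<forall>z'\<in>K. \<exists>z. z \<in> Z \<and> z' \<in> ball z (\<rho> z)" using Z(2) by blast
    from bchoice[OF this] obtain c where c: "\<And>z'. z' \<in> K \<Longrightarrow> c z' \<in> Z \<and> z' \<in> ball (c z') (\<rho> (c z'))"
      by blast
    define \<gamma> where "\<gamma> = (\<lambda>z'. \<beta> (c z') (g (c z') (A *v d z')))"
    have \<gamma>: "\<gamma> z' = \<beta> z (g z (A *v d z'))" if "z \<in> Z" "z' \<in> K \<inter> ball z (\<rho> z)" for z z'
      using indep[of "c z'" z z'] c that by (auto simp: \<gamma>_def)
    have "develops S K \<gamma> (\<lambda>z. A *v d z)"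
    proof (rule develops_local)
      fix y assume y: "y \<in> K"
      let ?z = "c y"
      have z: "?z \<in> Z" "?z \<in> K" "y \<in> ball ?z (\<rho> ?z)" using c[OF y] Z(1) by auto
      let ?L = "K \<inter> ball ?z (\<rho> ?z)"
      have AL: "A *v d z' \<in> ball (d ?z) (\<epsilon> ?z)" if "z' \<in> ?L" for z'
        using okd[OF z(2) _ that] \<beta>[OF z(1)] by blast
      have "continuous_on ?L (\<lambda>z'. A *v d z')"
        by (intro continuous_on_matrix_vector continuous_on_subset[OF cd]) auto
      then have cont: "continuous_on ?L (\<lambda>z'. g ?z (A *v d z'))"
        by (rule continuous_on_compose2[OF cg[OF z(2)]]) (use AL in blast)
      have "develops S (B ?z) (\<beta> ?z) (\<lambda>w. cvec (F ?z w))" using \<beta>[OF z(1)] by (simp add: lifts_def)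
      then have "develops S ?L (\<lambda>z'. \<beta> ?z (g ?z (A *v d z'))) (\<lambda>z'. cvec (F ?z (g ?z (A *v d z'))))"
        by (rule develops_compose[OF _ cont]) (use gB[OF z(2) AL] interior_subset in blast)
      then have "develops S ?L \<gamma> (\<lambda>z'. A *v d z')"
        by (rule develops_cong[where v = 0]) (use gB[OF z(2) AL] \<gamma>[OF z(1)] in auto)
      then show "\<exists>N. open N \<and> y \<in> N \<and> develops S (K \<inter> N) \<gamma> (\<lambda>z. A *v d z)"
        using z(3) by (intro exI[of _ "ball ?z (\<rho> ?z)"]) auto
    qed
    moreover have "\<gamma> z0 = bpt S"
    proof -
      let ?z = "c z0"
      have z: "?z \<in> Z" "z0 \<in> K \<inter> ball ?z (\<rho> ?z)" using c[OF K(3)] K(3) by auto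
      note p = path[OF z]
      have d\<beta>': "develops S ?B' \<beta>' cvec" "\<beta>' 0 = bpt S" using \<beta>' by (auto simp: lifts_def)
      have "develops S {0..1} (\<lambda>t. \<beta>' (vcomplex (A *v C t z0))) (\<lambda>t. cvec (vcomplex (A *v C t z0)))"
      proof (rule develops_compose[OF d\<beta>'(1)])
        show "continuous_on {0..1} (\<lambda>t. vcomplex (A *v C t z0))" by (intro continuous_intros cC K(3))
        show "(\<lambda>t. vcomplex (A *v C t z0)) ` {0..1} \<subseteq> ?B'"
          using A' unfolding ok'_def by (auto intro: less_imp_le)
      qed
      then have 2: "develops S {0..1} (\<lambda>t. \<beta>' (vcomplex (A *v C t z0))) (\<lambda>t. A *v C t z0)" by simp
      have v0: "vcomplex 0 = 0" by (simp add: vcomplex_def complex_eq_iff)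
      \<comment> \<open>The lift of the loop in the tube and its lift in the disk at the basepoint coincide.\<close>
      have "\<beta> ?z (h ?z 1 (A *v C 1 z0 - C 1 ?z)) = \<beta>' (vcomplex (A *v C 1 z0))"
        by (rule develops_unique[OF S connected_Icc p(1) 2, of 0]) (use p(2) d\<beta>'(2) C0[OF K(3)] v0 in auto)
      then show ?thesis
        using \<gamma>[OF z] p(3) d\<beta>'(2) C1[OF K(3)] d0 v0 by simp
    qed
    ultimately have "lifts S K (\<lambda>z. A *v d z) z0 \<gamma>" by (simp add: lifts_def)
    then show ?thesis using \<gamma> by blast
  qed
  have "tube_cover S0 G K d z0 B (\<lambda>z w. cvec (F z w)) \<epsilon> \<rho> g ?B' cvec"
    unfolding tube_cover_def
  proof (intro conjI ballI allI impI)
    show "\<exists>\<Omega>. disk_model \<Omega> ?B' cvec" "\<exists>\<beta>. lifts S0 ?B' cvec 0 \<beta> \<and> \<beta> ` ?B' \<subseteq> G" using base by blast+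
    fix Z assume Z: "finite Z" "Z \<subseteq> K" "K \<subseteq> (\<Union>z\<in>Z. ball z (\<rho> z))"
    have "\<forall>\<^sub>F A in nhds (mat 1). \<forall>z\<in>Z. ok z A"
      using Z(1,2) ev_ok by (intro eventually_ball_finite) auto
    then show "\<forall>\<^sub>F A in nhds (mat 1). (\<forall>z\<in>Z. \<forall>z'\<in>K \<inter> ball z (\<rho> z). A *v d z' \<in> ball (d z) (\<epsilon> z)) \<and>
         (\<forall>S\<in>structures. \<forall>\<beta> \<beta>'. (\<forall>z\<in>Z. lifts (S :: 'a pointed_structure) (B z) (\<lambda>w. cvec (F z w)) 0 (\<beta> z)) \<longrightarrow> lifts S ?B' cvec 0 \<beta>' \<longrightarrow>
           (\<exists>\<gamma>. lifts S K (\<lambda>z. A *v d z) z0 \<gamma> \<and> (\<forall>z\<in>Z. \<forall>z'\<in>K \<inter> ball z (\<rho> z). \<gamma> z' = \<beta> z (g z (A *v d z')))))"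
      using ev_ok'
    proof eventually_elim
      case (elim A)
      have "A *v d z' \<in> ball (d z) (\<epsilon> z)" if "z \<in> Z" "z' \<in> K \<inter> ball z (\<rho> z)" for z z'
        using okd[of z A z'] elim(1) that Z(2) by blast
      moreover have "\<exists>\<gamma>. lifts S K (\<lambda>z. A *v d z) z0 \<gamma> \<and> (\<forall>z\<in>Z. \<forall>z'\<in>K \<inter> ball z (\<rho> z). \<gamma> z' = \<beta> z (g z (A *v d z')))"
        if "S \<in> structures" "\<forall>z\<in>Z. lifts S (B z) (\<lambda>w. cvec (F z w)) 0 (\<beta> z)" "lifts S ?B' cvec 0 \<beta>'"
        for S :: "'a pointed_structure" and \<beta> \<beta>'
        by (rule main[OF that(1) Z(2,3) _ elim(2) that(3)]) (use elim(1) that(2) in blast)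
      ultimately show ?case by blast
    qed
  next
    fix z assume z: "z \<in> K"
    show "\<exists>\<Omega>. disk_model \<Omega> (B z) (\<lambda>w. cvec (F z w))" "\<exists>\<beta>. lifts S0 (B z) (\<lambda>w. cvec (F z w)) 0 \<beta> \<and> \<beta> ` B z \<subseteq> G"
      using \<Omega>B z by blast+
    show "0 < \<epsilon> z" "0 < \<rho> z" using h \<rho> z by blast+
    show "continuous_on (ball (d z) (\<epsilon> z)) (g z)" by (rule cg[OF z])
    fix x assume x: "x \<in> ball (d z) (\<epsilon> z)"
    show "g z x \<in> interior (B z)" "cvec (F z (g z x)) = x" using gB[OF z x] by blast+
  qed
  then show ?thesis by (rule that)
qed

section \<open>Developed maps under the action\<close>

lemma charts_act: "(U, \<phi>) \<in> charts P \<Longrightarrow> (U, restrict (\<lambda>x. A *v \<phi> x) U) \<in> charts (act A P)"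
  unfolding act_def by (force simp: matrix_chart_def)

lemma develops_act:
  assumes A: "invertible A" and P: "P \<in> structures" and \<gamma>: "develops P K \<gamma> d"
  shows "develops (act A P) K \<gamma> (\<lambda>z. A *v d z)"
proof (rule developsI[OF act_structures[OF A P]])
  show "continuous_map (top_of_set K) (surf (act A P)) \<gamma>" using develops_continuous_map[OF \<gamma>] by simp
  fix x assume x: "x \<in> K"
  obtain U \<phi> where U: "(U, \<phi>) \<in> charts P" "\<gamma> x \<in> U" using chart_exists[OF P develops_topspace[OF \<gamma> x]] .
  let ?\<psi> = "restrict (\<lambda>x. A *v \<phi> x) U"
  have "\<forall>\<^sub>F y in nhds x. y \<in> K \<longrightarrow> ?\<psi> (\<gamma> y) - ?\<psi> (\<gamma> x) = A *v d y - A *v d x"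
    using developsD[OF \<gamma> x U] eventually_in_open[OF develops_continuous_map[OF \<gamma>] chart_openin(1)[OF P U(1)] x U(2)]
    by eventually_elim (simp add: U(2) flip: matrix_vector_mult_diff_distrib)
  then show "\<exists>U \<phi>. (U, \<phi>) \<in> charts (act A P) \<and> \<gamma> x \<in> U \<and>
       (\<forall>\<^sub>F y in nhds x. y \<in> K \<longrightarrow> \<phi> (\<gamma> y) - \<phi> (\<gamma> x) = A *v d y - A *v d x)"
    using charts_act[OF U(1)] U(2) by blast
qed

lemma act_compose:
  fixes P :: "'a pointed_structure"
  shows "act (A ** B) P = act A (act B P)"
proof -
  have "matrix_chart (A ** B) c = matrix_chart A (matrix_chart B c)" for c :: "'a chart"
    by (cases c) (auto simp: matrix_chart_def fun_eq_iff restrict_def matrix_vector_mul_assoc)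
  then show ?thesis by (simp add: act_def image_image)
qed

lemma act_id:
  assumes P: "P \<in> structures"
  shows "act (mat 1) P = P"
proof -
  have "matrix_chart (mat 1) c = c" if "c \<in> charts P" for c
    using charts_structures(2)[OF P, of "fst c" "snd c"] that
    by (cases c) (simp add: matrix_chart_def extensional_restrict)
  then have "matrix_chart (mat 1) ` charts P = charts P" by simp
  then show ?thesis by (simp add: act_def)
qed

lemma act_inverse:
  assumes A: "invertible A" and P: "P \<in> structures"
  shows "act (matrix_inv A) (act A P) = P"
  using act_compose[of "matrix_inv A" A P] matrix_inv_works(2)[OF A] act_id[OF P] by simp

lemma lifts_act_iff:
  assumes A: "invertible A" and P: "P \<in> structures"
  shows "lifts (act A P) K d z0 \<gamma> \<longleftrightarrow> lifts P K (\<lambda>z. matrix_inv A *v d z) z0 \<gamma>"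
proof
  assume l: "lifts (act A P) K d z0 \<gamma>"
  show "lifts P K (\<lambda>z. matrix_inv A *v d z) z0 \<gamma>"
    using develops_act[OF matrix_inv_works(5)[OF A] act_structures[OF A P], of K \<gamma> d] l act_inverse[OF A P]
    by (simp add: lifts_def)
next
  assume "lifts P K (\<lambda>z. matrix_inv A *v d z) z0 \<gamma>"
  then show "lifts (act A P) K d z0 \<gamma>"
    using develops_act[OF A P, of K \<gamma> "\<lambda>z. matrix_inv A *v d z"] by (simp add: lifts_def matrix_inv_works(3)[OF A])
qed

lemma parametrizes_act:
  assumes A: "invertible A" and p: "parametrizes R D K h k d z0"
  shows "parametrizes (act A R) D K h k (\<lambda>z. A *v d z) z0"
  using p develops_act[OF A, of R K h d] act_structures[OF A, of R] unfolding parametrizes_def PC_def by simp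

lemma lifts_unique:
  assumes S: "S \<in> structures" and K: "connected K" "z0 \<in> K" and l: "lifts S K d z0 \<gamma>" "lifts S K d z0 \<gamma>'" and z: "z \<in> K"
  shows "\<gamma> z = \<gamma>' z"
  using develops_unique[OF S K(1) _ _ K(2) _ z, of \<gamma> d \<gamma>'] l by (simp add: lifts_def)

lemma lifts_subset: "lifts S K d z0 \<gamma> \<Longrightarrow> L \<subseteq> K \<Longrightarrow> lifts S L d z0 \<gamma>"
  unfolding lifts_def using develops_subset by blast

section \<open>Lifts to nearby surfaces\<close>

lemma finite_ball_cover:
  fixes K :: "'k::metric_space set"
  assumes "compact K" "\<And>z. z \<in> K \<Longrightarrow> 0 < \<rho> z"
  obtains Z where "finite Z" "Z \<subseteq> K" "K \<subseteq> (\<Union>z\<in>Z. ball z (\<rho> z))"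
proof -
  have "K \<subseteq> (\<Union>z\<in>K. ball z (\<rho> z))" using assms(2) by force
  from compactE_image[OF assms(1) open_ball this] obtain Z where "Z \<subseteq> K" "finite Z" "K \<subseteq> (\<Union>z\<in>Z. ball z (\<rho> z))" .
  then show ?thesis using that by blast
qed

lemma tube_coverD:
  assumes "tube_cover (S0 :: 'a pointed_structure) G K d z0 B f \<epsilon> \<rho> g B' f'"
  shows "\<And>z. z \<in> K \<Longrightarrow> \<exists>\<Omega>. disk_model \<Omega> (B z) (f z)"
    "\<And>z. z \<in> K \<Longrightarrow> \<exists>\<beta>. lifts S0 (B z) (f z) 0 \<beta> \<and> \<beta> ` B z \<subseteq> G"
    "\<exists>\<Omega>. disk_model \<Omega> B' f'" "\<exists>\<beta>. lifts S0 B' f' 0 \<beta> \<and> \<beta> ` B' \<subseteq> G"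
    "\<And>z. z \<in> K \<Longrightarrow> 0 < \<epsilon> z \<and> 0 < \<rho> z" "\<And>z. z \<in> K \<Longrightarrow> continuous_on (ball (d z) (\<epsilon> z)) (g z)"
    "\<And>z x. z \<in> K \<Longrightarrow> x \<in> ball (d z) (\<epsilon> z) \<Longrightarrow> g z x \<in> interior (B z) \<and> f z (g z x) = x"
    "\<And>Z. finite Z \<Longrightarrow> Z \<subseteq> K \<Longrightarrow> K \<subseteq> (\<Union>z\<in>Z. ball z (\<rho> z)) \<Longrightarrow>
       \<forall>\<^sub>F A in nhds (mat 1). (\<forall>z\<in>Z. \<forall>z'\<in>K \<inter> ball z (\<rho> z). A *v d z' \<in> ball (d z) (\<epsilon> z)) \<and>
         (\<forall>S\<in>structures. \<forall>\<beta> \<beta>'. (\<forall>z\<in>Z. lifts (S :: 'a pointed_structure) (B z) (f z) 0 (\<beta> z)) \<longrightarrow> lifts S B' f' 0 \<beta>' \<longrightarrow>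
           (\<exists>\<gamma>. lifts S K (\<lambda>z. A *v d z) z0 \<gamma> \<and> (\<forall>z\<in>Z. \<forall>z'\<in>K \<inter> ball z (\<rho> z). \<gamma> z' = \<beta> z (g z (A *v d z')))))"
  using assms unfolding tube_cover_def by simp_all

text \<open>
  For \<open>A = 1\<close> and \<open>S = S0\<close>, the lift provided by the tubes is the original one.
\<close>

lemma tube_cover_start:
  fixes S0 :: "'a pointed_structure" and K :: "'k::real_normed_vector set"
  assumes t: "tube_cover S0 G K d z0 B f \<epsilon> \<rho> g B' f'" and S0: "S0 \<in> structures"
    and K: "compact K" "convex K" "z0 \<in> K" and \<gamma>0: "lifts S0 K d z0 \<gamma>0" and z: "z \<in> K"
    and \<beta>: "lifts S0 (B z) (f z) 0 \<beta>"
  shows "\<beta> (g z (d z)) = \<gamma>0 z"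
proof -
  note t = tube_coverD[OF t]
  obtain Z0 where Z0: "finite Z0" "Z0 \<subseteq> K" "K \<subseteq> (\<Union>z\<in>Z0. ball z (\<rho> z))"
    using finite_ball_cover[OF K(1), of \<rho>] t(5) by metis
  let ?Z = "insert z Z0"
  have "finite ?Z" "?Z \<subseteq> K" "K \<subseteq> (\<Union>z\<in>?Z. ball z (\<rho> z))" using Z0 z by auto
  note ev = eventually_nhds_x_imp_x[OF t(8)[OF this]]
  have "\<forall>z\<in>K. \<exists>\<beta>. lifts S0 (B z) (f z) 0 \<beta>" using t(2) by blast
  from bchoice[OF this] obtain \<beta>0 where \<beta>0: "\<forall>z\<in>K. lifts S0 (B z) (f z) 0 (\<beta>0 z)" by blast
  obtain \<beta>' where \<beta>': "lifts S0 B' f' 0 \<beta>'" using t(4) by blast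
  have "\<forall>z'\<in>?Z. lifts S0 (B z') (f z') 0 ((\<beta>0(z := \<beta>)) z')" using \<beta>0 \<beta> Z0(2) by auto
  then obtain \<gamma> where \<gamma>: "lifts S0 K (\<lambda>z. mat 1 *v d z) z0 \<gamma>"
    "\<forall>y\<in>?Z. \<forall>z'\<in>K \<inter> ball y (\<rho> y). \<gamma> z' = (\<beta>0(z := \<beta>)) y (g y (mat 1 *v d z'))"
    using ev S0 \<beta>' by blast
  have "\<gamma> z = \<beta> (g z (d z))" using \<gamma>(2) z t(5) by simp
  moreover have "lifts S0 K d z0 \<gamma>" using \<gamma>(1) by simp
  then have "\<gamma> z = \<gamma>0 z" by (rule lifts_unique[OF S0 convex_connected[OF K(2)] K(3) _ \<gamma>0 z])
  ultimately show ?thesis by simp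
qed

text \<open>
  The lift of \<open>A d\<close> to a nearby \<open>P\<close> passes through \<open>x\<close> within the part \<open>L\<close> of its domain as soon as the
  tube belonging to \<open>u\<close> meets \<open>x\<close> in the small set \<open>U\<close> at its far end. The set \<open>U\<close> is mapped by \<open>f\<close>
  to a small ball around \<open>d u\<close>, and every point of this ball has the form \<open>A (d y)\<close> with \<open>y\<close> in \<open>L\<close> near
  \<open>u\<close>, because \<open>d\<close> is open at \<open>u\<close> along \<open>L\<close>.
\<close>

lemma near_id_lifts_at:
  fixes K :: "'k::real_normed_vector set" and S0 :: "'a pointed_structure"
  assumes S0: "S0 \<in> structures" and K: "compact K" "convex K" "z0 \<in> K"
    and \<gamma>0: "lifts S0 K d z0 \<gamma>0" and d0: "d z0 = 0" and u: "u \<in> K"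
    and N: "\<And>N. open N \<Longrightarrow> u \<in> N \<Longrightarrow> \<exists>e>0. ball (d u) e \<subseteq> d ` (L \<inter> N)" and L: "L \<subseteq> K"
  obtains V \<Omega> B f U where "openin immersive_topology_\<M> V" "iso_rel `` {S0} \<in> V"
    "disk_model \<Omega> B f" "open U" "U \<subseteq> B" "\<exists>\<beta>. lifts S0 B f 0 \<beta> \<and> \<gamma>0 u \<in> \<beta> ` U"
    "\<forall>\<^sub>F A in nhds (mat 1). invertible A \<longrightarrow> (\<forall>P\<in>structures. \<forall>x. iso_rel `` {P :: 'a pointed_structure} \<in> V \<longrightarrow>
       (\<exists>\<beta>. lifts P B f 0 \<beta> \<and> x \<in> \<beta> ` U) \<longrightarrow> (\<exists>\<gamma>. lifts P K (\<lambda>z. A *v d z) z0 \<gamma> \<and> x \<in> \<gamma> ` L))"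
proof -
  have G: "openin (surf S0) (topspace (surf S0))" "\<gamma>0 ` K \<subseteq> topspace (surf S0)"
    using \<gamma>0 develops_topspace by (auto simp: lifts_def)
  obtain B f \<epsilon> \<rho> g B' f' where tc: "tube_cover S0 (topspace (surf S0)) K d z0 B f \<epsilon> \<rho> g B' f'"
    by (rule tube_cover_exists[OF S0 K \<gamma>0 d0 G])
  note t = tube_coverD[OF tc]
  have pos: "0 < \<epsilon> u" "0 < \<rho> u" using t(5)[OF u] by auto
  obtain Z0 where Z0: "finite Z0" "Z0 \<subseteq> K" "K \<subseteq> (\<Union>z\<in>Z0. ball z (\<rho> z))"
    using finite_ball_cover[OF K(1), of \<rho>] t(5) by metis
  let ?Z = "insert u Z0"
  have Z: "finite ?Z" "?Z \<subseteq> K" "K \<subseteq> (\<Union>z\<in>?Z. ball z (\<rho> z))" using Z0 u by auto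
  obtain e where e: "e > 0" "ball (d u) e \<subseteq> d ` (L \<inter> ball u (\<rho> u))"
    using N[of "ball u (\<rho> u)"] pos by auto
  define r where "r = min (\<epsilon> u) (e / 2)"
  have r: "r > 0" "r \<le> \<epsilon> u" "r \<le> e / 2" using e pos by (auto simp: r_def)
  have rb: "ball (d u) r \<subseteq> ball (d u) (\<epsilon> u)" using r(2) by auto
  define U where "U = g u ` ball (d u) r"
  have "inj_on (g u) (ball (d u) r)"
    by (rule inj_on_inverseI[of _ "f u"]) (use t(7)[OF u] rb in blast)
  then have oU: "open U"
    unfolding U_def by (intro invariance_of_domain_gen continuous_on_subset[OF t(6)[OF u] rb]) auto
  have UB: "U \<subseteq> B u" unfolding U_def using t(7)[OF u] rb interior_subset by blast
  obtain \<Omega> where \<Omega>: "disk_model \<Omega> (B u) (f u)" using t(1)[OF u] by blast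
  have "\<forall>z\<in>K. \<exists>W :: 'a pointed_structure set set. openin immersive_topology_\<M> W \<and> (\<forall>P\<in>structures. iso_rel `` {P} \<in> W \<longleftrightarrow> (\<exists>\<beta>. lifts P (B z) (f z) 0 \<beta>))"
  proof
    fix z assume "z \<in> K"
    then obtain \<Omega> where "disk_model \<Omega> (B z) (f z)" using t(1) by blast
    from open_lifts[OF S0 this] show "\<exists>W :: 'a pointed_structure set set. openin immersive_topology_\<M> W \<and> (\<forall>P\<in>structures. iso_rel `` {P} \<in> W \<longleftrightarrow> (\<exists>\<beta>. lifts P (B z) (f z) 0 \<beta>))"
      by metis
  qed
  from bchoice[OF this] obtain W :: "'k \<Rightarrow> 'a pointed_structure set set" where
    W: "\<forall>z\<in>K. openin immersive_topology_\<M> (W z) \<and> (\<forall>P\<in>structures. iso_rel `` {P} \<in> W z \<longleftrightarrow> (\<exists>\<beta>. lifts P (B z) (f z) 0 \<beta>))"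
    by blast
  obtain \<Omega>' where "disk_model \<Omega>' B' f'" using t(3) by blast
  from open_lifts[OF S0 this] obtain W' :: "'a pointed_structure set set" where
    W': "openin immersive_topology_\<M> W'" "\<And>P. P \<in> structures \<Longrightarrow> iso_rel `` {P} \<in> W' \<longleftrightarrow> (\<exists>\<beta>. lifts P B' f' 0 \<beta>)"
    by metis
  define V where "V = W' \<inter> (\<Inter>z\<in>?Z. W z)"
  have oV: "openin immersive_topology_\<M> V"
    unfolding V_def using W W'(1) Z by (intro openin_Int openin_INT2) auto
  have S0V: "iso_rel `` {S0} \<in> V"
  proof -
    have "iso_rel `` {S0} \<in> W z" if "z \<in> K" for z
    proof -
      have "\<exists>\<beta>. lifts S0 (B z) (f z) 0 \<beta>" using t(2)[OF that] by blast
      then show ?thesis using bspec[OF W that] S0 by simp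
    qed
    moreover have "\<exists>\<beta>. lifts S0 B' f' 0 \<beta>" using t(4) by blast
    then have "iso_rel `` {S0} \<in> W'" using W'(2)[OF S0] by simp
    ultimately show ?thesis unfolding V_def using Z(2) by blast
  qed
  obtain \<beta>u where \<beta>u: "lifts S0 (B u) (f u) 0 \<beta>u" using t(2)[OF u] by blast
  have "\<beta>u (g u (d u)) = \<gamma>0 u" by (rule tube_cover_start[OF tc S0 K \<gamma>0 u \<beta>u])
  then have in_U: "\<gamma>0 u \<in> \<beta>u ` U" using r(1) unfolding U_def by (metis centre_in_ball imageI)
  \<comment> \<open>A point \<open>v\<close> of the ball of radius \<open>r \<le> e / 2\<close> moves by less than \<open>e / 2\<close> under \<open>A\<^sup>-\<^sup>1\<close>, so that \<open>A\<^sup>-\<^sup>1 v\<close>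
      lies in the ball of radius \<open>e\<close>, where \<open>d\<close> takes all values.\<close>
  have ev_inv: "\<forall>\<^sub>F A in nhds (mat 1 :: real^2^2). invertible A \<longrightarrow> (\<forall>x. norm x \<le> norm (d u) + r \<longrightarrow> norm (matrix_inv A *v x - x) < e / 2)"
  proof -
    have "e / 2 > 0" using e(1) by simp
    from eventually_matrix_inv[OF eventually_matrix_near_id[OF this, of "norm (d u) + r"]] show ?thesis .
  qed
  have ev: "\<forall>\<^sub>F A in nhds (mat 1). invertible A \<longrightarrow> (\<forall>P\<in>structures. \<forall>x. iso_rel `` {P :: 'a pointed_structure} \<in> V \<longrightarrow>
       (\<exists>\<beta>. lifts P (B u) (f u) 0 \<beta> \<and> x \<in> \<beta> ` U) \<longrightarrow> (\<exists>\<gamma>. lifts P K (\<lambda>z. A *v d z) z0 \<gamma> \<and> x \<in> \<gamma> ` L))"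
    using t(8)[OF Z] ev_inv
  proof eventually_elim
    case (elim A)
    show ?case
    proof (intro impI ballI allI)
      fix P :: "'a pointed_structure" and x
      assume A: "invertible A" and P: "P \<in> structures" "iso_rel `` {P} \<in> V" and x: "\<exists>\<beta>. lifts P (B u) (f u) 0 \<beta> \<and> x \<in> \<beta> ` U"
      obtain \<beta>1 where \<beta>1: "lifts P (B u) (f u) 0 \<beta>1" "x \<in> \<beta>1 ` U" using x by blast
      have "\<forall>z\<in>Z0. \<exists>\<beta>. lifts P (B z) (f z) 0 \<beta>"
      proof
        fix z assume z: "z \<in> Z0"
        then have "iso_rel `` {P} \<in> W z" "z \<in> K" using P(2) Z0(2) unfolding V_def by blast+
        then show "\<exists>\<beta>. lifts P (B z) (f z) 0 \<beta>" using W P(1) by simp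
      qed
      from bchoice[OF this] obtain \<beta>0 where \<beta>0: "\<forall>z\<in>Z0. lifts P (B z) (f z) 0 (\<beta>0 z)" by blast
      obtain \<beta>' where \<beta>': "lifts P B' f' 0 \<beta>'" using P(2) W'(2)[OF P(1)] unfolding V_def by blast
      have "\<forall>z\<in>?Z. lifts P (B z) (f z) 0 ((\<beta>0(u := \<beta>1)) z)" using \<beta>0 \<beta>1(1) by auto
      with bspec[OF conjunct2[OF elim(1)] P(1)] \<beta>'
      obtain \<gamma> where \<gamma>: "lifts P K (\<lambda>z. A *v d z) z0 \<gamma>"
        "\<forall>z\<in>?Z. \<forall>z'\<in>K \<inter> ball z (\<rho> z). \<gamma> z' = (\<beta>0(u := \<beta>1)) z (g z (A *v d z'))"
        by blast
      obtain v where v: "v \<in> ball (d u) r" "x = \<beta>1 (g u v)" using \<beta>1(2) unfolding U_def by blast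
      have "norm v \<le> norm (d u) + r"
        using v(1) norm_triangle_ineq2[of v "d u"] by (simp add: dist_norm norm_minus_commute)
      then have "norm (matrix_inv A *v v - v) < e / 2" using elim(2) A by blast
      moreover have "dist (d u) v < e / 2" using v(1) r(3) by simp
      ultimately have "dist (d u) (matrix_inv A *v v) < e"
        using dist_triangle[of "d u" "matrix_inv A *v v" v] by (simp add: dist_norm norm_minus_commute)
      then obtain y where y: "y \<in> L \<inter> ball u (\<rho> u)" "matrix_inv A *v v = d y" using e(2) by auto
      then have "A *v d y = v" using matrix_inv_works(3)[OF A, of v] by simp
      then have "\<gamma> y = x" using \<gamma>(2) y(1) L v(2) by auto
      then show "\<exists>\<gamma>. lifts P K (\<lambda>z. A *v d z) z0 \<gamma> \<and> x \<in> \<gamma> ` L" using \<gamma>(1) y(1) by blast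
    qed
  qed
  show ?thesis
    by (rule that[OF oV S0V \<Omega> oU UB _ ev]) (use \<beta>u in_U in blast)
qed

text \<open>
  Near each \<open>z\<close> in the compact set \<open>H\<close>, the far end of the tube contains a compact neighbourhood \<open>C\<close>
  of the end point that is not mapped to the basepoint of \<open>S0\<close>. Avoiding the basepoint on \<open>C\<close> is an open
  condition on the surface, and for \<open>z'\<close> near \<open>z\<close> and \<open>A\<close> near the
  identity the path of \<open>z'\<close> ends in \<open>C\<close>. Parameters outside \<open>H\<close>
  get the empty set instead of \<open>C\<close>.
\<close>

lemma near_id_lifts_avoiding:
  fixes K :: "'k::real_normed_vector set" and S0 :: "'a pointed_structure"
  assumes S0: "S0 \<in> structures" and K: "compact K" "convex K" "z0 \<in> K"
    and \<gamma>0: "lifts S0 K d z0 \<gamma>0" and d0: "d z0 = 0" and H: "closed H" "H \<subseteq> K" "bpt S0 \<notin> \<gamma>0 ` H"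
  obtains V where "openin immersive_topology_\<M> V" "iso_rel `` {S0} \<in> V"
    "\<forall>\<^sub>F A in nhds (mat 1). \<forall>P\<in>structures. iso_rel `` {P :: 'a pointed_structure} \<in> V \<longrightarrow>
       (\<exists>\<gamma>. lifts P K (\<lambda>z. A *v d z) z0 \<gamma> \<and> bpt P \<notin> \<gamma> ` H)"
proof -
  have dev0: "develops S0 K \<gamma>0 d" using \<gamma>0 by (simp add: lifts_def)
  have G: "openin (surf S0) (topspace (surf S0))" "\<gamma>0 ` K \<subseteq> topspace (surf S0)"
    using dev0 develops_topspace by auto
  have cd: "continuous_on K d" by (rule developed_map_continuous[OF S0 dev0])
  obtain M where M: "\<And>z. z \<in> K \<Longrightarrow> norm (d z) \<le> M"
    using compact_imp_bounded[OF compact_continuous_image[OF cd K(1)]] unfolding bounded_iff by auto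
  obtain B f \<epsilon> \<rho> g B' f' where tc: "tube_cover S0 (topspace (surf S0)) K d z0 B f \<epsilon> \<rho> g B' f'"
    by (rule tube_cover_exists[OF S0 K \<gamma>0 d0 G])
  note t = tube_coverD[OF tc]
  have "\<forall>z\<in>K. \<exists>\<sigma> C. 0 < \<sigma> \<and> \<sigma> \<le> \<rho> z \<and> compact C \<and> C \<subseteq> B z \<and> (\<exists>\<beta>. lifts S0 (B z) (f z) 0 \<beta> \<and> bpt S0 \<notin> \<beta> ` C) \<and>
    (\<forall>\<^sub>F A in nhds (mat 1). \<forall>z'\<in>H \<inter> ball z \<sigma>. g z (A *v d z') \<in> C)"
  proof
    fix z assume z: "z \<in> K"
    have pos: "0 < \<epsilon> z" "0 < \<rho> z" using t(5)[OF z] by auto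
    obtain \<beta> where \<beta>: "lifts S0 (B z) (f z) 0 \<beta>" using t(2)[OF z] by blast
    show "\<exists>\<sigma> C. 0 < \<sigma> \<and> \<sigma> \<le> \<rho> z \<and> compact C \<and> C \<subseteq> B z \<and> (\<exists>\<beta>. lifts S0 (B z) (f z) 0 \<beta> \<and> bpt S0 \<notin> \<beta> ` C) \<and>
      (\<forall>\<^sub>F A in nhds (mat 1). \<forall>z'\<in>H \<inter> ball z \<sigma>. g z (A *v d z') \<in> C)"
    proof (cases "z \<in> H")
      case False
      then obtain s where s: "s > 0" "ball z s \<inter> H = {}"
        using H(1) by (metis ComplI disjoint_eq_subset_Compl open_Compl open_contains_ball)
      have "H \<inter> ball z (min s (\<rho> z)) = {}" using s(2) by auto
      then show ?thesis
        using s(1) pos \<beta> by (intro exI[of _ "min s (\<rho> z)"] exI[of _ "{}"]) auto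
    next
      case True
      have ne: "\<beta> (g z (d z)) \<noteq> bpt S0"
        using tube_cover_start[OF tc S0 K \<gamma>0 z \<beta>] H(3) True by (metis imageI)
      have "develops S0 (ball (d z) (\<epsilon> z)) (\<lambda>x. \<beta> (g z x)) (\<lambda>x. f z (g z x))"
        using \<beta> unfolding lifts_def
        by (intro develops_compose[OF _ t(6)[OF z]]) (use t(7)[OF z] interior_subset in blast)+
      then have cont: "continuous_map (top_of_set (ball (d z) (\<epsilon> z))) (surf S0) (\<lambda>x. \<beta> (g z x))"
        by (rule develops_continuous_map)
      have o1: "openin (surf S0) (topspace (surf S0) - {bpt S0})"
        using closedin_Hausdorff_sing_eq[OF structure_Hausdorff[OF S0]] structure_bpt[OF S0] by blast
      have o2: "\<beta> (g z (d z)) \<in> topspace (surf S0) - {bpt S0}"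
        using ne tube_cover_start[OF tc S0 K \<gamma>0 z \<beta>] develops_topspace[OF dev0 z] by simp
      have "\<forall>\<^sub>F x in nhds (d z). x \<in> ball (d z) (\<epsilon> z) \<longrightarrow> \<beta> (g z x) \<in> topspace (surf S0) - {bpt S0}"
        by (rule eventually_in_open[OF cont o1 _ o2]) (use pos in simp)
      then obtain s where s: "s > 0" "\<And>x. dist x (d z) < s \<Longrightarrow> x \<in> ball (d z) (\<epsilon> z) \<longrightarrow> \<beta> (g z x) \<noteq> bpt S0"
        unfolding eventually_nhds_metric by blast
      define r where "r = min s (\<epsilon> z) / 2"
      have r: "r > 0" "r < s" "r < \<epsilon> z" using s(1) pos by (auto simp: r_def)
      have rb: "cball (d z) r \<subseteq> ball (d z) (\<epsilon> z)" using r(3) by auto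
      define C where "C = g z ` cball (d z) r"
      have C: "compact C" "C \<subseteq> B z"
      proof -
        show "compact C"
          unfolding C_def by (intro compact_continuous_image continuous_on_subset[OF t(6)[OF z] rb] compact_cball)
        show "C \<subseteq> B z"
        proof
          fix w assume "w \<in> C"
          then obtain x where "x \<in> cball (d z) r" "w = g z x" unfolding C_def by blast
          then show "w \<in> B z" using t(7)[OF z, of x] rb interior_subset by blast
        qed
      qed
      have bC: "bpt S0 \<notin> \<beta> ` C"
      proof
        assume "bpt S0 \<in> \<beta> ` C"
        then obtain x where x: "x \<in> cball (d z) r" "bpt S0 = \<beta> (g z x)" unfolding C_def by blast
        then have "dist x (d z) < s" "x \<in> ball (d z) (\<epsilon> z)" using r by (auto simp: dist_commute)
        then show False using s(2) x(2) by metis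
      qed
      obtain q where q: "q > 0" "\<And>z'. z' \<in> K \<Longrightarrow> dist z' z < q \<Longrightarrow> dist (d z') (d z) < r / 2"
        using cd z r(1) unfolding continuous_on_iff by (metis half_gt_zero)
      have "\<forall>\<^sub>F A in nhds (mat 1 :: real^2^2). \<forall>x. norm x \<le> M \<longrightarrow> norm (A *v x - x) < r / 2"
        using r(1) by (intro eventually_matrix_near_id) auto
      then have "\<forall>\<^sub>F A in nhds (mat 1). \<forall>z'\<in>H \<inter> ball z (min q (\<rho> z)). g z (A *v d z') \<in> C"
      proof eventually_elim
        case (elim A)
        show ?case
        proof
          fix z' assume z': "z' \<in> H \<inter> ball z (min q (\<rho> z))"
          then have "z' \<in> K" "dist z' z < q" using H(2) by (auto simp: dist_commute)
          then have "dist (d z') (d z) < r / 2" "norm (A *v d z' - d z') < r / 2" using q(2) elim M by blast+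
          then have "dist (d z) (A *v d z') \<le> r"
            using dist_triangle[of "d z" "A *v d z'" "d z'"] by (simp add: dist_commute) (simp add: dist_norm norm_minus_commute)
          then show "g z (A *v d z') \<in> C" unfolding C_def by simp
        qed
      qed
      then show ?thesis
        using q(1) pos(2) C bC \<beta> by (intro exI[of _ "min q (\<rho> z)"] exI[of _ C]) auto
    qed
  qed
  from this[unfolded bchoice_iff] obtain \<sigma> C where \<sigma>C: "\<forall>z\<in>K. 0 < \<sigma> z \<and> \<sigma> z \<le> \<rho> z \<and> compact (C z) \<and> C z \<subseteq> B z \<and>
    (\<exists>\<beta>. lifts S0 (B z) (f z) 0 \<beta> \<and> bpt S0 \<notin> \<beta> ` C z) \<and> (\<forall>\<^sub>F A in nhds (mat 1). \<forall>z'\<in>H \<inter> ball z (\<sigma> z). g z (A *v d z') \<in> C z)"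
    by (elim exE) (rule that)
  obtain Z where Z: "finite Z" "Z \<subseteq> K" "K \<subseteq> (\<Union>z\<in>Z. ball z (\<sigma> z))"
    using finite_ball_cover[OF K(1), of \<sigma>] \<sigma>C by metis
  have \<sigma>\<rho>: "ball z (\<sigma> z) \<subseteq> ball z (\<rho> z)" if "z \<in> Z" for z using \<sigma>C Z(2) that by (intro subset_ball) blast
  then have Z\<rho>: "K \<subseteq> (\<Union>z\<in>Z. ball z (\<rho> z))" using Z(3) by blast
  have "\<forall>z\<in>K. \<exists>W :: 'a pointed_structure set set. openin immersive_topology_\<M> W \<and>
      (\<forall>P\<in>structures. iso_rel `` {P} \<in> W \<longleftrightarrow> (\<exists>\<beta>. lifts P (B z) (f z) 0 \<beta> \<and> bpt P \<notin> \<beta> ` C z))"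
  proof
    fix z assume z: "z \<in> K"
    then obtain \<Omega> where "disk_model \<Omega> (B z) (f z)" using t(1) by blast
    moreover have "compact (C z)" "C z \<subseteq> B z" using \<sigma>C z by auto
    ultimately show "\<exists>W :: 'a pointed_structure set set. openin immersive_topology_\<M> W \<and>
      (\<forall>P\<in>structures. iso_rel `` {P} \<in> W \<longleftrightarrow> (\<exists>\<beta>. lifts P (B z) (f z) 0 \<beta> \<and> bpt P \<notin> \<beta> ` C z))"
      using open_lifts_minus[OF S0] by metis
  qed
  from bchoice[OF this] obtain W :: "'k \<Rightarrow> 'a pointed_structure set set" where
    W: "\<forall>z\<in>K. openin immersive_topology_\<M> (W z) \<and> (\<forall>P\<in>structures. iso_rel `` {P} \<in> W z \<longleftrightarrow> (\<exists>\<beta>. lifts P (B z) (f z) 0 \<beta> \<and> bpt P \<notin> \<beta> ` C z))"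
    by blast
  obtain \<Omega>' where "disk_model \<Omega>' B' f'" using t(3) by blast
  from open_lifts[OF S0 this] obtain W' :: "'a pointed_structure set set" where
    W': "openin immersive_topology_\<M> W'" "\<And>P. P \<in> structures \<Longrightarrow> iso_rel `` {P} \<in> W' \<longleftrightarrow> (\<exists>\<beta>. lifts P B' f' 0 \<beta>)"
    by metis
  have "Z \<noteq> {}" using Z(3) K(3) by auto
  define V where "V = W' \<inter> (\<Inter>z\<in>Z. W z)"
  have oV: "openin immersive_topology_\<M> V"
    unfolding V_def using W W'(1) Z \<open>Z \<noteq> {}\<close> by (intro openin_Int openin_INT2) auto
  have S0V: "iso_rel `` {S0} \<in> V"
  proof -
    have "iso_rel `` {S0} \<in> W z" if "z \<in> K" for z
    proof -
      have "\<exists>\<beta>. lifts S0 (B z) (f z) 0 \<beta> \<and> bpt S0 \<notin> \<beta> ` C z" using bspec[OF \<sigma>C that] by blast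
      then show ?thesis using bspec[OF W that] S0 by simp
    qed
    moreover have "\<exists>\<beta>. lifts S0 B' f' 0 \<beta>" using t(4) by blast
    then have "iso_rel `` {S0} \<in> W'" using W'(2)[OF S0] by simp
    ultimately show ?thesis unfolding V_def using Z(2) by blast
  qed
  have "\<forall>\<^sub>F A in nhds (mat 1). \<forall>z\<in>Z. \<forall>z'\<in>H \<inter> ball z (\<sigma> z). g z (A *v d z') \<in> C z"
    using \<sigma>C Z(1,2) by (intro eventually_ball_finite) auto
  then have "\<forall>\<^sub>F A in nhds (mat 1). \<forall>P\<in>structures. iso_rel `` {P :: 'a pointed_structure} \<in> V \<longrightarrow>
       (\<exists>\<gamma>. lifts P K (\<lambda>z. A *v d z) z0 \<gamma> \<and> bpt P \<notin> \<gamma> ` H)"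
    using t(8)[OF Z(1,2) Z\<rho>]
  proof eventually_elim
    case (elim A)
    show ?case
    proof (intro impI ballI)
      fix P :: "'a pointed_structure" assume P: "P \<in> structures" "iso_rel `` {P} \<in> V"
      have "\<forall>z\<in>Z. \<exists>\<beta>. lifts P (B z) (f z) 0 \<beta> \<and> bpt P \<notin> \<beta> ` C z"
      proof
        fix z assume z: "z \<in> Z"
        then have "iso_rel `` {P} \<in> W z" "z \<in> K" using P(2) Z(2) unfolding V_def by blast+
        then show "\<exists>\<beta>. lifts P (B z) (f z) 0 \<beta> \<and> bpt P \<notin> \<beta> ` C z" using W P(1) by simp
      qed
      from bchoice[OF this] obtain \<beta> where \<beta>: "\<forall>z\<in>Z. lifts P (B z) (f z) 0 (\<beta> z) \<and> bpt P \<notin> \<beta> z ` C z" by blast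
      obtain \<beta>' where \<beta>': "lifts P B' f' 0 \<beta>'" using P(2) W'(2)[OF P(1)] unfolding V_def by blast
      have "\<forall>z\<in>Z. lifts P (B z) (f z) 0 (\<beta> z)" using \<beta> by blast
      with bspec[OF conjunct2[OF elim(2)] P(1)] \<beta>'
      obtain \<gamma> where \<gamma>: "lifts P K (\<lambda>z. A *v d z) z0 \<gamma>" "\<forall>z\<in>Z. \<forall>z'\<in>K \<inter> ball z (\<rho> z). \<gamma> z' = \<beta> z (g z (A *v d z'))"
        by blast
      have "\<gamma> z' \<noteq> bpt P" if z': "z' \<in> H" for z'
      proof -
        obtain z where z: "z \<in> Z" "z' \<in> ball z (\<sigma> z)" using Z(3) H(2) z' by blast
        then have "\<gamma> z' = \<beta> z (g z (A *v d z'))" using \<gamma>(2) H(2) z' \<sigma>\<rho>[OF z(1)] by blast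
        moreover have "g z (A *v d z') \<in> C z" using elim(1) z z' by blast
        ultimately show ?thesis using \<beta> z(1) by (metis imageI)
      qed
      then show "\<exists>\<gamma>. lifts P K (\<lambda>z. A *v d z) z0 \<gamma> \<and> bpt P \<notin> \<gamma> ` H" using \<gamma>(1) by (metis imageE)
    qed
  qed
  then show ?thesis by (rule that[OF oV S0V])
qed

section \<open>Open disks\<close>

text \<open>
  Invariance of domain, applied in charts. The definition of an open disk only gives a subset
  homeomorphic to a disk.
\<close>

lemma open_disk_openin:
  assumes R: "R \<in> structures" and U: "open_disk R U"
  shows "openin (surf R) U"
proof (subst openin_subopen, rule ballI)
  fix x assume x: "x \<in> U"
  have UR: "U \<subseteq> topspace (surf R)" using U path_connectedin_subset_topspace unfolding open_disk_def PC_def by blast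
  obtain k where k: "homeomorphic_map (subtopology (surf R) U) (top_of_set (ball (0::real^2) 1)) k"
    using U homeomorphic_space unfolding open_disk_def by blast
  obtain V \<phi> where V: "(V, \<phi>) \<in> charts R" "x \<in> V" "open (\<phi> ` V)"
    "homeomorphic_map (subtopology (surf R) V) (top_of_set (\<phi> ` V)) \<phi>"
    using chart_injective_near[OF R, of x] x UR by auto
  have oV: "openin (surf R) V" and VR: "V \<subseteq> topspace (surf R)"
    using chart_openin(1)[OF R V(1)] openin_subset by auto
  let ?W = "U \<inter> V"
  have k_top: "k ` U = ball 0 1" "inj_on k U"
    using homeomorphic_imp_surjective_map[OF k] homeomorphic_imp_injective_map[OF k] UR by (simp_all add: inf.absorb2)
  have \<phi>_inj: "inj_on \<phi> V" using homeomorphic_imp_injective_map[OF V(4)] VR by (simp add: inf.absorb2)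
  have "openin (subtopology (surf R) U) ?W" using oV by (auto simp: openin_subtopology)
  then have "openin (top_of_set (ball 0 1)) (k ` ?W)"
    using homeomorphic_map_openness[OF k, of ?W] UR by auto
  then have okW: "open (k ` ?W)" using openin_open_trans open_ball by blast
  obtain k' where k': "homeomorphic_maps (subtopology (surf R) U) (top_of_set (ball 0 1)) k k'"
    using k homeomorphic_map_maps by blast
  have k'k: "k' (k y) = y" if "y \<in> U" for y using k' that UR by (auto simp: homeomorphic_maps_def)
  have ck': "continuous_map (top_of_set (ball 0 1)) (surf R) k'"
    using k' by (auto simp: homeomorphic_maps_def continuous_map_in_subtopology)
  have im: "k' ` k ` ?W = ?W" using k'k by (force simp: image_image)
  have "k ` ?W \<subseteq> ball 0 1" using k_top by blast
  then have "continuous_map (top_of_set (k ` ?W)) (surf R) k'"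
    by (rule continuous_map_from_subtopology_mono[OF ck'])
  then have "continuous_map (top_of_set (k ` ?W)) (subtopology (surf R) V) k'"
    using im by (simp add: continuous_map_in_subtopology image_subset_iff_funcset[symmetric])
  moreover have "continuous_map (subtopology (surf R) V) euclidean \<phi>"
    using homeomorphic_imp_continuous_map[OF V(4)] by (simp add: continuous_map_in_subtopology)
  ultimately have "continuous_map (top_of_set (k ` ?W)) euclidean (\<phi> \<circ> k')"
    by (rule continuous_map_compose)
  then have cont: "continuous_on (k ` ?W) (\<phi> \<circ> k')" by simp
  have inj: "inj_on (\<phi> \<circ> k') (k ` ?W)"
  proof (rule inj_onI)
    fix a b assume "a \<in> k ` ?W" "b \<in> k ` ?W" and eq: "(\<phi> \<circ> k') a = (\<phi> \<circ> k') b"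
    then obtain p q where pq: "p \<in> ?W" "a = k p" "q \<in> ?W" "b = k q" by blast
    then have "\<phi> p = \<phi> q" using eq k'k by simp
    then show "a = b" using pq inj_onD[OF \<phi>_inj] by blast
  qed
  have "open ((\<phi> \<circ> k') ` k ` ?W)" by (rule invariance_of_domain_gen[OF okW cont inj]) simp
  moreover have "(\<phi> \<circ> k') ` k ` ?W = \<phi> ` ?W" using im by (simp only: image_comp[symmetric])
  ultimately have "openin (top_of_set (\<phi> ` V)) (\<phi> ` ?W)" by (metis Int_lower2 image_mono open_subset)
  then have "openin (subtopology (surf R) V) ?W"
    using homeomorphic_map_openness[OF V(4), of ?W] VR by auto
  then have "openin (surf R) ?W" using oV openin_trans_full by blast
  then show "\<exists>T. openin (surf R) T \<and> x \<in> T \<and> T \<subseteq> U" using x V(2) by blast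
qed

text \<open>
  The open unit ball is not compact, so objects on it are glued from objects on the
  smaller balls, which are unique and hence fit together. This serves for developed maps
  (\<open>develops_exists_ball\<close>) and for lifts (\<open>lifts_ball_exhaustion\<close>).
\<close>

lemma ball_exhaustion_glue:
  fixes Q :: "real \<Rightarrow> ('k::real_normed_vector \<Rightarrow> 'b) \<Rightarrow> bool"
  assumes r0: "r0 < 1" and ex: "\<forall>r\<in>{r0<..<1}. \<exists>g. Q r g"
    and agree': "\<forall>r s g g' x. r0 < r \<longrightarrow> r \<le> s \<longrightarrow> s < 1 \<longrightarrow> Q r g \<longrightarrow> Q s g' \<longrightarrow> norm x < r \<longrightarrow> g x = g' x"
  obtains g where "\<forall>r\<in>{r0<..<1}. \<exists>g'. Q r g' \<and> (\<forall>x. norm x < r \<longrightarrow> g x = g' x)"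
proof -
  have agree: "g x = g' x" if "r0 < r" "r \<le> s" "s < 1" "Q r g" "Q s g'" "norm x < r" for r s g g' x
    using agree' that by blast
  from bchoice[OF ex] obtain G where G: "\<forall>r\<in>{r0<..<1}. Q r (G r)" by blast
  define R where "R = (\<lambda>x::'k. (max (norm x) r0 + 1) / 2)"
  have R: "norm x < R x" "R x \<in> {r0<..<1}" if "norm x < 1" for x
    using that r0 by (auto simp: R_def max_def)
  have "G (R x) x = G r x" if "r0 < r" "r < 1" "norm x < r" for r x
  proof -
    have x: "norm x < R x" "R x \<in> {r0<..<1}" using R[of x] that by auto
    have Q: "Q r (G r)" "Q (R x) (G (R x))" using G x that by auto
    show ?thesis
    proof (cases "r \<le> R x")
      case True
      then show ?thesis using agree[OF that(1) True _ Q that(3)] x by simp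
    next
      case False
      then show ?thesis using agree[of "R x" r "G (R x)" "G r" x] Q x that by simp
    qed
  qed
  then have "\<forall>r\<in>{r0<..<1}. \<exists>g'. Q r g' \<and> (\<forall>x. norm x < r \<longrightarrow> G (R x) x = g' x)"
    using G by (metis greaterThanLessThan_iff)
  then show ?thesis by (rule that)
qed

lemma develops_exists_ball:
  fixes h :: "'k::euclidean_space \<Rightarrow> 'a"
  assumes R: "R \<in> structures" and h: "continuous_map (top_of_set (ball (0::'k) 1)) (surf R) h" and z0: "z0 \<in> ball 0 1"
  obtains d where "develops R (ball 0 1) h d" "d z0 = 0"
proof -
  define Q where "Q = (\<lambda>r d. develops R (cball 0 r) h d \<and> d z0 = 0)"
  have z01: "norm z0 < 1" using z0 by simp
  have ex: "\<exists>d. Q r d" if r: "norm z0 < r" "r < 1" for r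
  proof -
    have "cball (0::'k) r \<subseteq> ball 0 1" using r by auto
    then have "continuous_map (top_of_set (cball 0 r)) (surf R) h" by (rule continuous_map_from_subtopology_mono[OF h])
    then obtain d where "develops R (cball 0 r) h d" "d z0 = 0"
      using develops_exists[OF R compact_cball convex_cball, of z0 0 r h] r by auto
    then show ?thesis unfolding Q_def by blast
  qed
  have agree: "g x = g' x" if "norm z0 < r" "r \<le> s" "s < 1" "Q r g" "Q s g'" "norm x < r" for r s g g' x
  proof -
    have "develops R (cball 0 r) h g'" using that(5) develops_subset subset_cball[OF that(2)] unfolding Q_def by blast
    then show ?thesis
      using developed_map_unique[OF R convex_connected[OF convex_cball], of 0 r h g g' z0 x] that(1,4,5,6) by (simp add: Q_def)
  qed
  have ex': "\<forall>r\<in>{norm z0<..<1}. \<exists>d. Q r d" using ex by simp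
  have agree': "\<forall>r s g g' x. norm z0 < r \<longrightarrow> r \<le> s \<longrightarrow> s < 1 \<longrightarrow> Q r g \<longrightarrow> Q s g' \<longrightarrow> norm x < r \<longrightarrow> g x = g' x"
    by (intro allI impI) (rule agree)
  obtain d where "\<forall>r\<in>{norm z0<..<1}. \<exists>g'. Q r g' \<and> (\<forall>x. norm x < r \<longrightarrow> d x = g' x)"
    by (rule ball_exhaustion_glue[OF z01 ex' agree'])
  then have d: "\<And>r. norm z0 < r \<Longrightarrow> r < 1 \<Longrightarrow> \<exists>g'. Q r g' \<and> (\<forall>x. norm x < r \<longrightarrow> d x = g' x)" by simp
  have "develops R (ball 0 1) h d"
  proof (rule develops_local)
    fix x :: 'k assume x: "x \<in> ball 0 1"
    define r where "r = (max (norm x) (norm z0) + 1) / 2"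
    have r: "norm x < r" "norm z0 < r" "r < 1" using x z01 by (auto simp: r_def max_def)
    obtain g' where g': "Q r g'" "\<forall>x. norm x < r \<longrightarrow> d x = g' x" using d r by blast
    have "develops R (cball 0 r) h g'" using g'(1) by (simp add: Q_def)
    then have "develops R (ball 0 1 \<inter> ball 0 r) h g'" by (rule develops_subset) auto
    then have "develops R (ball 0 1 \<inter> ball 0 r) h d"
      by (rule develops_cong[where v = 0]) (use g'(2) in auto)
    then show "\<exists>N. open N \<and> x \<in> N \<and> develops R (ball 0 1 \<inter> N) h d"
      using r(1) by (intro exI[of _ "ball 0 r"]) auto
  qed
  moreover have "d z0 = 0"
  proof -
    define r where "r = (norm z0 + 1) / 2"
    have r: "norm z0 < r" "r < 1" using z01 by (auto simp: r_def)
    obtain g' where "Q r g'" "\<forall>x. norm x < r \<longrightarrow> d x = g' x" using d r by blast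
    then show ?thesis using r by (simp add: Q_def)
  qed
  ultimately show ?thesis by (rule that)
qed

lemma open_disk_parametrization:
  assumes R: "R \<in> structures" and U: "open_disk R U"
  obtains h k d z0 where "parametrizes R U (ball (0::real^2) 1) h k d z0" "d z0 = 0"
proof -
  have PC: "U \<in> PC R" using U by (simp add: open_disk_def)
  then have UR: "U \<subseteq> topspace (surf R)" and o: "bpt R \<in> U"
    using path_connectedin_subset_topspace unfolding PC_def by blast+
  have "subtopology (surf R) U homeomorphic_space top_of_set (ball (0::real^2) 1)"
    using U by (simp add: open_disk_def)
  then have "top_of_set (ball (0::real^2) 1) homeomorphic_space subtopology (surf R) U"
    by (rule homeomorphic_space_sym[THEN iffD1])
  then obtain h k where hk: "homeomorphic_maps (top_of_set (ball (0::real^2) 1)) (subtopology (surf R) U) h k"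
    unfolding homeomorphic_space_def by blast
  then have c: "continuous_map (top_of_set (ball 0 1)) (surf R) h" "continuous_map (subtopology (surf R) U) (top_of_set (ball 0 1)) k"
    "\<forall>s\<in>U. h (k s) = s"
    using UR unfolding homeomorphic_maps_def by (simp_all add: continuous_map_in_subtopology[of _ "surf R"] inf.absorb2)
  have "k ` U \<subseteq> ball 0 1" using continuous_map_image_subset_topspace[OF c(2)] UR by (simp add: inf.absorb2)
  then have z0: "k (bpt R) \<in> ball 0 1" using o by blast
  have hz0: "h (k (bpt R)) = bpt R" using c(3) o by blast
  obtain d where d: "develops R (ball 0 1) h d" "d (k (bpt R)) = 0"
    by (rule develops_exists_ball[OF R c(1) z0])
  have "parametrizes R U (ball 0 1) h k d (k (bpt R))"
    unfolding parametrizes_def using R PC hk d z0 hz0 by blast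
  then show ?thesis using that d(2) by blast
qed

lemma parametrizes_subdisk:
  fixes K :: "'k::topological_space set"
  assumes p: "parametrizes R D K h k d z0" and L: "L \<subseteq> K" "path_connected L" "z0 \<in> L"
  shows "parametrizes R (h ` L) L h k d z0"
proof -
  note q = parametrizesD[OF p]
  have hL: "h ` L \<subseteq> D" using q(10) L(1) by blast
  have "homeomorphic_maps (subtopology (top_of_set K) L) (subtopology (subtopology (surf R) D) (h ` L)) h k"
    by (rule homeomorphic_maps_subtopologies[OF q(3)]) (use L(1) hL q(7) in auto)
  moreover have "subtopology (top_of_set K) L = top_of_set L" using L(1) by (simp add: subtopology_subtopology inf.absorb2)
  moreover have "subtopology (subtopology (surf R) D) (h ` L) = subtopology (surf R) (h ` L)"
    using hL by (simp add: subtopology_subtopology inf.absorb2)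
  ultimately have hm: "homeomorphic_maps (top_of_set L) (subtopology (surf R) (h ` L)) h k" by simp
  have "path_connectedin (surf R) (h ` L)"
    by (rule path_connectedin_continuous_map_image[OF develops_continuous_map[OF q(4)]])
       (use L in \<open>simp add: path_connectedin_subtopology\<close>)
  then have "h ` L \<in> PC R" using L(3) q(6) by (auto simp: PC_def intro: image_eqI[of _ h z0])
  then show ?thesis
    using q(1,6) hm develops_subset[OF q(4) L(1)] L(3) by (simp add: parametrizes_def)
qed

lemma lifts_ball_exhaustion:
  fixes z0 :: "'k::real_normed_vector"
  assumes S: "S \<in> structures" and z0: "norm z0 < 1"
    and ex: "\<And>r. norm z0 < r \<Longrightarrow> r < 1 \<Longrightarrow> \<exists>\<gamma>. lifts S (ball 0 r) d z0 \<gamma>"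
  shows "\<exists>\<gamma>. lifts S (ball 0 1) d z0 \<gamma>"
proof -
  have agree: "g x = g' x" if "norm z0 < r" "r \<le> s" "s < 1" "lifts S (ball 0 r) d z0 g" "lifts S (ball 0 s) d z0 g'" "norm x < r" for r s g g' x
  proof -
    have "lifts S (ball 0 r) d z0 g'" by (rule lifts_subset[OF that(5) subset_ball[OF that(2)]])
    then show ?thesis
      using lifts_unique[OF S connected_ball, of z0 0 r d g g' x] that by simp
  qed
  have ex': "\<forall>r\<in>{norm z0<..<1}. \<exists>\<gamma>. lifts S (ball 0 r) d z0 \<gamma>" using ex by simp
  have agree': "\<forall>r s g g' x. norm z0 < r \<longrightarrow> r \<le> s \<longrightarrow> s < 1 \<longrightarrow> lifts S (ball 0 r) d z0 g \<longrightarrow>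
      lifts S (ball 0 s) d z0 g' \<longrightarrow> norm x < r \<longrightarrow> g x = g' x"
    by (intro allI impI) (rule agree)
  obtain \<gamma> where "\<forall>r\<in>{norm z0<..<1}. \<exists>g'. lifts S (ball 0 r) d z0 g' \<and> (\<forall>x. norm x < r \<longrightarrow> \<gamma> x = g' x)"
    by (rule ball_exhaustion_glue[OF z0 ex' agree'])
  then have \<gamma>: "\<And>r. norm z0 < r \<Longrightarrow> r < 1 \<Longrightarrow> \<exists>g'. lifts S (ball 0 r) d z0 g' \<and> (\<forall>x. norm x < r \<longrightarrow> \<gamma> x = g' x)" by simp
  have "develops S (ball 0 1) \<gamma> d"
  proof (rule develops_local)
    fix x :: 'k assume x: "x \<in> ball 0 1"
    define r where "r = (max (norm x) (norm z0) + 1) / 2"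
    have r: "norm x < r" "norm z0 < r" "r < 1" using x z0 by (auto simp: r_def max_def)
    obtain g' where g': "lifts S (ball 0 r) d z0 g'" "\<forall>x. norm x < r \<longrightarrow> \<gamma> x = g' x" using \<gamma> r by blast
    have "develops S (ball 0 1 \<inter> ball 0 r) g' d"
      using g'(1) develops_subset[of S "ball 0 r" g' d] by (auto simp: lifts_def)
    then have "develops S (ball 0 1 \<inter> ball 0 r) \<gamma> d"
      by (rule develops_cong[where v = 0]) (use g'(2) in auto)
    then show "\<exists>N. open N \<and> x \<in> N \<and> develops S (ball 0 1 \<inter> N) \<gamma> d"
      using r(1) by (intro exI[of _ "ball 0 r"]) auto
  qed
  moreover have "\<gamma> z0 = bpt S"
  proof -
    define r where "r = (norm z0 + 1) / 2"
    have r: "norm z0 < r" "r < 1" using z0 by (auto simp: r_def)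
    obtain g' where "lifts S (ball 0 r) d z0 g'" "\<forall>x. norm x < r \<longrightarrow> \<gamma> x = g' x" using \<gamma> r by blast
    then show ?thesis using r by (simp add: lifts_def)
  qed
  ultimately show ?thesis unfolding lifts_def by blast
qed

text \<open>
  If all smaller concentric disks immersed in \<open>S0\<close>, then so would \<open>U\<close>. Hence some smaller disk \<open>U'\<close>
  does not immerse, and this defines the neighbourhood \<open>V\<close>. Tubes covering the closure
  of \<open>U'\<close> can be chosen to immerse into \<open>U\<close>. An immersion of \<open>U\<close> in \<open>A P\<close> carries them to \<open>A P\<close>, so
  \<open>A d\<close> lifts to \<open>A P\<close> over the closure of \<open>U'\<close>; that is, \<open>d\<close> lifts to \<open>P\<close>.
\<close>

lemma near_id_not_immerses:
  assumes R: "(R :: 'a pointed_structure) \<in> structures" and U: "open_disk R U"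
    and S0: "S0 \<in> structures" "\<not> immerses R U (iso_rel `` {S0})"
  obtains V where "openin immersive_topology_\<M> V" "iso_rel `` {S0} \<in> V"
    "\<forall>\<^sub>F A in nhds (mat 1). invertible A \<longrightarrow>
       (\<forall>P\<in>structures. iso_rel `` {P} \<in> V \<longrightarrow> \<not> immerses R U (iso_rel `` {act A P}))"
proof -
  obtain h k d z0 where p: "parametrizes R U (ball (0::real^2) 1) h k d z0" and d0: "d z0 = 0"
    by (rule open_disk_parametrization[OF R U])
  note q = parametrizesD[OF p]
  have z0: "norm z0 < 1" using q(5) by simp
  have "\<nexists>\<gamma>. lifts S0 (ball 0 1) d z0 \<gamma>" using S0 immerses_iff[OF p] by blast
  then obtain r where r: "norm z0 < r" "r < 1" "\<nexists>\<gamma>. lifts S0 (ball 0 r) d z0 \<gamma>"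
    using lifts_ball_exhaustion[OF S0(1) z0] by blast
  have sub: "ball (0::real^2) r \<subseteq> ball 0 1" "cball (0::real^2) r \<subseteq> ball 0 1" using r(2) by auto
  have z0r: "z0 \<in> ball 0 r" "z0 \<in> cball 0 r" using r(1) by auto
  let ?U' = "h ` ball 0 r"
  have p': "parametrizes R ?U' (ball 0 r) h k d z0"
    by (rule parametrizes_subdisk[OF p sub(1) convex_imp_path_connected[OF convex_ball] z0r(1)])
  have "open_disk R ?U'"
    unfolding open_disk_def
  proof
    show "?U' \<in> PC R" using parametrizesD(2)[OF p'] .
    have "r > 0" using r(1) by (rule le_less_trans[OF norm_ge_zero])
    then have "ball (0::real^2) r homeomorphic ball (0::real^2) 1" by (intro homeomorphic_balls) auto
    then obtain a b where "homeomorphism (ball (0::real^2) r) (ball (0::real^2) 1) a b" unfolding homeomorphic_def by blast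
    then have "top_of_set (ball (0::real^2) r) homeomorphic_space top_of_set (ball (0::real^2) 1)"
      using homeomorphism_imp_homeomorphic_maps unfolding homeomorphic_space_def by blast
    moreover have "subtopology (surf R) ?U' homeomorphic_space top_of_set (ball (0::real^2) r)"
      using parametrizesD(3)[OF p'] homeomorphic_maps_sym unfolding homeomorphic_space_def by blast
    ultimately show "subtopology (surf R) ?U' homeomorphic_space top_of_set (ball (0::real^2) 1)"
      by (rule homeomorphic_space_trans[rotated])
  qed
  from open_disk_subbasis_open[OF R this] have oV: "openin immersive_topology_\<M> {c \<in> \<M>. \<not> immerses R ?U' c}" .
  have S0V: "iso_rel `` {S0} \<in> {c \<in> \<M>. \<not> immerses R ?U' c}"
    using class_in_\<M>[OF S0(1)] immerses_iff[OF p' S0(1)] r(3) by simp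
  have lh: "lifts R (cball 0 r) d z0 h"
    using develops_subset[OF q(4) sub(2)] q(6) by (simp add: lifts_def)
  have oU: "openin (surf R) U" by (rule open_disk_openin[OF R U])
  have hU: "h ` cball 0 r \<subseteq> U" using q(10) sub(2) by blast
  obtain B f \<epsilon> \<rho> g B' f' where tc: "tube_cover R U (cball 0 r) d z0 B f \<epsilon> \<rho> g B' f'"
    by (rule tube_cover_exists[OF R compact_cball convex_cball z0r(2) lh d0 oU hU])
  note t = tube_coverD[OF tc]
  obtain Z where Z: "finite Z" "Z \<subseteq> cball 0 r" "cball 0 r \<subseteq> (\<Union>z\<in>Z. ball z (\<rho> z))"
    using finite_ball_cover[OF compact_cball, of 0 r \<rho>] t(5) by metis
  have "\<forall>z\<in>Z. \<exists>\<beta>. lifts R (B z) (f z) 0 \<beta> \<and> \<beta> ` B z \<subseteq> U" using t(2) Z(2) by blast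
  from bchoice[OF this] obtain \<beta> where \<beta>: "\<forall>z\<in>Z. lifts R (B z) (f z) 0 (\<beta> z) \<and> \<beta> z ` B z \<subseteq> U" by blast
  obtain \<beta>' where \<beta>': "lifts R B' f' 0 \<beta>'" "\<beta>' ` B' \<subseteq> U" using t(4) by blast
  have "\<forall>\<^sub>F A in nhds (mat 1). invertible A \<longrightarrow>
       (\<forall>P\<in>structures. iso_rel `` {P} \<in> {c \<in> \<M>. \<not> immerses R ?U' c} \<longrightarrow> \<not> immerses R U (iso_rel `` {act A P}))"
    using t(8)[OF Z]
  proof eventually_elim
    case (elim A)
    show ?case
    proof (intro impI ballI notI)
      fix P :: "'a pointed_structure"
      assume A: "invertible A" and P: "P \<in> structures" and PV: "iso_rel `` {P} \<in> {c \<in> \<M>. \<not> immerses R ?U' c}"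
        and im: "immerses R U (iso_rel `` {act A P})"
      let ?Q = "act A P"
      have Q: "?Q \<in> structures" by (rule act_structures[OF A P])
      obtain \<gamma>1 where "lifts ?Q (ball 0 1) d z0 \<gamma>1" using immerses_iff[OF p Q] im by blast
      from lifts_immersion[OF p Q this] have i: "is_immersion R U ?Q (topspace (surf ?Q)) (\<lambda>s. \<gamma>1 (k s))" .
      \<comment> \<open>Whatever lifts into the part \<open>U\<close> of \<open>R\<close> is carried to \<open>A P\<close> by the immersion of \<open>U\<close>.\<close>
      have comp: "lifts ?Q C e 0 (\<lambda>w. \<gamma>1 (k (b w)))" if "lifts R C e 0 b" "b ` C \<subseteq> U"
        for C and e :: "complex \<Rightarrow> real^2" and b
        using develops_immersion(1,3)[OF R Q i _ that(2), of e] that(1) by (simp add: lifts_def)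
      have "\<forall>z\<in>Z. lifts ?Q (B z) (f z) 0 (\<lambda>w. \<gamma>1 (k (\<beta> z w)))" using comp \<beta> by blast
      from mp[OF mp[OF spec[OF spec[OF bspec[OF conjunct2[OF elim] Q], of "\<lambda>z w. \<gamma>1 (k (\<beta> z w))"],
            of "\<lambda>w. \<gamma>1 (k (\<beta>' w))"] this] comp[OF \<beta>']]
      obtain \<gamma> where "lifts ?Q (cball 0 r) (\<lambda>z. A *v d z) z0 \<gamma>" by blast
      then have "lifts P (cball 0 r) d z0 \<gamma>" by (simp add: lifts_act_iff[OF A P] matrix_inv_works(4)[OF A])
      then have "lifts P (ball 0 r) d z0 \<gamma>" by (rule lifts_subset) auto
      then show False using PV immerses_iff[OF p' P] by blast
    qed
  qed
  then show ?thesis by (rule that[OF oV S0V])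
qed

section \<open>Subbasic sets near the identity\<close>

lemma near_id_immerses:
  assumes R: "(R :: 'a pointed_structure) \<in> structures" and D: "closed_disk R D"
    and S0: "S0 \<in> structures" "immerses R D (iso_rel `` {S0})"
  obtains V where "openin immersive_topology_\<M> V" "iso_rel `` {S0} \<in> V"
    "\<forall>\<^sub>F A in nhds (mat 1). invertible A \<longrightarrow> (\<forall>P\<in>structures. iso_rel `` {P} \<in> V \<longrightarrow> immerses R D (iso_rel `` {act A P}))"
proof -
  obtain h k d z0 where p: "parametrizes R D (cball (0::real^2) 1) h k d z0" and d0: "d z0 = 0"
    by (rule closed_disk_parametrization[OF R D])
  obtain \<gamma>0 where \<gamma>0: "lifts S0 (cball 0 1) d z0 \<gamma>0" using S0 immerses_iff[OF p] by blast
  obtain V where V: "openin immersive_topology_\<M> V" "iso_rel `` {S0} \<in> V"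
    "\<forall>\<^sub>F A in nhds (mat 1). \<forall>P\<in>structures. iso_rel `` {P :: 'a pointed_structure} \<in> V \<longrightarrow>
       (\<exists>\<gamma>. lifts P (cball 0 1) (\<lambda>z. A *v d z) z0 \<gamma> \<and> bpt P \<notin> \<gamma> ` {})"
    by (rule near_id_lifts_avoiding[OF S0(1) compact_cball convex_cball parametrizesD(5)[OF p] \<gamma>0 d0, where H = "{}"]) auto
  have "\<forall>\<^sub>F A in nhds (mat 1). invertible A \<longrightarrow> (\<forall>P\<in>structures. iso_rel `` {P} \<in> V \<longrightarrow> immerses R D (iso_rel `` {act A P}))"
    using eventually_matrix_inv[OF V(3)]
  proof eventually_elim
    case (elim A)
    show ?case
    proof (intro impI ballI)
      fix P :: "'a pointed_structure" assume A: "invertible A" and P: "P \<in> structures" "iso_rel `` {P} \<in> V"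
      obtain \<gamma> where "lifts P (cball 0 1) (\<lambda>z. matrix_inv A *v d z) z0 \<gamma>" using elim A P by blast
      then have "lifts (act A P) (cball 0 1) d z0 \<gamma>" by (simp add: lifts_act_iff[OF A P(1)])
      then show "immerses R D (iso_rel `` {act A P})" using immerses_iff[OF p act_structures[OF A P(1)]] by blast
    qed
  qed
  then show ?thesis by (rule that[OF V(1,2)])
qed

lemma near_id_\<M>_minus:
  assumes R: "(R :: 'a pointed_structure) \<in> structures" and D: "closed_disk R D" and C: "closedin (surf R) C" "C \<subseteq> D"
    and S0: "S0 \<in> structures" "iso_rel `` {S0} \<in> \<M>_minus R D C"
  obtains V where "openin immersive_topology_\<M> V" "iso_rel `` {S0} \<in> V"
    "\<forall>\<^sub>F A in nhds (mat 1). invertible A \<longrightarrow> (\<forall>P\<in>structures. iso_rel `` {P} \<in> V \<longrightarrow> iso_rel `` {act A P} \<in> \<M>_minus R D C)"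
proof -
  obtain h k d z0 where p: "parametrizes R D (cball (0::real^2) 1) h k d z0" and d0: "d z0 = 0"
    by (rule closed_disk_parametrization[OF R D])
  define H where "H = {z \<in> cball (0::real^2) 1. h z \<in> C}"
  have "closedin (top_of_set (cball 0 1)) H"
    using closedin_continuous_map_preimage[OF develops_continuous_map[OF parametrizesD(4)[OF p]] C(1)] by (simp add: H_def)
  then have H: "closed H" "H \<subseteq> cball 0 1" using closedin_closed_trans closed_cball by (blast, auto simp: H_def)
  obtain \<gamma>0 where \<gamma>0: "lifts S0 (cball 0 1) d z0 \<gamma>0" "bpt S0 \<notin> \<gamma>0 ` H"
    using S0(2) \<M>_minus_iff[OF p S0(1) C(2)] unfolding H_def by blast
  obtain V where V: "openin immersive_topology_\<M> V" "iso_rel `` {S0} \<in> V"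
    "\<forall>\<^sub>F A in nhds (mat 1). \<forall>P\<in>structures. iso_rel `` {P :: 'a pointed_structure} \<in> V \<longrightarrow>
       (\<exists>\<gamma>. lifts P (cball 0 1) (\<lambda>z. A *v d z) z0 \<gamma> \<and> bpt P \<notin> \<gamma> ` H)"
    by (rule near_id_lifts_avoiding[OF S0(1) compact_cball convex_cball parametrizesD(5)[OF p] \<gamma>0(1) d0 H \<gamma>0(2)])
  have "\<forall>\<^sub>F A in nhds (mat 1). invertible A \<longrightarrow> (\<forall>P\<in>structures. iso_rel `` {P} \<in> V \<longrightarrow> iso_rel `` {act A P} \<in> \<M>_minus R D C)"
    using eventually_matrix_inv[OF V(3)]
  proof eventually_elim
    case (elim A)
    show ?case
    proof (intro impI ballI)
      fix P :: "'a pointed_structure" assume A: "invertible A" and P: "P \<in> structures" "iso_rel `` {P} \<in> V"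
      obtain \<gamma> where "lifts P (cball 0 1) (\<lambda>z. matrix_inv A *v d z) z0 \<gamma>" "bpt P \<notin> \<gamma> ` H" using elim A P by blast
      then have "lifts (act A P) (cball 0 1) d z0 \<gamma>" "bpt (act A P) \<notin> \<gamma> ` H" by (simp_all add: lifts_act_iff[OF A P(1)])
      then show "iso_rel `` {act A P} \<in> \<M>_minus R D C"
        using \<M>_minus_iff[OF p act_structures[OF A P(1)] C(2)] unfolding H_def by blast
    qed
  qed
  then show ?thesis by (rule that[OF V(1,2)])
qed

lemma near_id_plus:
  assumes p: "parametrizes R D (cball (0::real^2) 1) h k d z0" and d0: "d z0 = 0"
    and U: "openin (surf R) U" "U \<subseteq> surf R interior_of D"
    and S0: "(S0 :: 'a pointed_structure) \<in> structures" and \<gamma>0: "lifts S0 (cball 0 1) d z0 \<gamma>0"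
    and x0: "x0 \<in> \<gamma>0 ` {z \<in> cball 0 1. h z \<in> U}"
  obtains V \<Omega> B f U' where "openin immersive_topology_\<M> V" "iso_rel `` {S0} \<in> V"
    "disk_model \<Omega> B f" "open U'" "U' \<subseteq> B" "\<exists>\<beta>. lifts S0 B f 0 \<beta> \<and> x0 \<in> \<beta> ` U'"
    "\<forall>\<^sub>F A in nhds (mat 1). invertible A \<longrightarrow> (\<forall>P\<in>structures. \<forall>x. iso_rel `` {P :: 'a pointed_structure} \<in> V \<longrightarrow>
       (\<exists>\<beta>. lifts P B f 0 \<beta> \<and> x \<in> \<beta> ` U') \<longrightarrow>
       (\<exists>\<gamma>. lifts (act A P) (cball 0 1) d z0 \<gamma> \<and> x \<in> \<gamma> ` {z \<in> cball 0 1. h z \<in> U}))"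
proof -
  have UD: "U \<subseteq> D" by (rule order_trans[OF U(2) interior_of_subset])
  let ?L = "{z \<in> cball 0 1. h z \<in> U}"
  obtain u where u: "u \<in> ?L" "x0 = \<gamma>0 u" using x0 by blast
  have N: "\<exists>e>0. ball (d u) e \<subseteq> d ` (?L \<inter> N)" if oN: "open N" "u \<in> N" for N
  proof -
    obtain e where "e > 0" "ball (d u) e \<subseteq> d ` {y \<in> cball 0 1 \<inter> N. h y \<in> U}"
      by (rule developed_map_open[OF p U(1) UD _ _ oN]) (use u in auto)
    moreover have "{y \<in> cball 0 1 \<inter> N. h y \<in> U} = ?L \<inter> N" by auto
    ultimately show ?thesis by metis
  qed
  obtain V \<Omega> B f U' where V: "openin immersive_topology_\<M> V" "iso_rel `` {S0} \<in> V"
    "disk_model \<Omega> B f" "open U'" "U' \<subseteq> B" "\<exists>\<beta>. lifts S0 B f 0 \<beta> \<and> \<gamma>0 u \<in> \<beta> ` U'"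
    "\<forall>\<^sub>F A in nhds (mat 1). invertible A \<longrightarrow> (\<forall>P\<in>structures. \<forall>x. iso_rel `` {P :: 'a pointed_structure} \<in> V \<longrightarrow>
       (\<exists>\<beta>. lifts P B f 0 \<beta> \<and> x \<in> \<beta> ` U') \<longrightarrow> (\<exists>\<gamma>. lifts P (cball 0 1) (\<lambda>z. A *v d z) z0 \<gamma> \<and> x \<in> \<gamma> ` ?L))"
    by (rule near_id_lifts_at[OF S0 compact_cball convex_cball parametrizesD(5)[OF p] \<gamma>0 d0 _ N]) (use u in auto)
  have "\<forall>\<^sub>F A in nhds (mat 1). invertible A \<longrightarrow> (\<forall>P\<in>structures. \<forall>x. iso_rel `` {P :: 'a pointed_structure} \<in> V \<longrightarrow>
       (\<exists>\<beta>. lifts P B f 0 \<beta> \<and> x \<in> \<beta> ` U') \<longrightarrow> (\<exists>\<gamma>. lifts (act A P) (cball 0 1) d z0 \<gamma> \<and> x \<in> \<gamma> ` ?L))"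
    using eventually_matrix_inv[OF V(7)]
    by eventually_elim (simp add: lifts_act_iff matrix_inv_works(5))
  then show ?thesis using that[OF V(1-5)] V(6) u(2) by blast
qed

lemma near_id_\<M>_plus:
  assumes R: "(R :: 'a pointed_structure) \<in> structures" and D: "closed_disk R D"
    and U: "openin (surf R) U" "U \<subseteq> surf R interior_of D"
    and S0: "S0 \<in> structures" "iso_rel `` {S0} \<in> \<M>_plus R D U"
  obtains V where "openin immersive_topology_\<M> V" "iso_rel `` {S0} \<in> V"
    "\<forall>\<^sub>F A in nhds (mat 1). invertible A \<longrightarrow> (\<forall>P\<in>structures. iso_rel `` {P} \<in> V \<longrightarrow> iso_rel `` {act A P} \<in> \<M>_plus R D U)"
proof -
  have UD: "U \<subseteq> D" by (rule order_trans[OF U(2) interior_of_subset])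
  obtain h k d z0 where p: "parametrizes R D (cball (0::real^2) 1) h k d z0" and d0: "d z0 = 0"
    by (rule closed_disk_parametrization[OF R D])
  obtain \<gamma>0 where \<gamma>0: "lifts S0 (cball 0 1) d z0 \<gamma>0" "bpt S0 \<in> \<gamma>0 ` {z \<in> cball 0 1. h z \<in> U}"
    using S0(2) \<M>_plus_iff[OF p S0(1) UD] by blast
  \<comment> \<open>The point to be hit is the basepoint of the surface, which \<open>A\<close> does not move.\<close>
  obtain V \<Omega> B f U' where V: "openin immersive_topology_\<M> V" "iso_rel `` {S0} \<in> V"
    "disk_model \<Omega> B f" "open U'" "U' \<subseteq> B" "\<exists>\<beta>. lifts S0 B f 0 \<beta> \<and> bpt S0 \<in> \<beta> ` U'"
    "\<forall>\<^sub>F A in nhds (mat 1). invertible A \<longrightarrow> (\<forall>P\<in>structures. \<forall>x. iso_rel `` {P :: 'a pointed_structure} \<in> V \<longrightarrow>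
       (\<exists>\<beta>. lifts P B f 0 \<beta> \<and> x \<in> \<beta> ` U') \<longrightarrow>
       (\<exists>\<gamma>. lifts (act A P) (cball 0 1) d z0 \<gamma> \<and> x \<in> \<gamma> ` {z \<in> cball 0 1. h z \<in> U}))"
    by (rule near_id_plus[OF p d0 U S0(1) \<gamma>0])
  obtain W :: "'a pointed_structure set set" where W: "openin immersive_topology_\<M> W"
    "\<And>P. P \<in> structures \<Longrightarrow> iso_rel `` {P} \<in> W \<longleftrightarrow> (\<exists>\<beta>. lifts P B f 0 \<beta> \<and> bpt P \<in> \<beta> ` U')"
    using open_lifts_plus[OF S0(1) V(3-5)] by metis
  have "openin immersive_topology_\<M> (V \<inter> W)" "iso_rel `` {S0} \<in> V \<inter> W"
    using V(1,2,6) W(1) W(2)[OF S0(1)] by auto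
  moreover have "\<forall>\<^sub>F A in nhds (mat 1). invertible A \<longrightarrow> (\<forall>P\<in>structures. iso_rel `` {P} \<in> V \<inter> W \<longrightarrow> iso_rel `` {act A P} \<in> \<M>_plus R D U)"
    using V(7)
  proof eventually_elim
    case (elim A)
    show ?case
    proof (intro impI ballI)
      fix P :: "'a pointed_structure" assume A: "invertible A" and P: "P \<in> structures" "iso_rel `` {P} \<in> V \<inter> W"
      have "\<exists>\<beta>. lifts P B f 0 \<beta> \<and> bpt P \<in> \<beta> ` U'" using W(2)[OF P(1)] P(2) by blast
      then have "\<exists>\<gamma>. lifts (act A P) (cball 0 1) d z0 \<gamma> \<and> bpt P \<in> \<gamma> ` {z \<in> cball 0 1. h z \<in> U}"
        using elim A P by blast
      then show "iso_rel `` {act A P} \<in> \<M>_plus R D U"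
        using \<M>_plus_iff[OF p act_structures[OF A P(1)] UD] by simp
    qed
  qed
  ultimately show ?thesis by (rule that)
qed

lemma near_id_\<E>_plus:
  assumes R: "(R :: 'a pointed_structure) \<in> structures" and D: "closed_disk R D"
    and U: "openin (surf R) U" "U \<subseteq> surf R interior_of D"
    and S0: "S0 \<in> structures" "x0 \<in> topspace (surf S0)" "iso_rel_pt `` {(S0, x0)} \<in> \<E>_plus R D U"
  obtains V where "openin immersive_topology_\<E> V" "iso_rel_pt `` {(S0, x0)} \<in> V"
    "\<forall>\<^sub>F A in nhds (mat 1). invertible A \<longrightarrow> (\<forall>P\<in>structures. \<forall>x\<in>topspace (surf P).
       iso_rel_pt `` {(P, x)} \<in> V \<longrightarrow> iso_rel_pt `` {(act A P, x)} \<in> \<E>_plus R D U)"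
proof -
  have UD: "U \<subseteq> D" by (rule order_trans[OF U(2) interior_of_subset])
  obtain h k d z0 where p: "parametrizes R D (cball (0::real^2) 1) h k d z0" and d0: "d z0 = 0"
    by (rule closed_disk_parametrization[OF R D])
  obtain \<gamma>0 where \<gamma>0: "lifts S0 (cball 0 1) d z0 \<gamma>0" "x0 \<in> \<gamma>0 ` {z \<in> cball 0 1. h z \<in> U}"
    using S0(3) \<E>_plus_iff[OF p S0(1,2) UD] by blast
  obtain V \<Omega> B f U' where V: "openin immersive_topology_\<M> V" "iso_rel `` {S0} \<in> V"
    "disk_model \<Omega> B f" "open U'" "U' \<subseteq> B" "\<exists>\<beta>. lifts S0 B f 0 \<beta> \<and> x0 \<in> \<beta> ` U'"
    "\<forall>\<^sub>F A in nhds (mat 1). invertible A \<longrightarrow> (\<forall>P\<in>structures. \<forall>x. iso_rel `` {P :: 'a pointed_structure} \<in> V \<longrightarrow>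
       (\<exists>\<beta>. lifts P B f 0 \<beta> \<and> x \<in> \<beta> ` U') \<longrightarrow>
       (\<exists>\<gamma>. lifts (act A P) (cball 0 1) d z0 \<gamma> \<and> x \<in> \<gamma> ` {z \<in> cball 0 1. h z \<in> U}))"
    by (rule near_id_plus[OF p d0 U S0(1) \<gamma>0])
  obtain W :: "('a pointed_structure \<times> 'a) set set" where W: "openin immersive_topology_\<E> W"
    "\<And>P x. P \<in> structures \<Longrightarrow> x \<in> topspace (surf P) \<Longrightarrow>
      iso_rel_pt `` {(P, x)} \<in> W \<longleftrightarrow> (\<exists>\<beta>. lifts P B f 0 \<beta> \<and> x \<in> \<beta> ` U')"
    using open_lifts_\<E>[OF S0(1) V(3-5)] by metis
  let ?V = "{e \<in> \<E>. proj_\<E> e \<in> V} \<inter> W"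
  have "openin immersive_topology_\<E> {e \<in> \<E>. proj_\<E> e \<in> V}" by (rule proj_preimage_open[OF V(1)])
  then have oV: "openin immersive_topology_\<E> ?V" using W(1) by blast
  have proj: "proj_\<E> (iso_rel_pt `` {(P, x)}) = iso_rel `` {P}" if "P \<in> structures" "x \<in> topspace (surf P)" for P :: "'a pointed_structure" and x
    using that by (intro proj_\<E>_class) (simp add: structures_pt_def)
  have in_V: "iso_rel_pt `` {(S0, x0)} \<in> ?V"
    using class_in_\<E>[OF S0(1,2)] proj[OF S0(1,2)] V(2,6) W(2)[OF S0(1,2)] by simp
  have "\<forall>\<^sub>F A in nhds (mat 1). invertible A \<longrightarrow> (\<forall>P\<in>structures. \<forall>x\<in>topspace (surf P).
       iso_rel_pt `` {(P, x)} \<in> ?V \<longrightarrow> iso_rel_pt `` {(act A P, x)} \<in> \<E>_plus R D U)"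
    using V(7)
  proof eventually_elim
    case (elim A)
    show ?case
    proof (intro impI ballI)
      fix P :: "'a pointed_structure" and x
      assume A: "invertible A" and P: "P \<in> structures" "x \<in> topspace (surf P)" "iso_rel_pt `` {(P, x)} \<in> ?V"
      have "\<exists>\<beta>. lifts P B f 0 \<beta> \<and> x \<in> \<beta> ` U'" using W(2)[OF P(1,2)] P(3) by blast
      moreover have "iso_rel `` {P} \<in> V" using P(3) proj[OF P(1,2)] by simp
      ultimately have "\<exists>\<gamma>. lifts (act A P) (cball 0 1) d z0 \<gamma> \<and> x \<in> \<gamma> ` {z \<in> cball 0 1. h z \<in> U}"
        using elim A P(1) by blast
      then show "iso_rel_pt `` {(act A P, x)} \<in> \<E>_plus R D U"
        using \<E>_plus_iff[OF p act_structures[OF A P(1)] _ UD] P(2) by simp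
    qed
  qed
  then show ?thesis by (rule that[OF oV in_V])
qed

section \<open>Continuity of the actions\<close>

text \<open>
  Writing \<open>A c = (A A0\<^sup>-\<^sup>1) (A0 c)\<close> reduces continuity at \<open>(A0, c0)\<close> to continuity at
  \<open>(1, A0 c0)\<close> and to the continuity of the single map given by \<open>A0\<close>. At the identity, neighbourhoods have to be
  found only for sets of a subbasis.
\<close>

lemma action_continuous:
  fixes \<alpha> :: "real^2^2 \<Rightarrow> 'b \<Rightarrow> 'b" and T :: "'b topology"
  assumes T: "T = topology_generated_by \<B>"
    and each: "\<And>A. invertible A \<Longrightarrow> continuous_map T T (\<alpha> A)"
    and comp: "\<And>A B c. invertible A \<Longrightarrow> invertible B \<Longrightarrow> c \<in> topspace T \<Longrightarrow> \<alpha> (A ** B) c = \<alpha> A (\<alpha> B c)"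
    and near: "\<And>W c. W \<in> \<B> \<Longrightarrow> c \<in> topspace T \<Longrightarrow> c \<in> W \<Longrightarrow> \<exists>V. openin T V \<and> c \<in> V \<and>
      (\<forall>\<^sub>F A in nhds (mat 1). invertible A \<longrightarrow> \<alpha> A ` V \<subseteq> W)"
  shows "continuous_map (prod_topology GL2 T) T (\<lambda>(A, c). \<alpha> A c)"
proof -
  have top: "topspace (prod_topology GL2 T) = {A. invertible A} \<times> topspace T" by (simp add: GL2_def)
  have \<alpha>T: "\<alpha> A c \<in> topspace T" if "invertible A" "c \<in> topspace T" for A c
    using continuous_map_image_subset_topspace[OF each[OF that(1)]] that(2) by blast
  have "openin (prod_topology GL2 T) ((\<lambda>(A, c). \<alpha> A c) -` W \<inter> topspace (prod_topology GL2 T))" if W: "W \<in> \<B>" for W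
    unfolding top
  proof (subst openin_prod_topology_alt, intro allI impI)
    fix A0 c0 assume "(A0, c0) \<in> (\<lambda>(A, c). \<alpha> A c) -` W \<inter> {A. invertible A} \<times> topspace T"
    then have A0: "invertible A0" "c0 \<in> topspace T" "\<alpha> A0 c0 \<in> W" by auto
    obtain V where V: "openin T V" "\<alpha> A0 c0 \<in> V" "\<forall>\<^sub>F A in nhds (mat 1). invertible A \<longrightarrow> \<alpha> A ` V \<subseteq> W"
      using near[OF W \<alpha>T[OF A0(1,2)] A0(3)] by blast
    obtain N where N: "open N" "mat 1 \<in> N" "\<And>A. A \<in> N \<Longrightarrow> invertible A \<Longrightarrow> \<alpha> A ` V \<subseteq> W"
      using V(3) unfolding eventually_nhds by blast
    have "continuous_on UNIV (\<lambda>A :: real^2^2. A ** matrix_inv A0)"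
      unfolding matrix_matrix_mult_def by (intro continuous_intros)
    then have "open ((\<lambda>A. A ** matrix_inv A0) -` N)" using N(1) by (intro open_vimage) auto
    then have oN: "openin GL2 ({A. invertible A} \<inter> (\<lambda>A. A ** matrix_inv A0) -` N)"
      unfolding GL2_def by (rule openin_open_Int)
    have oV: "openin T {c \<in> topspace T. \<alpha> A0 c \<in> V}"
      by (rule openin_continuous_map_preimage[OF each[OF A0(1)] V(1)])
    have "\<alpha> A c \<in> W" if A: "invertible A" "A ** matrix_inv A0 \<in> N" and c: "c \<in> topspace T" "\<alpha> A0 c \<in> V" for A c
    proof -
      have inv: "invertible (A ** matrix_inv A0)"
        using A(1) matrix_inv_works(5)[OF A0(1)] by (rule invertible_mult)
      have "(A ** matrix_inv A0) ** A0 = A"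
        using matrix_inv_works(2)[OF A0(1)] by (simp flip: matrix_mul_assoc)
      then have "\<alpha> A c = \<alpha> (A ** matrix_inv A0) (\<alpha> A0 c)" using comp[OF inv A0(1) c(1)] by simp
      then show ?thesis using N(3)[OF A(2) inv] c(2) by blast
    qed
    then have "({A. invertible A} \<inter> (\<lambda>A. A ** matrix_inv A0) -` N) \<times> {c \<in> topspace T. \<alpha> A0 c \<in> V}
        \<subseteq> (\<lambda>(A, c). \<alpha> A c) -` W \<inter> {A. invertible A} \<times> topspace T" by auto
    moreover have "A0 \<in> {A. invertible A} \<inter> (\<lambda>A. A ** matrix_inv A0) -` N"
      using A0(1) N(2) matrix_inv_works(1)[OF A0(1)] by simp
    moreover have "c0 \<in> {c \<in> topspace T. \<alpha> A0 c \<in> V}" using A0(2) V(2) by simp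
    ultimately show "\<exists>U V. openin GL2 U \<and> openin T V \<and> A0 \<in> U \<and> c0 \<in> V \<and>
        U \<times> V \<subseteq> (\<lambda>(A, c). \<alpha> A c) -` W \<inter> {A. invertible A} \<times> topspace T"
      using oN oV by blast
  qed
  moreover have "(\<lambda>(A, c). \<alpha> A c) ` topspace (prod_topology GL2 T) \<subseteq> \<Union>\<B>"
  proof -
    have "(\<lambda>(A, c). \<alpha> A c) ` ({A. invertible A} \<times> topspace T) \<subseteq> topspace T" using \<alpha>T by auto
    moreover have "topspace T = \<Union>\<B>" unfolding T by (rule topology_generated_by_topspace)
    ultimately show ?thesis unfolding top by (simp only:)
  qed
  ultimately have "continuous_map (prod_topology GL2 T) (topology_generated_by \<B>) (\<lambda>(A, c). \<alpha> A c)"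
    by (intro iffD2[OF continuous_on_generated_topo_iff]) blast
  then show ?thesis by (simp only: T[symmetric])
qed

lemma lifts_act_matrix:
  assumes A: "invertible A" and P: "P \<in> structures" and p: "parametrizes R D K h k d z0"
  shows "parametrizes (act (matrix_inv A) R) D K h k (\<lambda>z. matrix_inv A *v d z) z0"
    "lifts (act A P) K d z0 \<gamma> \<longleftrightarrow> lifts P K (\<lambda>z. matrix_inv A *v d z) z0 \<gamma>"
  by (rule parametrizes_act[OF matrix_inv_works(5)[OF A] p], rule lifts_act_iff[OF A P])

text \<open>
  A disk of \<open>R\<close> immerses in \<open>A P\<close> exactly when the same disk, as a subset of \<open>A\<^sup>-\<^sup>1 R\<close>, immerses in \<open>P\<close>.
\<close>

lemma act_\<M>_preimages:
  assumes A: "invertible A" and R: "R \<in> structures" and P: "P \<in> structures"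
  shows "closed_disk R D \<Longrightarrow> immerses R D (iso_rel `` {act A P}) \<longleftrightarrow> immerses (act (matrix_inv A) R) D (iso_rel `` {P})"
    "open_disk R D \<Longrightarrow> immerses R D (iso_rel `` {act A P}) \<longleftrightarrow> immerses (act (matrix_inv A) R) D (iso_rel `` {P})"
    "closed_disk R D \<Longrightarrow> U \<subseteq> D \<Longrightarrow> iso_rel `` {act A P} \<in> \<M>_plus R D U \<longleftrightarrow> iso_rel `` {P} \<in> \<M>_plus (act (matrix_inv A) R) D U"
    "closed_disk R D \<Longrightarrow> U \<subseteq> D \<Longrightarrow> iso_rel `` {act A P} \<in> \<M>_minus R D U \<longleftrightarrow> iso_rel `` {P} \<in> \<M>_minus (act (matrix_inv A) R) D U"
    "closed_disk R D \<Longrightarrow> U \<subseteq> D \<Longrightarrow> x \<in> topspace (surf P) \<Longrightarrow>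
       iso_rel_pt `` {(act A P, x)} \<in> \<E>_plus R D U \<longleftrightarrow> iso_rel_pt `` {(P, x)} \<in> \<E>_plus (act (matrix_inv A) R) D U"
proof -
  note Q = act_structures[OF A P]
  have imm: "immerses R D (iso_rel `` {act A P}) \<longleftrightarrow> immerses (act (matrix_inv A) R) D (iso_rel `` {P})"
    if p: "parametrizes R D K h k d z0" for K :: "(real^2) set" and h k d z0
    using immerses_iff[OF p Q] immerses_iff[OF lifts_act_matrix(1)[OF A P p] P] lifts_act_matrix(2)[OF A P p] by simp
  show "immerses R D (iso_rel `` {act A P}) \<longleftrightarrow> immerses (act (matrix_inv A) R) D (iso_rel `` {P})" if "closed_disk R D"
    using closed_disk_parametrization[OF R that] imm by metis
  show "immerses R D (iso_rel `` {act A P}) \<longleftrightarrow> immerses (act (matrix_inv A) R) D (iso_rel `` {P})" if "open_disk R D"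
    using open_disk_parametrization[OF R that] imm by metis
  assume D: "closed_disk R D" and U: "U \<subseteq> D"
  obtain h k d z0 where p: "parametrizes R D (cball (0::real^2) 1) h k d z0"
    using closed_disk_parametrization[OF R D] by metis
  note p' = lifts_act_matrix(1)[OF A P p] and l = lifts_act_matrix(2)[OF A P p]
  show "iso_rel `` {act A P} \<in> \<M>_plus R D U \<longleftrightarrow> iso_rel `` {P} \<in> \<M>_plus (act (matrix_inv A) R) D U"
    using \<M>_plus_iff[OF p Q U] \<M>_plus_iff[OF p' P U] l by simp
  show "iso_rel `` {act A P} \<in> \<M>_minus R D U \<longleftrightarrow> iso_rel `` {P} \<in> \<M>_minus (act (matrix_inv A) R) D U"
    using \<M>_minus_iff[OF p Q U] \<M>_minus_iff[OF p' P U] l by simp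
  assume x: "x \<in> topspace (surf P)"
  show "iso_rel_pt `` {(act A P, x)} \<in> \<E>_plus R D U \<longleftrightarrow> iso_rel_pt `` {(P, x)} \<in> \<E>_plus (act (matrix_inv A) R) D U"
    using \<E>_plus_iff[OF p Q _ U] \<E>_plus_iff[OF p' P x U] l x by simp
qed

lemma act_\<M>_in: "invertible A \<Longrightarrow> c \<in> \<M> \<Longrightarrow> act_\<M> A c \<in> \<M>"
  by (metis \<M>_classE act_\<M>_class act_structures class_in_\<M>)

lemma act_\<E>_class':
  assumes A: "invertible A" and P: "P \<in> structures" "x \<in> topspace (surf P)"
  shows "act_\<E> A (iso_rel_pt `` {(P, x)}) = iso_rel_pt `` {(act A P, x)}"
  using P by (intro act_\<E>_class[OF A]) (simp add: structures_pt_def)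

lemma proj_\<E>_class':
  assumes "P \<in> structures" "x \<in> topspace (surf P)"
  shows "proj_\<E> (iso_rel_pt `` {(P, x)}) = iso_rel `` {P}"
  using assms by (intro proj_\<E>_class) (simp add: structures_pt_def)

lemma act_\<E>_in:
  assumes A: "invertible A" and e: "e \<in> \<E>"
  shows "act_\<E> A e \<in> \<E>" "proj_\<E> (act_\<E> A e) = act_\<M> A (proj_\<E> e)"
proof -
  obtain P x where P: "P \<in> structures" "x \<in> topspace (surf P)" "e = iso_rel_pt `` {(P, x)}"
    by (rule \<E>_classE[OF e])
  have Q: "act A P \<in> structures" "x \<in> topspace (surf (act A P))" using act_structures[OF A P(1)] P(2) by simp_all
  show "act_\<E> A e \<in> \<E>" using act_\<E>_class'[OF A P(1,2)] class_in_\<E>[OF Q] P(3) by simp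
  show "proj_\<E> (act_\<E> A e) = act_\<M> A (proj_\<E> e)"
    using act_\<E>_class'[OF A P(1,2)] proj_\<E>_class'[OF Q] proj_\<E>_class'[OF P(1,2)] act_\<M>_class[OF A P(1)] P(3) by simp
qed

lemma act_\<M>_mult:
  assumes A: "invertible A" and B: "invertible B" and c: "c \<in> \<M>"
  shows "act_\<M> (A ** B) c = act_\<M> A (act_\<M> B c)"
proof -
  obtain P where P: "P \<in> structures" "c = iso_rel `` {P}" by (rule \<M>_classE[OF c])
  then show ?thesis
    using act_\<M>_class[OF invertible_mult[OF A B] P(1)] act_\<M>_class[OF B P(1)]
      act_\<M>_class[OF A act_structures[OF B P(1)]] act_compose[of A B P] by simp
qed

lemma act_\<E>_mult:
  assumes A: "invertible A" and B: "invertible B" and e: "e \<in> \<E>"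
  shows "act_\<E> (A ** B) e = act_\<E> A (act_\<E> B e)"
proof -
  obtain P x where P: "P \<in> structures" "x \<in> topspace (surf P)" "e = iso_rel_pt `` {(P, x)}"
    by (rule \<E>_classE[OF e])
  have Q: "act B P \<in> structures" "x \<in> topspace (surf (act B P))" using act_structures[OF B P(1)] P(2) by simp_all
  show ?thesis
    using act_\<E>_class'[OF invertible_mult[OF A B] P(1,2)] act_\<E>_class'[OF B P(1,2)]
      act_\<E>_class'[OF A Q] act_compose[of A B P] P(3) by simp
qed

lemma \<M>_preimage_eq:
  assumes A: "invertible A" and W': "W' \<subseteq> \<M>"
    and eq: "\<And>P. P \<in> structures \<Longrightarrow> iso_rel `` {act A P} \<in> W \<longleftrightarrow> iso_rel `` {P} \<in> W'"
  shows "act_\<M> A -` W \<inter> \<M> = W'"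
proof -
  have "act_\<M> A c \<in> W \<longleftrightarrow> c \<in> W'" if c: "c \<in> \<M>" for c
  proof -
    obtain P where P: "P \<in> structures" "c = iso_rel `` {P}" by (rule \<M>_classE[OF c])
    then show ?thesis using eq[OF P(1)] act_\<M>_class[OF A P(1)] by simp
  qed
  then show ?thesis using W' by auto
qed

lemma act_\<M>_continuous:
  assumes A: "invertible A"
  shows "continuous_map immersive_topology_\<M> (immersive_topology_\<M> :: 'a pointed_structure set topology) (act_\<M> A)"
proof -
  let ?T = "immersive_topology_\<M> :: 'a pointed_structure set topology"
  let ?B = "matrix_inv A"
  have B: "act ?B R \<in> structures" if "R \<in> structures" for R :: "'a pointed_structure"
    using act_structures[OF matrix_inv_works(5)[OF A] that] .
  have cd: "closed_disk (act ?B R) D \<longleftrightarrow> closed_disk R D" and od: "open_disk (act ?B R) D \<longleftrightarrow> open_disk R D"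
    for R :: "'a pointed_structure" and D by (simp_all add: closed_disk_def open_disk_def PC_def)
  have pre: "openin ?T (act_\<M> A -` W \<inter> topspace ?T)"
    if W: "W \<in> subbasis_\<M>" for W
    using W unfolding topspace_immersive_topology_\<M> subbasis_\<M>_def
  proof (elim insertE UnE CollectE exE conjE)
    assume "W = \<M>"
    then have "act_\<M> A -` W \<inter> \<M> = \<M>" using act_\<M>_in[OF A] by auto
    then show "openin ?T (act_\<M> A -` W \<inter> \<M>)" using openin_topspace[of ?T] by simp
  next
    fix R D assume W: "W = {c \<in> \<M>. immerses R D c}" and R: "R \<in> structures" "closed_disk R D"
    have "act_\<M> A -` W \<inter> \<M> = {c \<in> \<M>. immerses (act ?B R) D c}"
      by (rule \<M>_preimage_eq[OF A])
         (use act_\<M>_preimages(1)[OF A R(1) _ R(2)] W class_in_\<M> act_structures[OF A] in auto)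
    then show "openin ?T (act_\<M> A -` W \<inter> \<M>)" using \<M>_subbasis_open(1)[OF B[OF R(1)]] cd R(2) by simp
  next
    fix R D assume W: "W = {c \<in> \<M>. \<not> immerses R D c}" and R: "R \<in> structures" "open_disk R D"
    have "act_\<M> A -` W \<inter> \<M> = {c \<in> \<M>. \<not> immerses (act ?B R) D c}"
      by (rule \<M>_preimage_eq[OF A])
         (use act_\<M>_preimages(2)[OF A R(1) _ R(2)] W class_in_\<M> act_structures[OF A] in auto)
    then show "openin ?T (act_\<M> A -` W \<inter> \<M>)" using open_disk_subbasis_open[OF B[OF R(1)]] od R(2) by simp
  next
    fix R D U assume W: "W = \<M>_plus R D U" and R: "R \<in> structures" "closed_disk R D" "openin (surf R) U" "U \<subseteq> surf R interior_of D"
    have UD: "U \<subseteq> D" by (rule order_trans[OF R(4) interior_of_subset])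
    have "act_\<M> A -` W \<inter> \<M> = \<M>_plus (act ?B R) D U"
    proof (rule \<M>_preimage_eq[OF A])
      show "\<M>_plus (act ?B R) D U \<subseteq> \<M>" by (auto simp: \<M>_plus_def)
      show "iso_rel `` {act A P} \<in> W \<longleftrightarrow> iso_rel `` {P} \<in> \<M>_plus (act ?B R) D U" if "P \<in> structures" for P
        using act_\<M>_preimages(3)[OF A R(1) that R(2) UD] W by simp
    qed
    then show "openin ?T (act_\<M> A -` W \<inter> \<M>)" using \<M>_subbasis_open(2)[OF B[OF R(1)], of D U] cd R(2-4) by simp
  next
    fix R D U assume W: "W = \<M>_minus R D U" and R: "R \<in> structures" "closed_disk R D" "closedin (surf R) U" "U \<subseteq> D"
    have "act_\<M> A -` W \<inter> \<M> = \<M>_minus (act ?B R) D U"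
    proof (rule \<M>_preimage_eq[OF A])
      show "\<M>_minus (act ?B R) D U \<subseteq> \<M>" by (auto simp: \<M>_minus_def)
      show "iso_rel `` {act A P} \<in> W \<longleftrightarrow> iso_rel `` {P} \<in> \<M>_minus (act ?B R) D U" if "P \<in> structures" for P
        using act_\<M>_preimages(4)[OF A R(1) that R(2) R(4)] W by simp
    qed
    then show "openin ?T (act_\<M> A -` W \<inter> \<M>)" using \<M>_subbasis_open(3)[OF B[OF R(1)], of D U] cd R(2-4) by simp
  qed
  have im: "act_\<M> A ` topspace ?T \<subseteq> topspace ?T" using act_\<M>_in[OF A] by auto
  show ?thesis
  proof (subst (2) immersive_topology_\<M>_subbasis, rule iffD2[OF continuous_on_generated_topo_iff], intro conjI allI impI)
    show "openin ?T (act_\<M> A -` W \<inter> topspace ?T)" if "W \<in> subbasis_\<M>" for W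
      by (rule pre[OF that])
    have "\<M> \<in> subbasis_\<M>" by (simp add: subbasis_\<M>_def)
    then show "act_\<M> A ` topspace ?T \<subseteq> \<Union>subbasis_\<M>" using im by auto
  qed
qed

lemma near_id_act_\<M>:
  assumes V: "openin immersive_topology_\<M> V" "iso_rel `` {S0} \<in> V"
    "\<forall>\<^sub>F A in nhds (mat 1). invertible A \<longrightarrow> (\<forall>P\<in>structures. iso_rel `` {P} \<in> V \<longrightarrow> iso_rel `` {act A P} \<in> W)"
  shows "\<exists>V. openin immersive_topology_\<M> V \<and> iso_rel `` {S0} \<in> V \<and> (\<forall>\<^sub>F A in nhds (mat 1). invertible A \<longrightarrow> act_\<M> A ` V \<subseteq> W)"
proof -
  have VM: "V \<subseteq> \<M>" using openin_subset[OF V(1)] by simp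
  have "\<forall>\<^sub>F A in nhds (mat 1). invertible A \<longrightarrow> act_\<M> A ` V \<subseteq> W"
    using V(3)
  proof eventually_elim
    case (elim A)
    show ?case
    proof (intro impI subsetI)
      fix c' assume A: "invertible A" and "c' \<in> act_\<M> A ` V"
      then obtain c where c: "c \<in> V" "c' = act_\<M> A c" by blast
      then obtain P where P: "P \<in> structures" "c = iso_rel `` {P}" using VM \<M>_classE by blast
      then show "c' \<in> W" using elim A c act_\<M>_class[OF A P(1)] by simp
    qed
  qed
  then show ?thesis using V(1,2) by blast
qed

lemma continuous_action_\<M>:
  "continuous_map (prod_topology GL2 immersive_topology_\<M>)
     (immersive_topology_\<M> :: 'a pointed_structure set topology) (\<lambda>(A, S). act_\<M> A S)"
proof (rule action_continuous[OF immersive_topology_\<M>_subbasis act_\<M>_continuous])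
  show "act_\<M> (A ** B) c = act_\<M> A (act_\<M> B c)"
    if "invertible A" "invertible B" "c \<in> topspace immersive_topology_\<M>" for A B and c :: "'a pointed_structure set"
    using act_\<M>_mult[OF that(1,2)] that(3) by simp
  fix W and c :: "'a pointed_structure set"
  assume W: "W \<in> subbasis_\<M>"
    and c: "c \<in> topspace immersive_topology_\<M>" and cW: "c \<in> W"
  obtain S0 where S0: "S0 \<in> structures" and c_eq: "c = iso_rel `` {S0}" using c \<M>_classE by auto
  have S0W: "iso_rel `` {S0} \<in> W" using cW c_eq by simp
  have "\<exists>V. openin immersive_topology_\<M> V \<and> iso_rel `` {S0} \<in> V \<and>
      (\<forall>\<^sub>F A in nhds (mat 1). invertible A \<longrightarrow> (\<forall>P\<in>structures. iso_rel `` {P} \<in> V \<longrightarrow> iso_rel `` {act A P} \<in> W))"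
    using W unfolding subbasis_\<M>_def
  proof (elim insertE UnE CollectE exE conjE)
    assume "W = \<M>"
    then have "openin immersive_topology_\<M> W" "\<And>A P. invertible A \<Longrightarrow> P \<in> structures \<Longrightarrow> iso_rel `` {act A P} \<in> W"
      using openin_topspace[of immersive_topology_\<M>] class_in_\<M> act_structures by auto
    then show ?thesis using S0W by (intro exI[of _ W]) auto
  next
    fix R D assume W: "W = {c \<in> \<M>. immerses R D c}" and R: "R \<in> structures" "closed_disk R D"
    obtain V where V: "openin immersive_topology_\<M> V" "iso_rel `` {S0} \<in> V"
      "\<forall>\<^sub>F A in nhds (mat 1). invertible A \<longrightarrow> (\<forall>P\<in>structures. iso_rel `` {P} \<in> V \<longrightarrow> immerses R D (iso_rel `` {act A P}))"
      by (rule near_id_immerses[OF R S0]) (use S0W W in simp)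
    have "\<forall>\<^sub>F A in nhds (mat 1). invertible A \<longrightarrow> (\<forall>P\<in>structures. iso_rel `` {P} \<in> V \<longrightarrow> iso_rel `` {act A P} \<in> W)"
      using V(3) by eventually_elim (simp add: W class_in_\<M> act_structures)
    then show ?thesis using V(1,2) by blast
  next
    fix R U assume W: "W = {c \<in> \<M>. \<not> immerses R U c}" and R: "R \<in> structures" "open_disk R U"
    obtain V where V: "openin immersive_topology_\<M> V" "iso_rel `` {S0} \<in> V"
      "\<forall>\<^sub>F A in nhds (mat 1). invertible A \<longrightarrow> (\<forall>P\<in>structures. iso_rel `` {P} \<in> V \<longrightarrow> \<not> immerses R U (iso_rel `` {act A P}))"
      by (rule near_id_not_immerses[OF R S0]) (use S0W W in simp)
    have "\<forall>\<^sub>F A in nhds (mat 1). invertible A \<longrightarrow> (\<forall>P\<in>structures. iso_rel `` {P} \<in> V \<longrightarrow> iso_rel `` {act A P} \<in> W)"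
      using V(3) by eventually_elim (simp add: W class_in_\<M> act_structures)
    then show ?thesis using V(1,2) by blast
  next
    fix R D U assume W: "W = \<M>_plus R D U" and R: "R \<in> structures" "closed_disk R D" "openin (surf R) U" "U \<subseteq> surf R interior_of D"
    show ?thesis by (rule near_id_\<M>_plus[OF R S0 S0W[unfolded W]]) (unfold W, blast)
  next
    fix R D K assume W: "W = \<M>_minus R D K" and R: "R \<in> structures" "closed_disk R D" "closedin (surf R) K" "K \<subseteq> D"
    show ?thesis by (rule near_id_\<M>_minus[OF R S0 S0W[unfolded W]]) (unfold W, blast)
  qed
  then show "\<exists>V. openin immersive_topology_\<M> V \<and> c \<in> V \<and> (\<forall>\<^sub>F A in nhds (mat 1). invertible A \<longrightarrow> act_\<M> A ` V \<subseteq> W)"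
    unfolding c_eq using near_id_act_\<M> by blast
qed

lemma act_\<E>_continuous:
  assumes A: "invertible A"
  shows "continuous_map immersive_topology_\<E> (immersive_topology_\<E> :: ('a pointed_structure \<times> 'a) set topology) (act_\<E> A)"
proof -
  let ?T = "immersive_topology_\<E> :: ('a pointed_structure \<times> 'a) set topology"
  let ?B = "matrix_inv A"
  have pre: "openin ?T (act_\<E> A -` W \<inter> topspace ?T)"
    if W: "W \<in> subbasis_\<E>" for W
    using W unfolding topspace_immersive_topology_\<E> subbasis_\<E>_def
  proof (elim UnE CollectE exE conjE)
    fix W' assume W: "W = {e \<in> \<E>. proj_\<E> e \<in> W'}" and W': "openin immersive_topology_\<M> W'"
    have "act_\<E> A -` W \<inter> \<E> = {e \<in> \<E>. proj_\<E> e \<in> {c \<in> topspace immersive_topology_\<M>. act_\<M> A c \<in> W'}}"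
      using W act_\<E>_in[OF A] proj_\<E>_in_\<M> by auto
    then show "openin ?T (act_\<E> A -` W \<inter> \<E>)"
      using proj_preimage_open[OF openin_continuous_map_preimage[OF act_\<M>_continuous[OF A] W']] by simp
  next
    fix R D U assume W: "W = \<E>_plus R D U" and R: "R \<in> structures" "closed_disk R D" "openin (surf R) U" "U \<subseteq> surf R interior_of D"
    have UD: "U \<subseteq> D" by (rule order_trans[OF R(4) interior_of_subset])
    have "act_\<E> A e \<in> W \<longleftrightarrow> e \<in> \<E>_plus (act ?B R) D U" if e: "e \<in> \<E>" for e
    proof -
      obtain P x where P: "P \<in> structures" "x \<in> topspace (surf P)" "e = iso_rel_pt `` {(P, x)}"
        by (rule \<E>_classE[OF e])
      then show ?thesis
        using act_\<M>_preimages(5)[OF A R(1) P(1) R(2) UD P(2)] act_\<E>_class'[OF A P(1,2)] W by simp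
    qed
    moreover have "\<E>_plus (act ?B R) D U \<subseteq> \<E>" by (auto simp: \<E>_plus_def)
    ultimately have "act_\<E> A -` W \<inter> \<E> = \<E>_plus (act ?B R) D U" by blast
    moreover have "act ?B R \<in> structures" "closed_disk (act ?B R) D"
      using act_structures[OF matrix_inv_works(5)[OF A] R(1)] R(2) by (simp_all add: closed_disk_def)
    ultimately show "openin ?T (act_\<E> A -` W \<inter> \<E>)"
      using \<M>_subbasis_open(4)[of "act ?B R" D U] R(3,4) by simp
  qed
  have im: "act_\<E> A ` topspace ?T \<subseteq> topspace ?T" using act_\<E>_in[OF A] by auto
  show ?thesis
  proof (subst (2) immersive_topology_\<E>_subbasis, rule iffD2[OF continuous_on_generated_topo_iff], intro conjI allI impI)
    show "openin ?T (act_\<E> A -` W \<inter> topspace ?T)" if "W \<in> subbasis_\<E>" for W by (rule pre[OF that])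
    have "topspace ?T = \<Union>subbasis_\<E>"
      unfolding immersive_topology_\<E>_subbasis by (rule topology_generated_by_topspace)
    then show "act_\<E> A ` topspace ?T \<subseteq> \<Union>subbasis_\<E>" using im by (simp only:)
  qed
qed

text \<open>
  For the subbasic sets pulled back from \<open>\<M>\<close>, equivariance of the projection reduces the claim to
  the continuity of the action on \<open>\<M>\<close>.
\<close>

lemma continuous_action_\<E>:
  "continuous_map (prod_topology GL2 immersive_topology_\<E>)
     (immersive_topology_\<E> :: ('a pointed_structure \<times> 'a) set topology) (\<lambda>(A, e). act_\<E> A e)"
proof (rule action_continuous[OF immersive_topology_\<E>_subbasis act_\<E>_continuous])
  show "act_\<E> (A ** B) e = act_\<E> A (act_\<E> B e)"
    if "invertible A" "invertible B" "e \<in> topspace immersive_topology_\<E>" for A B and e :: "('a pointed_structure \<times> 'a) set"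
    using act_\<E>_mult[OF that(1,2)] that(3) by simp
  fix W and e :: "('a pointed_structure \<times> 'a) set"
  assume W: "W \<in> subbasis_\<E>"
    and e: "e \<in> topspace immersive_topology_\<E>" and eW: "e \<in> W"
  have eE: "e \<in> \<E>" using e by simp
  obtain S0 x0 where S0: "S0 \<in> structures" "x0 \<in> topspace (surf S0)" and e_eq: "e = iso_rel_pt `` {(S0, x0)}"
    by (rule \<E>_classE[OF eE])
  show "\<exists>V. openin immersive_topology_\<E> V \<and> e \<in> V \<and> (\<forall>\<^sub>F A in nhds (mat 1). invertible A \<longrightarrow> act_\<E> A ` V \<subseteq> W)"
    using W unfolding subbasis_\<E>_def
  proof (elim UnE CollectE exE conjE)
    fix W' assume W: "W = {e \<in> \<E>. proj_\<E> e \<in> W'}" and W': "openin immersive_topology_\<M> W'"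
    let ?pre = "{p \<in> topspace (prod_topology GL2 immersive_topology_\<M>). (\<lambda>(A, S). act_\<M> A S) p \<in> W'}"
    have "openin (prod_topology GL2 immersive_topology_\<M>) ?pre"
      by (rule openin_continuous_map_preimage[OF continuous_action_\<M> W'])
    moreover have "(mat 1, proj_\<E> e) \<in> ?pre"
    proof -
      have inv1: "invertible (mat 1 :: real^2^2)" unfolding invertible_def by (intro exI[of _ "mat 1"]) simp
      have "act_\<M> (mat 1) (proj_\<E> e) = proj_\<E> e"
        using act_\<M>_class[OF inv1 S0(1)] act_id[OF S0(1)] proj_\<E>_class'[OF S0] e_eq by simp
      then show ?thesis using inv1 eW W proj_\<E>_in_\<M>[OF eE] by (simp add: GL2_def)
    qed
    ultimately have "\<exists>N V. openin GL2 N \<and> openin immersive_topology_\<M> V \<and> mat 1 \<in> N \<and> proj_\<E> e \<in> V \<and> N \<times> V \<subseteq> ?pre"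
      by (rule iffD1[OF openin_prod_topology_alt, rule_format])
    then obtain N V where NV: "openin GL2 N" "openin immersive_topology_\<M> V" "mat 1 \<in> N" "proj_\<E> e \<in> V" "N \<times> V \<subseteq> ?pre"
      by (elim exE conjE)
    obtain N' where N': "open N'" "N = {A. invertible A} \<inter> N'" using NV(1) unfolding GL2_def by (auto simp: openin_open)
    have "\<forall>\<^sub>F A in nhds (mat 1). A \<in> N'" using N' NV(3) by (intro eventually_nhds_in_open) auto
    then have "\<forall>\<^sub>F A in nhds (mat 1). invertible A \<longrightarrow> act_\<E> A ` {e \<in> \<E>. proj_\<E> e \<in> V} \<subseteq> W"
    proof eventually_elim
      case (elim A)
      show ?case
      proof clarify
        fix e' assume A: "invertible A" and e': "e' \<in> \<E>" "proj_\<E> e' \<in> V"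
        then have "(A, proj_\<E> e') \<in> ?pre" using NV(5) N'(2) elim by blast
        then show "act_\<E> A e' \<in> W" using W act_\<E>_in[OF A e'(1)] by simp
      qed
    qed
    then show ?thesis
      using proj_preimage_open[OF NV(2)] NV(4) eE by (intro exI[of _ "{e \<in> \<E>. proj_\<E> e \<in> V}"]) simp
  next
    fix R D U assume W: "W = \<E>_plus R D U" and R: "R \<in> structures" "closed_disk R D" "openin (surf R) U" "U \<subseteq> surf R interior_of D"
    have S0W: "iso_rel_pt `` {(S0, x0)} \<in> \<E>_plus R D U" using eW e_eq W by simp
    obtain V where V: "openin immersive_topology_\<E> V" "iso_rel_pt `` {(S0, x0)} \<in> V"
      "\<forall>\<^sub>F A in nhds (mat 1). invertible A \<longrightarrow> (\<forall>P\<in>structures. \<forall>x\<in>topspace (surf P).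
         iso_rel_pt `` {(P, x)} \<in> V \<longrightarrow> iso_rel_pt `` {(act A P, x)} \<in> \<E>_plus R D U)"
      by (rule near_id_\<E>_plus[OF R S0 S0W])
    have VE: "V \<subseteq> \<E>" using openin_subset[OF V(1)] by simp
    have "\<forall>\<^sub>F A in nhds (mat 1). invertible A \<longrightarrow> act_\<E> A ` V \<subseteq> W"
      using V(3)
    proof eventually_elim
      case (elim A)
      show ?case
      proof clarify
        fix e' assume A: "invertible A" and e': "e' \<in> V"
        then have "e' \<in> \<E>" using VE by blast
        then obtain P x where P: "P \<in> structures" "x \<in> topspace (surf P)" "e' = iso_rel_pt `` {(P, x)}"
          by (rule \<E>_classE)
        then show "act_\<E> A e' \<in> W" using elim A e' act_\<E>_class'[OF A P(1,2)] W by simp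
      qed
    qed
    then show ?thesis using V(1,2) unfolding e_eq by blast
  qed
qed

theorem theorem12:
  shows "continuous_map (prod_topology GL2 immersive_topology_\<M>)
           (immersive_topology_\<M> :: 'a pointed_structure set topology)
           (\<lambda>(A, S). act_\<M> A S) \<and>
         continuous_map (prod_topology GL2 immersive_topology_\<E>)
           (immersive_topology_\<E> :: ('a pointed_structure \<times> 'a) set topology)
           (\<lambda>(A, e). act_\<E> A e)"
  using continuous_action_\<M> continuous_action_\<E> by (rule conjI)

end
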